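(* Let $P$ be a non-abelian finite $p$-group, $p$ a prime. Then $P$ is a $\mathbf{GC}^*$-group if and only if $\mathbf{Z}(P)$ is cyclic and $|P'| = p$.
   Context: Galois automorphisms act on characters by $\chi^\alpha(g)=\chi(g)^\alpha$; two irreducible characters of $G$ are Galois conjugate if one is the image of the other under some element of $\mathrm{Gal}(\mathbb{Q}_n|\mathbb{Q})$ with $|G|$ dividing $n$. A finite group is a $\mathbf{GC}^*$-group if any two of its non-linear irreducible characters of the same degree are Galois conjugate. *)

theory Defs
  imports "HOL-Algebra.Generated_Groups" "Jordan_Normal_Form.Matrix" "HOL-Computational_Algebra.Polynomial"
begin

text \<open>A complex representation of degree d of the group G: a homomorphism
  from G into the invertible d x d complex matrices (multiplicativity and
  identity-preservation imply invertibility).\<close>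
definition is_rep :: "('a, 'b) monoid_scheme \<Rightarrow> nat \<Rightarrow> ('a \<Rightarrow> complex mat) \<Rightarrow> bool" where
  "is_rep G d \<rho> \<longleftrightarrow> 0 < d \<and>
     (\<forall>g \<in> carrier G. \<rho> g \<in> carrier_mat d d) \<and>
     (\<forall>g \<in> carrier G. \<forall>h \<in> carrier G. \<rho> (g \<otimes>\<^bsub>G\<^esub> h) = \<rho> g * \<rho> h) \<and>
     \<rho> \<one>\<^bsub>G\<^esub> = 1\<^sub>m d"

definition is_subspace :: "nat \<Rightarrow> complex vec set \<Rightarrow> bool" where
  "is_subspace d W \<longleftrightarrow> W \<subseteq> carrier_vec d \<and> 0\<^sub>v d \<in> W \<and>
     (\<forall>v \<in> W. \<forall>w \<in> W. v + w \<in> W) \<and> (\<forall>c. \<forall>v \<in> W. c \<cdot>\<^sub>v v \<in> W)"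

definition is_irr_rep :: "('a, 'b) monoid_scheme \<Rightarrow> nat \<Rightarrow> ('a \<Rightarrow> complex mat) \<Rightarrow> bool" where
  "is_irr_rep G d \<rho> \<longleftrightarrow> is_rep G d \<rho> \<and>
     (\<forall>W. is_subspace d W \<and> (\<forall>g \<in> carrier G. \<forall>w \<in> W. \<rho> g *\<^sub>v w \<in> W)
          \<longrightarrow> W = {0\<^sub>v d} \<or> W = carrier_vec d)"

definition mat_trace :: "complex mat \<Rightarrow> complex" where
  "mat_trace A = (\<Sum>i < dim_row A. A $$ (i, i))"

definition irr_char :: "('a, 'b) monoid_scheme \<Rightarrow> ('a \<Rightarrow> complex) \<Rightarrow> bool" where
  "irr_char G \<chi> \<longleftrightarrow> (\<exists>d \<rho>. is_irr_rep G d \<rho> \<and> (\<forall>g \<in> carrier G. \<chi> g = mat_trace (\<rho> g)))"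

definition cyclotomic_field :: "nat \<Rightarrow> complex set" where
  "cyclotomic_field n = {poly (map_poly of_rat p) (cis (2 * pi / real n)) | p. True}"

definition gal_cyclotomic :: "nat \<Rightarrow> (complex \<Rightarrow> complex) set" where
  "gal_cyclotomic n = {\<sigma>. bij_betw \<sigma> (cyclotomic_field n) (cyclotomic_field n) \<and>
     (\<forall>x \<in> cyclotomic_field n. \<forall>y \<in> cyclotomic_field n.
        \<sigma> (x + y) = \<sigma> x + \<sigma> y \<and> \<sigma> (x * y) = \<sigma> x * \<sigma> y) \<and> \<sigma> 1 = 1}"

definition galois_conjugate :: "('a, 'b) monoid_scheme \<Rightarrow> ('a \<Rightarrow> complex) \<Rightarrow> ('a \<Rightarrow> complex) \<Rightarrow> bool" where
  "galois_conjugate G \<chi> \<psi> \<longleftrightarrow>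
     (\<exists>n \<sigma>. 0 < n \<and> card (carrier G) dvd n \<and> \<sigma> \<in> gal_cyclotomic n \<and>
        (\<forall>g \<in> carrier G. \<psi> g = \<sigma> (\<chi> g)))"

definition GC_star :: "('a, 'b) monoid_scheme \<Rightarrow> bool" where
  "GC_star G \<longleftrightarrow> (\<forall>\<chi> \<psi>. irr_char G \<chi> \<and> irr_char G \<psi> \<and>
       \<chi> \<one>\<^bsub>G\<^esub> \<noteq> 1 \<and> \<psi> \<one>\<^bsub>G\<^esub> \<noteq> 1 \<and> \<chi> \<one>\<^bsub>G\<^esub> = \<psi> \<one>\<^bsub>G\<^esub>
       \<longrightarrow> galois_conjugate G \<chi> \<psi>)"

definition group_center :: "('a, 'b) monoid_scheme \<Rightarrow> 'a set" where
  "group_center G = {z \<in> carrier G. \<forall>g \<in> carrier G. z \<otimes>\<^bsub>G\<^esub> g = g \<otimes>\<^bsub>G\<^esub> z}"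

definition cyclic_subset :: "('a, 'b) monoid_scheme \<Rightarrow> 'a set \<Rightarrow> bool" where
  "cyclic_subset G H \<longleftrightarrow> (\<exists>z \<in> H. H = generate G {z})"

end

theory Submission
  imports Defs "Jordan_Normal_Form.Spectral_Radius" "Berlekamp_Zassenhaus.Factor_Bound"
    "HOL-Algebra.Group_Action" "HOL-Number_Theory.Cong"
begin

text \<open>
  Let \<open>G\<close> be a \<open>p\<close>-group all of whose nonlinear irreducible characters of equal degree are Galois
  conjugate. Galois conjugate characters have the same kernel, and twisting by linear characters
  shows that kernels of nonlinear characters lie in \<open>G'\<close>. A representation in which all
  commutators are scalar has a character vanishing off the group of scalar elements \<open>S\<close>, and so has
  degree \<open>d\<close> with \<open>d\<^sup>2 |S| = |G|\<close>.

  If \<open>|G'| > p\<close>, pass to a quotient with \<open>|G'| = p\<^sup>2\<close>, choose \<open>N \<le> G' \<inter> Z(G)\<close> of order \<open>p\<close>, and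
  compare a nonlinear representation of \<open>G/N\<close> of degree \<open>d\<close>, whose scalar elements \<open>K\<close> satisfy
  \<open>|K : Z(G)| \<le> p\<close>, with one of degree \<open>e\<close> that is nontrivial on \<open>N\<close>. If \<open>G'\<close> is central, the
  degree formula gives \<open>e\<^sup>2 \<in> {d\<^sup>2, p d\<^sup>2, d\<^sup>2/p}\<close>, so \<open>e = d\<close>. Otherwise the centralizer \<open>C\<close> of
  \<open>G'\<close> has index \<open>p\<close> and \<open>C' \<le> N\<close>; this bounds \<open>d\<close> by \<open>p\<close>, forces \<open>C\<close> to be abelian, and again
  \<open>e = d = p\<close>. Both cases contradict that the two kernels differ. Hence \<open>|G'| = p\<close>, and then a
  nonlinear representation is faithful on \<open>Z(G)\<close>, which is therefore cyclic.

  Conversely, if \<open>|G'| = p\<close> and \<open>Z(G)\<close> is cyclic, a nonlinear irreducible character is determined by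
  its degree and its faithful central character; two such central characters are Galois
  conjugate because the cyclotomic polynomial of prime power order is irreducible.
\<close>

section \<open>Galois automorphisms of prime power cyclotomic fields\<close>

hide_const (open) up_ring.coeff up_ring.monom

text \<open>Representations are matrices throughout, and three tools suffice: Schur's lemma, the
  norm relation of a single irreducible character, and an irreducible constituent inside a given
  invariant subspace. Complete reducibility and orthogonality of distinct characters never enter.
  Kernels are compared only at elements acting as scalars, where a character value is the degree
  times an eigenvalue and automorphisms fix the degree. Order p squared is the smallest for G' at
  which two kinds of nonlinear representation coexist: one trivial on N that still sees G'/N, and
  one that sees N. As they cannot be conjugate, it suffices that their degrees agree. If G' is
  central, the squares of the degrees differ at most by a factor p, which is not a square. In the
  converse the field is generated by a root of unity of order |G|, a prime power, so Eisenstein's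
  criterion after the shift X + 1 supplies the automorphisms.\<close>

lemma dvd_power_diff:
  fixes x y :: "'a :: comm_ring_1"
  assumes "m dvd x - y"
  shows "m dvd x ^ k - y ^ k"
proof (induction k)
  case (Suc k)
  have "x ^ Suc k - y ^ Suc k = x * (x ^ k - y ^ k) + (x - y) * y ^ k"
    by (simp add: algebra_simps)
  then show ?case using Suc assms by (simp add: dvd_add dvd_mult dvd_mult2)
qed simp

text \<open>Frobenius additivity modulo p, phrased as divisibility by \<open>of_nat p\<close> so
  that it applies directly to integer polynomials, with no quotient ring.\<close>

lemma prime_dvd_binomial_power_diff:
  fixes u v :: "'a :: comm_ring_1"
  assumes "prime p"
  shows "of_nat p dvd (u + v) ^ p - u ^ p - v ^ p"
proof -
  have p: "p > 0" using assms prime_gt_0_nat by blast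
  let ?t = "\<lambda>k. of_nat (p choose k) * u ^ k * v ^ (p - k)"
  have "(u + v) ^ p = (\<Sum>k\<le>p. ?t k)" by (rule binomial_ring)
  also have "{..p} = insert 0 (insert p {0<..<p})" using p by auto
  also have "sum ?t \<dots> = v ^ p + u ^ p + sum ?t {0<..<p}" using p by (simp add: add.assoc)
  finally have "(u + v) ^ p - u ^ p - v ^ p = sum ?t {0<..<p}" by simp
  moreover have "of_nat p dvd ?t k" if k: "k \<in> {0<..<p}" for k
  proof -
    have "p dvd (p choose k)" using k assms by (intro dvd_choose_prime) auto
    then have "(of_nat p :: 'a) dvd of_nat (p choose k)" by auto
    then show ?thesis by (simp add: dvd_mult2 mult.assoc)
  qed
  ultimately show ?thesis by (metis (no_types, lifting) dvd_sum)
qed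

lemma prime_dvd_binomial_prime_power_diff:
  fixes u :: "'a :: comm_ring_1"
  assumes "prime p"
  shows "of_nat p dvd (u + 1) ^ (p ^ j) - u ^ (p ^ j) - 1"
proof (induction j)
  case (Suc j)
  let ?w = "u ^ (p ^ j)"
  have "of_nat p dvd (u + 1) ^ (p ^ j) - (?w + 1)" using Suc by (simp add: algebra_simps)
  then have "of_nat p dvd ((u + 1) ^ (p ^ j)) ^ p - (?w + 1) ^ p" by (rule dvd_power_diff)
  moreover have "of_nat p dvd (?w + 1) ^ p - ?w ^ p - 1 ^ p"
    by (rule prime_dvd_binomial_power_diff[OF assms])
  ultimately have "of_nat p dvd (((u + 1) ^ (p ^ j)) ^ p - (?w + 1) ^ p) + ((?w + 1) ^ p - ?w ^ p - 1 ^ p)"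
    by (rule dvd_add)
  also have "(((u + 1) ^ (p ^ j)) ^ p - (?w + 1) ^ p) + ((?w + 1) ^ p - ?w ^ p - 1 ^ p) = (u + 1) ^ (p ^ Suc j) - u ^ (p ^ Suc j) - 1"
    by (simp add: power_mult[symmetric] mult.commute)
  finally show ?case .
qed simp

text \<open>At the least index \<open>i\<close> with p not dividing \<open>coeff f i\<close>, the
  product has the coefficient \<open>coeff f i * coeff g 0\<close> modulo p, which is nonzero. Hence
  \<open>i\<close> is not below \<open>degree (f * g)\<close>, and as
  \<open>i \<le> degree f\<close> no degree is left for \<open>g\<close>.\<close>

lemma eisenstein_factor_constant:
  fixes f g :: "int poly" and p :: int
  assumes p: "prime p" and lead: "\<not> p dvd lead_coeff (f * g)"
    and low: "\<And>i. i < degree (f * g) \<Longrightarrow> p dvd coeff (f * g) i"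
    and g0: "\<not> p dvd coeff g 0"
  shows "degree g = 0"
proof -
  have nz: "f \<noteq> 0" "g \<noteq> 0" using lead by auto
  have lf: "\<not> p dvd lead_coeff f" using lead by (auto simp: lead_coeff_mult dvd_mult2)
  define i where "i = (LEAST i. \<not> p dvd coeff f i)"
  have i: "\<not> p dvd coeff f i" unfolding i_def using lf by (rule LeastI)
  have min: "p dvd coeff f j" if "j < i" for j using not_less_Least[of j] that unfolding i_def by blast
  have "i \<le> degree f" unfolding i_def using lf by (rule Least_le)
  have "coeff (f * g) i = (\<Sum>j\<le>i. coeff f j * coeff g (i - j))" by (rule coeff_mult)
  also have "\<dots> = (\<Sum>j<i. coeff f j * coeff g (i - j)) + coeff f i * coeff g 0"
    by (simp add: lessThan_Suc_atMost[symmetric])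
  finally have eq: "coeff (f * g) i = (\<Sum>j<i. coeff f j * coeff g (i - j)) + coeff f i * coeff g 0" .
  have "p dvd (\<Sum>j<i. coeff f j * coeff g (i - j))" using min by (intro dvd_sum) (auto simp: dvd_mult2)
  moreover have "\<not> p dvd coeff f i * coeff g 0" using i g0 p by (simp add: prime_dvd_mult_iff)
  ultimately have "\<not> p dvd coeff (f * g) i" unfolding eq by (simp add: dvd_add_right_iff)
  then have "degree (f * g) \<le> i" using low by (meson not_less)
  then show ?thesis using \<open>i \<le> degree f\<close> nz by (simp add: degree_mult_eq)
qed

lemma eisenstein:
  fixes f g :: "int poly" and p :: int
  assumes p: "prime p" and lead: "\<not> p dvd lead_coeff (f * g)"
    and low: "\<And>i. i < degree (f * g) \<Longrightarrow> p dvd coeff (f * g) i"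
    and c0: "\<not> p ^ 2 dvd coeff (f * g) 0"
  shows "degree f = 0 \<or> degree g = 0"
proof -
  have "\<not> (p dvd coeff f 0 \<and> p dvd coeff g 0)"
    using c0 by (auto simp: coeff_mult_0 power2_eq_square mult_dvd_mono)
  then show ?thesis
    using eisenstein_factor_constant[of p f g] eisenstein_factor_constant[of p g f] assms by (auto simp: mult.commute)
qed

text \<open>The cyclotomic polynomial of order \<open>p ^ (a + 1)\<close>, not \<open>p ^ a\<close>.\<close>

definition prime_power_cyclotomic :: "nat \<Rightarrow> nat \<Rightarrow> int poly" where
  "prime_power_cyclotomic p a = (\<Sum>i<p. ([:0, 1:] ^ (p ^ a)) ^ i)"

lemma prime_power_cyclotomic_mult:
  "prime_power_cyclotomic p a * ([:0, 1:] ^ (p ^ a) - 1) = [:0, 1:] ^ (p ^ Suc a) - 1"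
proof -
  have "[:0, 1:] ^ (p ^ Suc a) = (([:0, 1:] :: int poly) ^ (p ^ a)) ^ p" by (simp only: power_Suc2 power_mult)
  then show ?thesis unfolding prime_power_cyclotomic_def
    by (metis mult.commute power_diff_1_eq)
qed

lemma X_power_minus_1:
  assumes "m > 0"
  shows "degree ([:0, 1:] ^ m - 1 :: int poly) = m" "lead_coeff ([:0, 1:] ^ m - 1 :: int poly) = 1"
proof -
  have eq: "[:0, 1:] ^ m - 1 = monom (1::int) m - 1" by (simp add: monom_altdef)
  show d: "degree ([:0, 1:] ^ m - 1 :: int poly) = m" unfolding eq
    using assms by (metis degree_1 degree_monom_eq degree_minus degree_add_eq_left diff_conv_add_uminus zero_neq_one)
  show "lead_coeff ([:0, 1:] ^ m - 1 :: int poly) = 1"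
    unfolding d unfolding eq using assms by simp
qed

lemma prime_power_cyclotomic_degree:
  assumes "prime p"
  shows "degree (prime_power_cyclotomic p a) = p ^ Suc a - p ^ a" "lead_coeff (prime_power_cyclotomic p a) = 1"
proof -
  let ?F = "prime_power_cyclotomic p a" and ?D = "[:0, 1:] ^ (p ^ a) - 1 :: int poly"
  have p0: "p ^ a > 0" "p ^ Suc a > 0" using assms prime_gt_0_nat by auto
  note X1 = X_power_minus_1[OF p0(1)] and X2 = X_power_minus_1[OF p0(2)]
  have "?F \<noteq> 0" using prime_power_cyclotomic_mult[of p a] X2 by fastforce
  moreover have "?D \<noteq> 0" using X1 by fastforce
  ultimately show "degree ?F = p ^ Suc a - p ^ a"
    using degree_mult_eq[of ?F ?D] X1 X2 prime_power_cyclotomic_mult[of p a] by simp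
  show "lead_coeff ?F = 1" using lead_coeff_mult[of ?F ?D] X1 X2 prime_power_cyclotomic_mult[of p a] by simp
qed

text \<open>Substituting X + 1 makes Eisenstein's criterion applicable: modulo p,
  \<open>(X + 1) ^ (p ^ j) - 1\<close> becomes \<open>X ^ (p ^ j)\<close>, so the shifted cyclotomic
  polynomial is congruent to a power of X, and its value at 0 is p.\<close>

lemma prime_power_cyclotomic_factor:
  assumes p: "prime p" and FG: "prime_power_cyclotomic p a = F * G"
  shows "degree F = 0 \<or> degree G = 0"
proof -
  let ?Y = "[:1, 1:] :: int poly" and ?X = "[:0, 1:] :: int poly"
  let ?f = "F \<circ>\<^sub>p ?Y" and ?g = "G \<circ>\<^sub>p ?Y" and ?P = "prime_power_cyclotomic p a"
  have P1: "?f * ?g = ?P \<circ>\<^sub>p ?Y" using FG by (simp add: pcompose_mult)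
  have deg: "degree (?f * ?g) = p ^ Suc a - p ^ a" unfolding P1
    using prime_power_cyclotomic_degree[OF p, of a] by (simp add: degree_pcompose)
  have lead: "lead_coeff (?f * ?g) = 1" unfolding P1
    using prime_power_cyclotomic_degree[OF p, of a] by (subst lead_coeff_comp) auto
  have sum: "?P \<circ>\<^sub>p ?Y = (\<Sum>i<p. (?Y ^ (p ^ a)) ^ i)"
    unfolding prime_power_cyclotomic_def
    by (simp add: pcompose_sum pcompose_hom.hom_power pcompose_pCons)
  have c0: "coeff (?f * ?g) 0 = int p"
  proof -
    have "coeff (?f * ?g) 0 = poly (?P \<circ>\<^sub>p ?Y) 0" unfolding P1 by (simp add: poly_0_coeff_0)
    also have "\<dots> = int p" unfolding sum by (simp add: poly_sum)
    finally show ?thesis .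
  qed
  have Y: "?Y = ?X + 1" by (rule poly_eqI) (simp add: coeff_pCons split: nat.split)
  have mult: "?f * ?g * (?Y ^ (p ^ a) - 1) = ?Y ^ (p ^ Suc a) - 1"
  proof -
    have "?Y ^ (p ^ Suc a) = (?Y ^ (p ^ a)) ^ p" by (simp only: power_Suc2 power_mult)
    then show ?thesis unfolding P1 sum by (metis mult.commute power_diff_1_eq)
  qed
  have "of_nat p dvd ?Y ^ (p ^ a) - ?X ^ (p ^ a) - 1" "of_nat p dvd ?Y ^ (p ^ Suc a) - ?X ^ (p ^ Suc a) - 1"
    unfolding Y by (rule prime_dvd_binomial_prime_power_diff[OF p])+
  then have "of_nat p dvd (?Y ^ (p ^ Suc a) - ?X ^ (p ^ Suc a) - 1) - ?f * ?g * (?Y ^ (p ^ a) - ?X ^ (p ^ a) - 1)"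
    by (meson dvd_diff dvd_mult)
  also have "(?Y ^ (p ^ Suc a) - ?X ^ (p ^ Suc a) - 1) - ?f * ?g * (?Y ^ (p ^ a) - ?X ^ (p ^ a) - 1)
     = ?f * ?g * ?X ^ (p ^ a) - ?X ^ (p ^ Suc a)"
    using mult by (simp add: algebra_simps)
  finally have "of_nat p dvd ?f * ?g * monom 1 (p ^ a) - monom 1 (p ^ Suc a)" by (simp add: monom_altdef)
  then obtain r where r: "?f * ?g * monom 1 (p ^ a) - monom 1 (p ^ Suc a) = of_nat p * r" by (elim dvdE)
  have low: "int p dvd coeff (?f * ?g) i" if i: "i < degree (?f * ?g)" for i
  proof -
    have "p ^ Suc a \<ge> p ^ a" using p prime_gt_0_nat[of p] by simp
    then have "i + p ^ a \<noteq> p ^ Suc a" using i deg by linarith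
    \<comment> \<open>Instead of dividing by \<open>X ^ (p ^ a)\<close>, coefficient
      \<open>i\<close> is read off at position \<open>i + p ^ a\<close>, which the monomial of
      degree \<open>p ^ Suc a\<close> does not touch.\<close>
    then have "coeff (?f * ?g) i = coeff (of_nat p * r) (i + p ^ a)"
      unfolding r[symmetric] by (simp add: mult.commute[of _ "monom 1 (p ^ a)"] coeff_monom_mult)
    then show ?thesis by (simp add: of_nat_poly)
  qed
  have "\<not> int p ^ 2 dvd int p"
  proof
    assume "int p ^ 2 dvd int p"
    then have "int p ^ 2 \<le> int p" using p prime_gt_0_nat by (intro zdvd_imp_le) auto
    then show False using prime_gt_1_nat[OF p] by (simp add: power2_eq_square)
  qed
  then have "degree ?f = 0 \<or> degree ?g = 0"
    using eisenstein[of "int p" ?f ?g] p lead low c0 prime_gt_1_nat[OF p] by auto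
  then show ?thesis by (simp add: degree_pcompose)
qed

interpretation of_rat_poly_hom: map_poly_comm_ring_hom of_rat ..

lemma poly_of_rat_of_int:
  "poly (map_poly of_rat (of_int_poly q)) (x :: complex) = poly (of_int_poly q) x"
proof -
  have "map_poly of_rat (of_int_poly q) = (of_int_poly q :: complex poly)"
    by (rule poly_eqI) (simp add: coeff_map_poly)
  then show ?thesis by simp
qed

lemma prime_power_cyclotomic_root:
  fixes z :: complex
  assumes "z ^ (p ^ Suc a) = 1" "z ^ (p ^ a) \<noteq> 1"
  shows "poly (map_poly of_rat (of_int_poly (prime_power_cyclotomic p a))) z = 0"
proof -
  have "of_int_poly (prime_power_cyclotomic p a * ([:0, 1:] ^ (p ^ a) - 1)) = (of_int_poly ([:0, 1:] ^ (p ^ Suc a) - 1) :: complex poly)"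
    by (simp only: prime_power_cyclotomic_mult)
  then have "poly (of_int_poly (prime_power_cyclotomic p a * ([:0, 1:] ^ (p ^ a) - 1))) z = poly (of_int_poly ([:0, 1:] ^ (p ^ Suc a) - 1)) z"
    by simp
  then have "poly (of_int_poly (prime_power_cyclotomic p a)) z * (z ^ (p ^ a) - 1) = z ^ (p ^ Suc a) - 1"
    by (simp add: of_int_poly_hom.hom_mult of_int_poly_hom.hom_power of_int_poly_hom.hom_minus)
  then show ?thesis using assms by (simp add: poly_of_rat_of_int)
qed

text \<open>A rational minimal polynomial of \<open>z\<close> divides the cyclotomic polynomial;
  Gauss's lemma turns this into an integer factorization, so by irreducibility the cofactor is
  constant. The minimal polynomial therefore vanishes at \<open>z'\<close> too, and it divides
  \<open>f\<close>.\<close>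

lemma primitive_root_conjugate:
  fixes z z' :: complex
  assumes p: "prime p" and z: "z ^ (p ^ Suc a) = 1" "z ^ (p ^ a) \<noteq> 1"
    and z': "z' ^ (p ^ Suc a) = 1" "z' ^ (p ^ a) \<noteq> 1"
    and f: "poly (map_poly of_rat f) z = 0"
  shows "poly (map_poly of_rat f) z' = 0"
proof -
  let ?Q = "of_int_poly (prime_power_cyclotomic p a) :: rat poly"
  let ?e = "\<lambda>q z. poly (map_poly of_rat q) z :: complex"
  have [simp]: "?e (q * r) x = ?e q x * ?e r x" "?e (q + r) x = ?e q x + ?e r x" for q r x
    by (simp_all add: of_rat_poly_hom.hom_mult of_rat_poly_hom.hom_add)
  have Q0: "?Q \<noteq> 0" using prime_power_cyclotomic_degree(2)[OF p, of a] by fastforce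
  obtain b where b: "b \<noteq> 0" "?e b z = 0" and min: "\<And>q. q \<noteq> 0 \<Longrightarrow> ?e q z = 0 \<Longrightarrow> degree b \<le> degree q"
    using ex_has_least_nat[of "\<lambda>q. q \<noteq> 0 \<and> ?e q z = 0" ?Q degree] Q0 prime_power_cyclotomic_root[OF z] by blast
  have dvd: "b dvd q" if "?e q z = 0" for q
  proof -
    have "?e q z = ?e (q div b) z * ?e b z + ?e (q mod b) z"
      by (metis \<open>\<And>x r q. ?e (q * r) x = ?e q x * ?e r x\<close> \<open>\<And>x r q. ?e (q + r) x = ?e q x + ?e r x\<close> div_mult_mod_eq)
    then have "?e (q mod b) z = 0" using that b by simp
    then have "q mod b = 0" using min[of "q mod b"] degree_mod_less[OF b(1), of q] by fastforce
    then show ?thesis by auto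
  qed
  obtain c where c: "?Q = b * c" using dvd[OF prime_power_cyclotomic_root[OF z]] by (elim dvdE)
  obtain g h where gh: "prime_power_cyclotomic p a = g * h" "degree g = degree b" "degree h = degree c"
    using rat_to_int_factor[OF c] by blast
  have "degree b \<noteq> 0"
  proof
    assume "degree b = 0"
    then obtain k where "b = [:k:]" by (metis degree_eq_zeroE)
    then show False using b by (simp add: map_poly_pCons)
  qed
  then have "degree c = 0" using prime_power_cyclotomic_factor[OF p gh(1)] gh by simp
  then obtain k where k: "c = [:k:]" by (metis degree_eq_zeroE)
  have "?e ?Q z' = 0" by (rule prime_power_cyclotomic_root[OF z'])
  then have "?e b z' * of_rat k = 0" unfolding c k by (auto simp: of_rat_hom.map_poly_hom_smult)
  moreover have "k \<noteq> 0" using Q0 c k by auto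
  ultimately have "?e b z' = 0" by simp
  moreover obtain r where "f = b * r" using dvd[OF f] by (elim dvdE)
  ultimately show ?thesis by simp
qed

lemma cis_root_of_unity_power_eq_1_iff:
  assumes "n > 0"
  shows "cis (2 * pi / real n) ^ i = 1 \<longleftrightarrow> n dvd i"
proof -
  have "cis (2 * pi / real n) ^ i = cis (2 * pi * real i / real n)" by (simp add: DeMoivre field_simps)
  moreover have "cis x = 1 \<longleftrightarrow> cos x = 1" for x
    using sin_cos_squared_add[of x] by (auto simp: complex_eq_iff power2_eq_square)
  moreover have "cos (2 * pi * real i / real n) = 1 \<longleftrightarrow> (\<exists>k::int. real i = real_of_int k * real n)"
    unfolding cos_one_2pi_int using assms by (simp add: field_simps)
  moreover have "(\<exists>k::int. real i = real_of_int k * real n) \<longleftrightarrow> int n dvd int i"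
    by (metis dvd_def mult.commute of_int_eq_iff of_int_mult of_int_of_nat_eq)
  ultimately show ?thesis by simp
qed

lemma poly_map_poly_of_rat_power:
  fixes x :: complex
  shows "poly (map_poly of_rat q) (x ^ l) = poly (map_poly of_rat (q \<circ>\<^sub>p monom 1 l)) x"
proof (induction q)
  case (pCons c q)
  have "map_poly of_rat (monom 1 l) = (monom 1 l :: complex poly)" by (simp add: map_poly_monom)
  moreover have "map_poly of_rat [:c:] = [:of_rat c :: complex:]" by (simp add: of_rat_hom.map_poly_pCons_hom)
  ultimately show ?case using pCons
    by (simp add: pcompose_pCons of_rat_poly_hom.hom_mult of_rat_poly_hom.hom_add map_poly_pCons poly_monom)
qed simp

text \<open>Field elements are values of rational polynomials at the root of unity, so the
  automorphism has to send the value at the root to the value at its l-th power. Conjugacy of these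
  two primitive roots, used in both directions, makes the map well defined and injective.\<close>

lemma gal_cyclotomic_prime_power:
  assumes p: "prime p" and n: "n = p ^ Suc a" and l: "\<not> p dvd l"
  shows "\<exists>\<sigma> \<in> gal_cyclotomic n. \<sigma> (cis (2 * pi / real n)) = cis (2 * pi / real n) ^ l"
proof -
  let ?z = "cis (2 * pi / real n)"
  let ?e = "\<lambda>q z. poly (map_poly of_rat q) z :: complex"
  have hom: "?e (q * r) x = ?e q x * ?e r x" "?e (q + r) x = ?e q x + ?e r x" "?e (q - r) x = ?e q x - ?e r x" "?e 1 x = 1" for q r x
    by (simp_all add: of_rat_poly_hom.hom_mult of_rat_poly_hom.hom_add of_rat_poly_hom.hom_minus)
  have p1: "p > 1" using p prime_gt_1_nat by blast
  have n0: "n > 0" using n p1 by simp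
  have zpow: "?z ^ i = 1 \<longleftrightarrow> n dvd i" for i
    by (rule cis_root_of_unity_power_eq_1_iff[OF n0])
  have z: "?z ^ (p ^ Suc a) = 1" "?z ^ (p ^ a) \<noteq> 1"
    unfolding zpow using n p1 by (auto dest: dvd_imp_le)
  let ?w = "?z ^ l"
  have w: "?w ^ (p ^ Suc a) = 1" "?w ^ (p ^ a) \<noteq> 1"
    unfolding power_mult[symmetric] zpow using n p1 l by auto
  have wd: "?e f ?z = ?e g ?z \<longleftrightarrow> ?e f ?w = ?e g ?w" for f g
    using primitive_root_conjugate[OF p z w, of "f - g"] primitive_root_conjugate[OF p w z, of "f - g"] by (auto simp: hom)
  \<comment> \<open>The representing polynomial is chosen by \<open>SOME\<close>; by
    \<open>wd\<close> the result does not depend on the choice.\<close>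
  define \<sigma> where "\<sigma> x = ?e (SOME q. x = ?e q ?z) ?w" for x
  have \<sigma>: "\<sigma> (?e q ?z) = ?e q ?w" for q
    unfolding \<sigma>_def using wd[of "SOME q'. ?e q ?z = ?e q' ?z" q] someI[of "\<lambda>q'. ?e q ?z = ?e q' ?z" q] by simp
  have inF: "?e q ?z \<in> cyclotomic_field n" for q unfolding cyclotomic_field_def by blast
  have F: "\<exists>q. x = ?e q ?z" if "x \<in> cyclotomic_field n" for x using that unfolding cyclotomic_field_def by blast
  have wz: "?e q ?w = ?e (q \<circ>\<^sub>p monom 1 l) ?z" for q
    by (rule poly_map_poly_of_rat_power)
  \<comment> \<open>For surjectivity: the root is a power of its image, so the values at the image
    again exhaust the field.\<close>
  obtain l' where l': "[l * l' = 1] (mod n)"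
    using cong_solve_coprime_nat[of l n] prime_imp_power_coprime[OF p l, of "Suc a"]
    unfolding n by auto
  have zw: "?z = ?w ^ l'"
  proof -
    have n1: "n > 1" using n p1 by (metis one_less_power zero_less_Suc)
    then have "l * l' mod n = 1" using l' by (simp add: cong_def)
    then have "l * l' = n * (l * l' div n) + 1" by (metis div_mult_mod_eq mult.commute)
    then have "?z ^ (l * l') = (?z ^ n) ^ (l * l' div n) * ?z" by (metis power_add power_mult power_one_right)
    then show ?thesis using zpow[of n] by (simp add: power_mult)
  qed
  have "inj_on \<sigma> (cyclotomic_field n)"
    by (rule inj_onI) (use F \<sigma> wd in metis)
  moreover have "\<sigma> ` cyclotomic_field n = cyclotomic_field n"
  proof
    show "\<sigma> ` cyclotomic_field n \<subseteq> cyclotomic_field n" using F \<sigma> wz inF by (metis image_subsetI)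
    show "cyclotomic_field n \<subseteq> \<sigma> ` cyclotomic_field n"
    proof
      fix x assume "x \<in> cyclotomic_field n"
      then obtain q where "x = ?e q ?z" using F by blast
      also have "\<dots> = ?e (q \<circ>\<^sub>p monom 1 l') ?w" 
        using zw by (simp add: poly_map_poly_of_rat_power[symmetric])
      finally show "x \<in> \<sigma> ` cyclotomic_field n" using \<sigma> inF by (metis imageI)
    qed
  qed
  ultimately have "bij_betw \<sigma> (cyclotomic_field n) (cyclotomic_field n)" by (simp add: bij_betw_def)
  moreover have "\<sigma> (x + y) = \<sigma> x + \<sigma> y \<and> \<sigma> (x * y) = \<sigma> x * \<sigma> y"
    if "x \<in> cyclotomic_field n" "y \<in> cyclotomic_field n" for x y
    using F[OF that(1)] F[OF that(2)] \<sigma> by (metis hom(1,2))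
  moreover have "\<sigma> 1 = 1" using \<sigma>[of 1] by (simp add: hom)
  moreover have "\<sigma> ?z = ?w" using \<sigma>[of "[:0, 1:]"] by (simp add: map_poly_pCons)
  ultimately show ?thesis unfolding gal_cyclotomic_def by blast
qed

section \<open>Matrix representations\<close>

lemma is_repD:
  assumes "is_rep G d \<rho>"
  shows "0 < d" "g \<in> carrier G \<Longrightarrow> \<rho> g \<in> carrier_mat d d"
    "g \<in> carrier G \<Longrightarrow> h \<in> carrier G \<Longrightarrow> \<rho> (g \<otimes>\<^bsub>G\<^esub> h) = \<rho> g * \<rho> h"
    "\<rho> \<one>\<^bsub>G\<^esub> = 1\<^sub>m d"
  using assms unfolding is_rep_def by auto

lemma mat_eq_by_vec:
  fixes A B :: "complex mat"
  assumes "A \<in> carrier_mat n m" "B \<in> carrier_mat n m"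
    and "\<And>v. v \<in> carrier_vec m \<Longrightarrow> A *\<^sub>v v = B *\<^sub>v v"
  shows "A = B"
proof (rule eq_matI)
  show "dim_row A = dim_row B" "dim_col A = dim_col B" using assms by auto
  fix i j assume ij: "i < dim_row B" "j < dim_col B"
  have "(A *\<^sub>v unit_vec m j) $ i = (B *\<^sub>v unit_vec m j) $ i" using assms(3)[of "unit_vec m j"] by simp
  then show "A $$ (i, j) = B $$ (i, j)" using ij assms(1,2) by (simp add: scalar_prod_right_unit)
qed

lemma smult_one_mat_vec:
  assumes "w \<in> carrier_vec d"
  shows "(\<mu> \<cdot>\<^sub>m 1\<^sub>m d) *\<^sub>v w = \<mu> \<cdot>\<^sub>v (w :: complex vec)"
  using assms by (intro eq_vecI) (auto simp: row_smult smult_scalar_prod_distrib[of _ d])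

text \<open>An eigenvalue exists over the complex numbers, and its eigenspace is invariant because
  \<open>A\<close> commutes with the representation; being nonzero, it is the whole space.\<close>

lemma schur:
  assumes irr: "is_irr_rep G d \<rho>" and A: "A \<in> carrier_mat d d"
    and comm: "\<And>g. g \<in> carrier G \<Longrightarrow> A * \<rho> g = \<rho> g * A"
  shows "\<exists>\<mu>. A = \<mu> \<cdot>\<^sub>m 1\<^sub>m d"
proof -
  have rep: "is_rep G d \<rho>" using irr unfolding is_irr_rep_def by auto
  note R = is_repD[OF rep]
  obtain \<mu> where "\<mu> \<in> spectrum A" using spectrum_non_empty[OF A R(1)] by auto
  then obtain v where v: "v \<in> carrier_vec d" "v \<noteq> 0\<^sub>v d" "A *\<^sub>v v = \<mu> \<cdot>\<^sub>v v"
    using A unfolding spectrum_def eigenvalue_def eigenvector_def by auto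
  define W where "W = {w \<in> carrier_vec d. A *\<^sub>v w = \<mu> \<cdot>\<^sub>v w}"
  have "is_subspace d W" unfolding is_subspace_def W_def using A
    by (auto simp: mult_add_distrib_mat_vec[OF A] smult_add_distrib_vec mult_mat_vec smult_smult_assoc mult.commute)
  moreover have "\<forall>g \<in> carrier G. \<forall>w \<in> W. \<rho> g *\<^sub>v w \<in> W"
  proof (intro ballI)
    fix g w assume g: "g \<in> carrier G" and w: "w \<in> W"
    have wc: "w \<in> carrier_vec d" and we: "A *\<^sub>v w = \<mu> \<cdot>\<^sub>v w" using w unfolding W_def by auto
    have "A *\<^sub>v (\<rho> g *\<^sub>v w) = (A * \<rho> g) *\<^sub>v w" using A R(2)[OF g] wc by simp
    also have "\<dots> = \<rho> g *\<^sub>v (A *\<^sub>v w)" using A R(2)[OF g] wc comm[OF g] by simp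
    also have "\<dots> = \<mu> \<cdot>\<^sub>v (\<rho> g *\<^sub>v w)" unfolding we using R(2)[OF g] wc by (simp add: mult_mat_vec)
    finally show "\<rho> g *\<^sub>v w \<in> W" unfolding W_def using R(2)[OF g] wc by simp
  qed
  ultimately have "W = {0\<^sub>v d} \<or> W = carrier_vec d" using irr unfolding is_irr_rep_def by blast
  moreover have "v \<in> W" using v unfolding W_def by auto
  ultimately have "W = carrier_vec d" using v by auto
  then have "A *\<^sub>v w = (\<mu> \<cdot>\<^sub>m 1\<^sub>m d) *\<^sub>v w" if "w \<in> carrier_vec d" for w
    using that unfolding W_def by (auto simp: smult_one_mat_vec)
  then have "A = \<mu> \<cdot>\<^sub>m 1\<^sub>m d" using A by (intro mat_eq_by_vec) auto
  then show ?thesis by blast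
qed

section \<open>Dimension counts with injective and surjective matrices\<close>

lemma injective_matrix_square_surj:
  fixes A :: "complex mat"
  assumes A: "A \<in> carrier_mat n n" and inj: "\<And>v. v \<in> carrier_vec n \<Longrightarrow> A *\<^sub>v v = 0\<^sub>v n \<Longrightarrow> v = 0\<^sub>v n"
    and w: "w \<in> carrier_vec n"
  shows "\<exists>v \<in> carrier_vec n. A *\<^sub>v v = w"
proof -
  have "det A \<noteq> 0" using det_0_iff_vec_prod_zero[OF A] inj by blast
  then obtain B where B: "B \<in> carrier_mat n n" "A * B = 1\<^sub>m n"
    using det_non_zero_imp_unit[OF A, of "()"] unfolding Units_def ring_mat_def by auto
  then have "A *\<^sub>v (B *\<^sub>v w) = w" using A w by (metis assoc_mult_mat_vec one_mult_mat_vec)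
  then show ?thesis using B w by (metis mult_mat_vec_carrier)
qed

text \<open>Padding a wide matrix with zero rows makes it square and singular, and a kernel vector
  of the padded matrix is one of \<open>A\<close> as well. Singularity is read off the transpose,
  which kills the unit vector numbered \<open>n\<close>.\<close>

lemma injective_matrix_dim_le:
  fixes A :: "complex mat"
  assumes A: "A \<in> carrier_mat n m" and inj: "\<And>v. v \<in> carrier_vec m \<Longrightarrow> A *\<^sub>v v = 0\<^sub>v n \<Longrightarrow> v = 0\<^sub>v m"
  shows "m \<le> n"
proof (rule ccontr)
  assume "\<not> m \<le> n"
  then have nm: "n < m" by simp
  define M where "M = mat m m (\<lambda>(i, j). if i < n then A $$ (i, j) else 0)"
  have M: "M \<in> carrier_mat m m" unfolding M_def by simp
  have "transpose_mat M *\<^sub>v unit_vec m n = 0\<^sub>v m"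
    unfolding M_def using nm by (intro eq_vecI) (auto simp: scalar_prod_def)
  moreover have "unit_vec m n \<noteq> (0\<^sub>v m :: complex vec)"
    using nm by (metis index_unit_vec(1) index_zero_vec(1) zero_neq_one)
  ultimately have "det (transpose_mat M) = 0"
    using det_0_iff_vec_prod_zero[of "transpose_mat M" m] M by (metis transpose_carrier_mat unit_vec_carrier)
  then have "det M = 0" using det_transpose[OF M] by simp
  then obtain v where v: "v \<in> carrier_vec m" "v \<noteq> 0\<^sub>v m" "M *\<^sub>v v = 0\<^sub>v m"
    using det_0_iff_vec_prod_zero[OF M] by blast
  have "A *\<^sub>v v = 0\<^sub>v n"
  proof (rule eq_vecI)
    fix i assume "i < dim_vec (0\<^sub>v n :: complex vec)"
    then have i: "i < n" by simp
    have "row M i = row A i" unfolding M_def using i nm A by (intro eq_vecI) auto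
    then have "(A *\<^sub>v v) $ i = (M *\<^sub>v v) $ i" using i nm A M by simp
    then show "(A *\<^sub>v v) $ i = 0\<^sub>v n $ i" using v i nm by simp
  qed (use A in simp)
  then show False using inj v by blast
qed

text \<open>The transpose is injective: a vector that it kills has zero product with the whole image
  of \<open>A\<close>, that is, with every vector.\<close>

lemma surjective_matrix_dim_ge:
  fixes A :: "complex mat"
  assumes A: "A \<in> carrier_mat n m" and surj: "\<And>w. w \<in> carrier_vec n \<Longrightarrow> \<exists>v \<in> carrier_vec m. A *\<^sub>v v = w"
  shows "n \<le> m"
proof (rule injective_matrix_dim_le[of "transpose_mat A"])
  show "transpose_mat A \<in> carrier_mat m n" using A by simp
  fix y assume y: "y \<in> carrier_vec n" and 0: "transpose_mat A *\<^sub>v y = 0\<^sub>v m"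
  have "y \<bullet> w = 0" if w: "w \<in> carrier_vec n" for w
  proof -
    obtain v where v: "v \<in> carrier_vec m" "A *\<^sub>v v = w" using surj[OF w] by blast
    have "y \<bullet> (A *\<^sub>v v) = (transpose_mat A *\<^sub>v y) \<bullet> v"
      using transpose_vec_mult_scalar[OF A v(1) y] by simp
    then show ?thesis using v 0 by simp
  qed
  then have "y \<bullet> unit_vec n i = 0" for i by simp
  then have "y $ i = 0" if "i < n" for i using y that by (metis scalar_prod_right_unit)
  then show "y = 0\<^sub>v n" using y by (intro eq_vecI) auto
qed

text \<open>Says that the columns are linearly independent. Such matrices serve as bases, with the
  number of columns as the dimension, and as embeddings of one representation into another.\<close>

definition inj_mat :: "nat \<Rightarrow> nat \<Rightarrow> complex mat \<Rightarrow> bool" where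
  "inj_mat n m B \<longleftrightarrow> B \<in> carrier_mat n m \<and> (\<forall>x \<in> carrier_vec m. B *\<^sub>v x = 0\<^sub>v n \<longrightarrow> x = 0\<^sub>v m)"

lemma inj_mat_eqD:
  assumes "inj_mat n m B" "x \<in> carrier_vec m" "y \<in> carrier_vec m" "B *\<^sub>v x = B *\<^sub>v y"
  shows "x = y"
proof -
  have B: "B \<in> carrier_mat n m" using assms unfolding inj_mat_def by auto
  have "B *\<^sub>v (x - y) = 0\<^sub>v n"
    using assms B by (simp add: mult_minus_distrib_mat_vec[OF B] minus_cancel_vec[of _ n])
  then have "x - y = 0\<^sub>v m" using assms unfolding inj_mat_def by simp
  then have "(x - y) $ i = 0" if "i < m" for i using that by simp
  then show ?thesis using assms by (intro eq_vecI) auto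
qed

lemma inj_mat_cancel:
  assumes B: "inj_mat n m B" and S: "S \<in> carrier_mat m k" and T: "T \<in> carrier_mat m k" and eq: "B * S = B * T"
  shows "S = T"
proof (rule mat_eq_by_vec[OF S T])
  fix v :: "complex vec" assume v: "v \<in> carrier_vec k"
  have Bc: "B \<in> carrier_mat n m" using B unfolding inj_mat_def by auto
  have "B *\<^sub>v (S *\<^sub>v v) = B *\<^sub>v (T *\<^sub>v v)" using eq Bc S T v by (metis assoc_mult_mat_vec)
  then show "S *\<^sub>v v = T *\<^sub>v v" using inj_mat_eqD[OF B] S T v by simp
qed

text \<open>The number of independent columns inside \<open>W\<close> is bounded by
  \<open>d\<close>, so a largest one exists; if the image missed a vector \<open>w\<close>,
  adjoining \<open>w\<close> as a last column would keep the matrix injective.\<close>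

lemma subspace_basis:
  assumes W: "is_subspace d W"
  shows "\<exists>f B. f \<le> d \<and> inj_mat d f B \<and> (\<lambda>x. B *\<^sub>v x) ` carrier_vec f = W"
proof -
  define Q where "Q f \<longleftrightarrow> (\<exists>B. inj_mat d f B \<and> (\<forall>x \<in> carrier_vec f. B *\<^sub>v x \<in> W))" for f
  have W0: "0\<^sub>v d \<in> W" "W \<subseteq> carrier_vec d" using W unfolding is_subspace_def by auto
  have "0\<^sub>m d 0 *\<^sub>v x = 0\<^sub>v d" if "x \<in> carrier_vec 0" for x :: "complex vec"
    using that by (intro eq_vecI) (auto simp: scalar_prod_def)
  then have "Q 0" unfolding Q_def inj_mat_def using W0 by (intro exI[of _ "0\<^sub>m d 0"]) auto
  moreover have bound: "f \<le> d" if "Q f" for f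
    using that injective_matrix_dim_le unfolding Q_def inj_mat_def by blast
  ultimately obtain f where f: "Q f" and max: "\<And>f'. Q f' \<Longrightarrow> f' \<le> f"
    using GreatestI_nat[of Q 0 d] Greatest_le_nat[of Q _ d] by blast
  then obtain B where B: "inj_mat d f B" and im: "\<And>x. x \<in> carrier_vec f \<Longrightarrow> B *\<^sub>v x \<in> W"
    unfolding Q_def by blast
  have Bc: "B \<in> carrier_mat d f" using B unfolding inj_mat_def by auto
  have "W \<subseteq> (\<lambda>x. B *\<^sub>v x) ` carrier_vec f"
  proof (rule ccontr)
    assume "\<not> ?thesis"
    then obtain w where w: "w \<in> W" "\<And>x. x \<in> carrier_vec f \<Longrightarrow> B *\<^sub>v x \<noteq> w" by blast
    have wc: "w \<in> carrier_vec d" using w W0 by auto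
    define B' where "B' = mat d (Suc f) (\<lambda>(i, j). if j < f then B $$ (i, j) else w $ i)"
    have B'c: "B' \<in> carrier_mat d (Suc f)" unfolding B'_def by simp
    have split: "B' *\<^sub>v x = B *\<^sub>v vec f (\<lambda>i. x $ i) + x $ f \<cdot>\<^sub>v w" if x: "x \<in> carrier_vec (Suc f)" for x
      using Bc wc x unfolding B'_def by (intro eq_vecI) (auto simp: scalar_prod_def mult.commute)
    have "B' *\<^sub>v x \<in> W" if x: "x \<in> carrier_vec (Suc f)" for x
      unfolding split[OF x] using W im w(1) unfolding is_subspace_def by auto
    moreover have "x = 0\<^sub>v (Suc f)" if x: "x \<in> carrier_vec (Suc f)" and 0: "B' *\<^sub>v x = 0\<^sub>v d" for x
    proof -
      let ?y = "vec f (\<lambda>i. x $ i)"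
      have sum: "B *\<^sub>v ?y + x $ f \<cdot>\<^sub>v w = 0\<^sub>v d" using split[OF x] 0 by simp
      \<comment> \<open>Otherwise the relation could be solved for \<open>w\<close>, which would
        then lie in the image of \<open>B\<close>.\<close>
      have xf: "x $ f = 0"
      proof (rule ccontr)
        assume nz: "x $ f \<noteq> 0"
        have "B *\<^sub>v ((- 1 / x $ f) \<cdot>\<^sub>v ?y) = (- 1 / x $ f) \<cdot>\<^sub>v (B *\<^sub>v ?y)" using Bc by (simp add: mult_mat_vec)
        also have "\<dots> = w"
        proof (rule eq_vecI)
          fix i assume "i < dim_vec w"
          then have i: "i < d" using wc by simp
          have "(B *\<^sub>v ?y + x $ f \<cdot>\<^sub>v w) $ i = 0" unfolding sum using i by simp
          then have "(B *\<^sub>v ?y) $ i = - (x $ f * w $ i)" using i wc Bc by (simp add: eq_neg_iff_add_eq_0)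
          then show "((- 1 / x $ f) \<cdot>\<^sub>v (B *\<^sub>v ?y)) $ i = w $ i" using i Bc nz by simp
        qed (use Bc wc in simp)
        finally show False using w(2) by (metis smult_carrier_vec vec_carrier)
      qed
      have "B *\<^sub>v ?y = 0\<^sub>v d" 
      proof -
        have "x $ f \<cdot>\<^sub>v w = 0\<^sub>v d" using xf wc by (intro eq_vecI) auto
        then show ?thesis using sum Bc by (metis mult_mat_vec_carrier right_zero_vec vec_carrier)
      qed
      then have "?y = 0\<^sub>v f" using B unfolding inj_mat_def by simp
      then have "x $ i = 0" if "i < f" for i using that by (metis index_vec index_zero_vec(1))
      then show ?thesis using x xf by (intro eq_vecI) (auto simp: less_Suc_eq)
    qed
    ultimately have "Q (Suc f)" unfolding Q_def inj_mat_def using B'c by blast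
    then show False using max[of "Suc f"] by simp
  qed
  then show ?thesis using bound[OF f] B im by blast
qed

section \<open>Restriction to invariant subspaces and irreducible subrepresentations\<close>

lemma matrix_factor_through:
  assumes B: "B \<in> carrier_mat n f" and A: "A \<in> carrier_mat n m"
    and im: "\<And>v. v \<in> carrier_vec m \<Longrightarrow> \<exists>x \<in> carrier_vec f. B *\<^sub>v x = A *\<^sub>v (v :: complex vec)"
  shows "\<exists>T \<in> carrier_mat f m. A = B * T"
proof -
  obtain X where X: "\<And>j. X j \<in> carrier_vec f \<and> B *\<^sub>v X j = A *\<^sub>v unit_vec m j"
    using im[OF unit_vec_carrier] by metis
  define T where "T = mat f m (\<lambda>(i, j). X j $ i)"
  have T: "T \<in> carrier_mat f m" unfolding T_def by simp
  have colT: "col T j = X j" if "j < m" for j unfolding T_def using that X[of j] by (intro eq_vecI) auto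
  have "A = B * T"
  proof (rule eq_matI)
    fix i j assume "i < dim_row (B * T)" "j < dim_col (B * T)"
    then have ij: "i < n" "j < m" using B T by auto
    have "(B * T) $$ (i, j) = (B *\<^sub>v X j) $ i" using ij B T colT by simp
    also have "\<dots> = (A *\<^sub>v unit_vec m j) $ i" using X by simp
    also have "\<dots> = A $$ (i, j)" using ij A by (simp add: scalar_prod_right_unit)
    finally show "A $$ (i, j) = (B * T) $$ (i, j)" by simp
  qed (use A B T in auto)
  then show ?thesis using T by blast
qed

text \<open>The new representation is the old one in coordinates with respect to a basis
  \<open>B\<close> of \<open>W\<close>; cancelling the injective \<open>B\<close> carries the
  homomorphism law over. The strict bound for proper \<open>W\<close> is what the search for an
  irreducible constituent runs on.\<close>

lemma rep_restrict:
  assumes "group G" and rep: "is_rep G d \<rho>" and W: "is_subspace d W" "W \<noteq> {0\<^sub>v d}"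
    and inv: "\<And>g w. g \<in> carrier G \<Longrightarrow> w \<in> W \<Longrightarrow> \<rho> g *\<^sub>v w \<in> W"
  shows "\<exists>f B \<tau>. is_rep G f \<tau> \<and> inj_mat d f B \<and> (\<lambda>x. B *\<^sub>v x) ` carrier_vec f = W \<and>
    (\<forall>g \<in> carrier G. \<rho> g * B = B * \<tau> g) \<and> f \<le> d \<and> (W \<noteq> carrier_vec d \<longrightarrow> f < d)"
proof -
  interpret group G by fact
  note R = is_repD[OF rep]
  obtain f B where f: "f \<le> d" "inj_mat d f B" and im: "(\<lambda>x. B *\<^sub>v x) ` carrier_vec f = W"
    using subspace_basis[OF W(1)] by blast
  have B: "B \<in> carrier_mat d f" using f unfolding inj_mat_def by auto
  have "f \<noteq> 0"
  proof
    assume "f = 0"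
    then have "B *\<^sub>v x = 0\<^sub>v d" if "x \<in> carrier_vec f" for x
      using B that by (intro eq_vecI) (auto simp: scalar_prod_def)
    then show False using im W unfolding is_subspace_def by auto
  qed
  have "\<exists>T \<in> carrier_mat f f. \<rho> g * B = B * T" if g: "g \<in> carrier G" for g
  proof (rule matrix_factor_through[OF B])
    show "\<rho> g * B \<in> carrier_mat d f" using R(2)[OF g] B by simp
    fix v :: "complex vec" assume v: "v \<in> carrier_vec f"
    have "(\<rho> g * B) *\<^sub>v v = \<rho> g *\<^sub>v (B *\<^sub>v v)" using R(2)[OF g] B v by simp
    also have "\<dots> \<in> W" using inv[OF g] im v by blast
    finally show "\<exists>x \<in> carrier_vec f. B *\<^sub>v x = (\<rho> g * B) *\<^sub>v v" using im by (metis image_iff)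
  qed
  then obtain \<tau> where \<tau>: "\<And>g. g \<in> carrier G \<Longrightarrow> \<tau> g \<in> carrier_mat f f \<and> \<rho> g * B = B * \<tau> g"
    by metis
  have "is_rep G f \<tau>" unfolding is_rep_def
  proof (intro conjI ballI)
    show "0 < f" using \<open>f \<noteq> 0\<close> by simp
    show "\<tau> g \<in> carrier_mat f f" if "g \<in> carrier G" for g using \<tau> that by blast
    have "B * \<tau> \<one>\<^bsub>G\<^esub> = B * 1\<^sub>m f"
      using \<tau>[OF one_closed] R(4) B by (metis left_mult_one_mat right_mult_one_mat)
    then show "\<tau> \<one>\<^bsub>G\<^esub> = 1\<^sub>m f"
      using \<tau>[OF one_closed] by (meson inj_mat_cancel[OF f(2)] one_carrier_mat)
    fix g h assume gh: "g \<in> carrier G" "h \<in> carrier G"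
    have T: "\<tau> g \<in> carrier_mat f f" "\<tau> h \<in> carrier_mat f f" and RR: "\<rho> g \<in> carrier_mat d d" "\<rho> h \<in> carrier_mat d d"
      using \<tau> R(2) gh by auto
    have "B * \<tau> (g \<otimes>\<^bsub>G\<^esub> h) = (\<rho> g * \<rho> h) * B" using \<tau> R(3) gh by (metis m_closed)
    also have "\<dots> = \<rho> g * (\<rho> h * B)" by (rule assoc_mult_mat[OF RR B])
    also have "\<dots> = \<rho> g * (B * \<tau> h)" using \<tau> gh by simp
    also have "\<dots> = (\<rho> g * B) * \<tau> h" by (rule assoc_mult_mat[OF RR(1) B T(2), symmetric])
    also have "\<dots> = (B * \<tau> g) * \<tau> h" using \<tau> gh by simp
    also have "\<dots> = B * (\<tau> g * \<tau> h)" by (rule assoc_mult_mat[OF B T])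
    finally show "\<tau> (g \<otimes>\<^bsub>G\<^esub> h) = \<tau> g * \<tau> h"
      using \<tau> gh T by (meson inj_mat_cancel[OF f(2)] m_closed mult_carrier_mat)
  qed
  moreover have "f < d" if "W \<noteq> carrier_vec d"
  proof (rule ccontr)
    assume "\<not> f < d"
    then have fd: "f = d" using f by simp
    have "carrier_vec d \<subseteq> W"
      using injective_matrix_square_surj[of B d] f(2) B fd im unfolding inj_mat_def by blast
    then show False using that W(1) unfolding is_subspace_def by blast
  qed
  ultimately show ?thesis using f im \<tau> by blast
qed

text \<open>Induction on the degree, descending into invariant subspaces without choosing
  complements. The subspace \<open>W\<close> is part of the statement so that the constituent can be
  forced to lie in it.\<close>

lemma irr_subrep_exists:
  assumes "group G"
  shows "is_rep G d \<rho> \<Longrightarrow> is_subspace d W \<Longrightarrow> W \<noteq> {0\<^sub>v d} \<Longrightarrow>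
    (\<forall>g \<in> carrier G. \<forall>w \<in> W. \<rho> g *\<^sub>v w \<in> W) \<Longrightarrow>
    \<exists>f \<tau> B. is_irr_rep G f \<tau> \<and> inj_mat d f B \<and> (\<forall>x \<in> carrier_vec f. B *\<^sub>v x \<in> W) \<and>
      (\<forall>g \<in> carrier G. \<rho> g * B = B * \<tau> g)"
proof (induction d arbitrary: \<rho> W rule: less_induct)
  case (less d)
  show ?case
  proof (cases "is_irr_rep G d \<rho> \<and> W = carrier_vec d")
    case True
    moreover have "\<rho> g * 1\<^sub>m d = 1\<^sub>m d * \<rho> g" if "g \<in> carrier G" for g
      using is_repD(2)[OF less.prems(1) that] by simp
    ultimately show ?thesis
      by (intro exI[of _ d] exI[of _ \<rho>] exI[of _ "1\<^sub>m d"]) (auto simp: inj_mat_def)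
  next
    case False
    \<comment> \<open>A proper \<open>W\<close> serves itself; if \<open>W\<close> is everything,
      failure of irreducibility supplies the subspace.\<close>
    then obtain W' where W': "is_subspace d W'" "W' \<subseteq> W" "W' \<noteq> {0\<^sub>v d}" "W' \<noteq> carrier_vec d"
      and inv: "\<forall>g \<in> carrier G. \<forall>w \<in> W'. \<rho> g *\<^sub>v w \<in> W'"
      using less.prems unfolding is_irr_rep_def is_subspace_def by (metis order_refl)
    obtain f B \<tau> where \<tau>: "is_rep G f \<tau>" and B: "inj_mat d f B" and im: "(\<lambda>x. B *\<^sub>v x) ` carrier_vec f = W'"
      and comm: "\<And>g. g \<in> carrier G \<Longrightarrow> \<rho> g * B = B * \<tau> g" and fd: "f < d"
      using rep_restrict[OF assms less.prems(1) W'(1,3)] inv W'(4) by blast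
    have cc: "is_subspace f (carrier_vec f)" "carrier_vec f \<noteq> {0\<^sub>v f :: complex vec}"
      "\<forall>g \<in> carrier G. \<forall>w \<in> carrier_vec f. \<tau> g *\<^sub>v w \<in> carrier_vec f"
    proof -
      show "is_subspace f (carrier_vec f)" unfolding is_subspace_def by auto
      have "unit_vec f 0 \<noteq> (0\<^sub>v f :: complex vec)" using is_repD(1)[OF \<tau>] by simp
      then show "carrier_vec f \<noteq> {0\<^sub>v f :: complex vec}" by (metis singletonD unit_vec_carrier)
      show "\<forall>g \<in> carrier G. \<forall>w \<in> carrier_vec f. \<tau> g *\<^sub>v w \<in> carrier_vec f"
        using is_repD(2)[OF \<tau>] mult_mat_vec_carrier by blast
    qed
    obtain f' \<tau>' B' where IH: "is_irr_rep G f' \<tau>'" and B': "inj_mat f f' B'"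
      and comm': "\<And>g. g \<in> carrier G \<Longrightarrow> \<tau> g * B' = B' * \<tau>' g"
      using less.IH[OF fd \<tau> cc] by blast
    have c: "B \<in> carrier_mat d f" "B' \<in> carrier_mat f f'" using B B' unfolding inj_mat_def by auto
    have mv: "(B * B') *\<^sub>v x = B *\<^sub>v (B' *\<^sub>v x)" if "x \<in> carrier_vec f'" for x
      using c that by simp
    have "inj_mat d f' (B * B')" using B B' mv c unfolding inj_mat_def by auto
    moreover have "\<forall>x \<in> carrier_vec f'. (B * B') *\<^sub>v x \<in> W"
      using mv im c W'(2) by auto
    moreover have "\<rho> g * (B * B') = (B * B') * \<tau>' g" if g: "g \<in> carrier G" for g
    proof -
      have t: "\<rho> g \<in> carrier_mat d d" "\<tau> g \<in> carrier_mat f f" "\<tau>' g \<in> carrier_mat f' f'"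
        using g is_repD(2)[OF less.prems(1)] is_repD(2)[OF \<tau>] IH unfolding is_irr_rep_def is_rep_def by auto
      have "\<rho> g * (B * B') = (\<rho> g * B) * B'" by (rule assoc_mult_mat[OF t(1) c, symmetric])
      also have "\<dots> = B * (\<tau> g * B')" unfolding comm[OF g] by (rule assoc_mult_mat[OF c(1) t(2) c(2)])
      also have "\<dots> = (B * B') * \<tau>' g" unfolding comm'[OF g] by (rule assoc_mult_mat[OF c t(3), symmetric])
      finally show ?thesis .
    qed
    ultimately show ?thesis using IH by blast
  qed
qed

section \<open>Characters and scalar elements of irreducible representations\<close>

text \<open>The order of the factors is that of the generators of \<open>derived\<close>.\<close>

definition commutator :: "('a, 'b) monoid_scheme \<Rightarrow> 'a \<Rightarrow> 'a \<Rightarrow> 'a" where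
  "commutator G x y = x \<otimes>\<^bsub>G\<^esub> y \<otimes>\<^bsub>G\<^esub> inv\<^bsub>G\<^esub> x \<otimes>\<^bsub>G\<^esub> inv\<^bsub>G\<^esub> y"

context group
begin

lemma commutator_closed: "x \<in> carrier G \<Longrightarrow> y \<in> carrier G \<Longrightarrow> commutator G x y \<in> carrier G"
  unfolding commutator_def by simp

lemma commutator_mult: "x \<in> carrier G \<Longrightarrow> y \<in> carrier G \<Longrightarrow> commutator G x y \<otimes> (y \<otimes> x) = x \<otimes> y"
  unfolding commutator_def by (simp add: m_assoc inv_solve_left')

lemma commutator_eq_one_iff: "x \<in> carrier G \<Longrightarrow> y \<in> carrier G \<Longrightarrow> commutator G x y = \<one> \<longleftrightarrow> x \<otimes> y = y \<otimes> x"
  using commutator_mult[of x y] commutator_closed[of x y] by (metis l_one m_closed r_cancel_one')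

lemma inv_commutator: "x \<in> carrier G \<Longrightarrow> y \<in> carrier G \<Longrightarrow> inv (commutator G x y) = commutator G y x"
  unfolding commutator_def by (simp add: inv_mult_group m_assoc)

lemma conj_eq_commutator: "x \<in> carrier G \<Longrightarrow> y \<in> carrier G \<Longrightarrow> x \<otimes> y \<otimes> inv x = commutator G x y \<otimes> y"
  unfolding commutator_def by (simp add: m_assoc)

end

locale irrep = group G for G (structure) +
  fixes d :: nat and \<rho> :: "'a \<Rightarrow> complex mat"
  assumes finite_carrier: "finite (carrier G)" and irr: "is_irr_rep G d \<rho>"
begin

lemma rep: "is_rep G d \<rho>" using irr unfolding is_irr_rep_def by auto

lemmas degree_pos = is_repD(1)[OF rep]
  and \<rho>_carrier = is_repD(2)[OF rep]
  and \<rho>_mult = is_repD(3)[OF rep]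
  and \<rho>_one = is_repD(4)[OF rep]

lemma entry_mult:
  assumes "g \<in> carrier G" "h \<in> carrier G" "i < d" "j < d"
  shows "\<rho> (g \<otimes> h) $$ (i, j) = (\<Sum>k<d. \<rho> g $$ (i, k) * \<rho> h $$ (k, j))"
  using \<rho>_mult[OF assms(1,2)] \<rho>_carrier[OF assms(1)] \<rho>_carrier[OF assms(2)] assms(3,4)
  by (simp add: scalar_prod_def atLeast0LessThan)

lemma entry_orthogonality:
  assumes ij: "i < d" "j < d"
  shows "(\<Sum>g\<in>carrier G. \<rho> g $$ (i, i) * \<rho> (inv g) $$ (j, j)) = (if i = j then of_nat (card (carrier G)) / of_nat d else 0)"
proof -
  \<comment> \<open>This is the sum over g of \<open>\<rho> g * E * \<rho> (inv g)\<close>, where E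
    is the matrix unit at position (i, j). It commutes with the representation, so it is scalar, and
    its trace determines the scalar.\<close>
  define T where "T = mat d d (\<lambda>(k, l). \<Sum>g\<in>carrier G. \<rho> g $$ (k, i) * \<rho> (inv g) $$ (j, l))"
  have T: "T \<in> carrier_mat d d" unfolding T_def by simp
  have "T * \<rho> h = \<rho> h * T" if h: "h \<in> carrier G" for h
  proof (rule eq_matI)
    fix k l assume "k < dim_row (\<rho> h * T)" "l < dim_col (\<rho> h * T)"
    then have kl: "k < d" "l < d" using \<rho>_carrier[OF h] T by auto
    have "(\<rho> h * T) $$ (k, l) = (\<Sum>m<d. \<rho> h $$ (k, m) * (\<Sum>g\<in>carrier G. \<rho> g $$ (m, i) * \<rho> (inv g) $$ (j, l)))"
      using kl \<rho>_carrier[OF h] T unfolding T_def by (simp add: scalar_prod_def atLeast0LessThan)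
    also have "\<dots> = (\<Sum>g\<in>carrier G. (\<Sum>m<d. \<rho> h $$ (k, m) * \<rho> g $$ (m, i)) * \<rho> (inv g) $$ (j, l))"
      by (simp add: sum_distrib_left sum_distrib_right mult.assoc) (rule sum.swap)
    also have "\<dots> = (\<Sum>g\<in>carrier G. \<rho> (h \<otimes> g) $$ (k, i) * \<rho> (inv g) $$ (j, l))"
      using kl ij h by (intro sum.cong) (auto simp: entry_mult)
    also have "\<dots> = (\<Sum>g\<in>carrier G. \<rho> g $$ (k, i) * \<rho> (inv g \<otimes> h) $$ (j, l))"
    proof (rule sum.reindex_bij_witness[of _ "\<lambda>g. inv h \<otimes> g" "\<lambda>g. h \<otimes> g"])
      fix g assume g: "g \<in> carrier G"
      show "\<rho> (h \<otimes> g) $$ (k, i) * \<rho> (inv (h \<otimes> g) \<otimes> h) $$ (j, l) = \<rho> (h \<otimes> g) $$ (k, i) * \<rho> (inv g) $$ (j, l)"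
        using g h by (simp add: inv_mult_group m_assoc)
    qed (use h in \<open>auto simp: m_assoc[symmetric]\<close>)
    also have "\<dots> = (\<Sum>g\<in>carrier G. \<rho> g $$ (k, i) * (\<Sum>m<d. \<rho> (inv g) $$ (j, m) * \<rho> h $$ (m, l)))"
      using kl ij h by (intro sum.cong) (auto simp: entry_mult)
    also have "\<dots> = (\<Sum>m<d. (\<Sum>g\<in>carrier G. \<rho> g $$ (k, i) * \<rho> (inv g) $$ (j, m)) * \<rho> h $$ (m, l))"
      by (simp add: sum_distrib_left sum_distrib_right mult.assoc) (rule sum.swap)
    also have "\<dots> = (T * \<rho> h) $$ (k, l)"
      using kl \<rho>_carrier[OF h] T unfolding T_def by (simp add: scalar_prod_def atLeast0LessThan)
    finally show "(T * \<rho> h) $$ (k, l) = (\<rho> h * T) $$ (k, l)" by simp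
  qed (use \<rho>_carrier[OF h] T in auto)
  then obtain c where c: "T = c \<cdot>\<^sub>m 1\<^sub>m d" using schur[OF irr T] by blast
  have "(\<Sum>k<d. T $$ (k, k)) = (\<Sum>g\<in>carrier G. \<Sum>k<d. \<rho> (inv g) $$ (j, k) * \<rho> g $$ (k, i))"
    unfolding T_def by (simp add: mult.commute) (rule sum.swap)
  also have "\<dots> = (\<Sum>g\<in>carrier G. \<rho> (inv g \<otimes> g) $$ (j, i))"
    using ij by (intro sum.cong refl entry_mult[symmetric]) auto
  also have "\<dots> = (\<Sum>g\<in>carrier G. if i = j then 1 else 0)"
    using ij by (intro sum.cong) (auto simp: \<rho>_one)
  finally have "of_nat d * c = (if i = j then of_nat (card (carrier G)) else 0)"
    unfolding c by simp
  moreover have "(\<Sum>g\<in>carrier G. \<rho> g $$ (i, i) * \<rho> (inv g) $$ (j, j)) = T $$ (i, j)"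
    unfolding T_def using ij by simp
  ultimately show ?thesis unfolding c using ij degree_pos by (auto simp: field_simps)
qed

lemma trace_eq: "g \<in> carrier G \<Longrightarrow> mat_trace (\<rho> g) = (\<Sum>i<d. \<rho> g $$ (i, i))"
  unfolding mat_trace_def using \<rho>_carrier by (metis carrier_matD(1))

text \<open>The norm of the character, written with \<open>inv g\<close> in place of complex
  conjugation, which keeps invariant inner products out of the argument.\<close>

lemma trace_norm: "(\<Sum>g\<in>carrier G. mat_trace (\<rho> g) * mat_trace (\<rho> (inv g))) = of_nat (card (carrier G))"
proof -
  have "(\<Sum>g\<in>carrier G. mat_trace (\<rho> g) * mat_trace (\<rho> (inv g))) =
     (\<Sum>g\<in>carrier G. \<Sum>i<d. \<Sum>j<d. \<rho> g $$ (i, i) * \<rho> (inv g) $$ (j, j))"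
    by (intro sum.cong) (auto simp: trace_eq sum_product)
  also have "\<dots> = (\<Sum>i<d. \<Sum>j<d. \<Sum>g\<in>carrier G. \<rho> g $$ (i, i) * \<rho> (inv g) $$ (j, j))"
    by (subst sum.swap, intro sum.cong refl, rule sum.swap)
  also have "\<dots> = (\<Sum>i<d. \<Sum>j<d. if i = j then of_nat (card (carrier G)) / of_nat d else 0)"
    by (intro sum.cong refl entry_orthogonality) auto
  also have "\<dots> = of_nat (card (carrier G))" using degree_pos by simp
  finally show ?thesis .
qed

text \<open>Traditionally the centre Z(\<chi>) of the character: by Schur's lemma, the elements
  whose image is central in the image of G.\<close>

definition scal :: "'a set" where
  "scal = {x \<in> carrier G. \<exists>\<mu>. \<rho> x = \<mu> \<cdot>\<^sub>m 1\<^sub>m d}"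

text \<open>The eigenvalue of a scalar element; meaningless outside \<open>scal\<close>.\<close>

definition ev :: "'a \<Rightarrow> complex" where "ev x = \<rho> x $$ (0, 0)"

definition ker :: "'a set" where "ker = {x \<in> carrier G. \<rho> x = 1\<^sub>m d}"

lemma ev_eqI: "\<rho> x = \<mu> \<cdot>\<^sub>m 1\<^sub>m d \<Longrightarrow> ev x = \<mu>"
  unfolding ev_def using degree_pos by simp

lemma scalI: "x \<in> carrier G \<Longrightarrow> \<rho> x = \<mu> \<cdot>\<^sub>m 1\<^sub>m d \<Longrightarrow> x \<in> scal"
  unfolding scal_def by auto

lemma scalD: "x \<in> scal \<Longrightarrow> x \<in> carrier G" "x \<in> scal \<Longrightarrow> \<rho> x = ev x \<cdot>\<^sub>m 1\<^sub>m d"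
  unfolding scal_def using ev_eqI by auto

lemma ev_one: "ev \<one> = 1" unfolding ev_def \<rho>_one using degree_pos by simp

lemma \<rho>_scal_mult:
  assumes "x \<in> scal" "y \<in> carrier G"
  shows "\<rho> (x \<otimes> y) = ev x \<cdot>\<^sub>m \<rho> y" "\<rho> (y \<otimes> x) = ev x \<cdot>\<^sub>m \<rho> y"
  using \<rho>_mult \<rho>_carrier[OF assms(2)] scalD[OF assms(1)] assms(2)
  by (simp_all add: mult_smult_assoc_mat[of _ d d _ d] mult_smult_distrib[of _ d d _ d])

lemma scal_mult:
  assumes "x \<in> scal" "y \<in> scal"
  shows "x \<otimes> y \<in> scal" "ev (x \<otimes> y) = ev x * ev y"
proof -
  have "\<rho> (x \<otimes> y) = (ev x * ev y) \<cdot>\<^sub>m 1\<^sub>m d"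
    using \<rho>_scal_mult(1)[OF assms(1) scalD(1)[OF assms(2)]] scalD(2)[OF assms(2)] by (auto intro!: eq_matI)
  then show "x \<otimes> y \<in> scal" "ev (x \<otimes> y) = ev x * ev y"
    using scalI ev_eqI scalD(1) assms by auto
qed

lemma one_smult_one_mat: "1 \<cdot>\<^sub>m 1\<^sub>m d = (1\<^sub>m d :: complex mat)" by (intro eq_matI) auto

lemma scal_one: "\<one> \<in> scal" using scalI[of \<one> 1] \<rho>_one by (simp add: one_smult_one_mat)

lemma scal_inv:
  assumes "x \<in> scal"
  shows "inv x \<in> scal" "ev (inv x) = inverse (ev x)" "ev x \<noteq> 0"
proof -
  have x: "x \<in> carrier G" using assms scalD by auto
  have 1: "1\<^sub>m d = ev x \<cdot>\<^sub>m \<rho> (inv x)" using \<rho>_scal_mult(1)[OF assms inv_closed[OF x]] x \<rho>_one by simp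
  then have "(1\<^sub>m d :: complex mat) $$ (0, 0) = (ev x \<cdot>\<^sub>m \<rho> (inv x)) $$ (0, 0)" by simp
  then show nz: "ev x \<noteq> 0" using degree_pos \<rho>_carrier[OF inv_closed[OF x]] by auto
  have "\<rho> (inv x) = inverse (ev x) \<cdot>\<^sub>m (ev x \<cdot>\<^sub>m \<rho> (inv x))"
    using nz \<rho>_carrier[OF inv_closed[OF x]] by (intro eq_matI) auto
  then have "\<rho> (inv x) = inverse (ev x) \<cdot>\<^sub>m 1\<^sub>m d" using 1 by simp
  then show "inv x \<in> scal" "ev (inv x) = inverse (ev x)" using scalI ev_eqI x by auto
qed

lemma scal_pow:
  assumes "x \<in> scal"
  shows "x [^] (n::nat) \<in> scal" "ev (x [^] n) = ev x ^ n"
  using assms by (induction n) (auto simp: scal_one ev_one scal_mult mult.commute)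

lemma scal_subgroup: "subgroup scal G"
  by (rule subgroupI) (use scal_one scal_mult scal_inv scalD in auto)

lemma trace_scal: "x \<in> scal \<Longrightarrow> mat_trace (\<rho> x) = of_nat d * ev x"
  using scalD by (simp add: mat_trace_def)

lemma ker_iff: "x \<in> ker \<longleftrightarrow> x \<in> scal \<and> ev x = 1"
proof
  assume x: "x \<in> ker"
  then have "\<rho> x = 1 \<cdot>\<^sub>m 1\<^sub>m d" unfolding ker_def by (simp add: one_smult_one_mat)
  then show "x \<in> scal \<and> ev x = 1" using x scalI ev_eqI unfolding ker_def by blast
qed (use scalD in \<open>auto simp: ker_def one_smult_one_mat\<close>)

lemma ker_subgroup: "subgroup ker G"
proof (rule subgroupI)
  show "ker \<noteq> {}" using ker_iff[of \<one>] scal_one ev_one by auto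
qed (auto simp: ker_iff scal_mult scal_inv scalD)

lemma scal_iff_commutes:
  assumes x: "x \<in> carrier G"
  shows "x \<in> scal \<longleftrightarrow> (\<forall>g \<in> carrier G. \<rho> (x \<otimes> g) = \<rho> (g \<otimes> x))"
proof
  assume "\<forall>g \<in> carrier G. \<rho> (x \<otimes> g) = \<rho> (g \<otimes> x)"
  then have "\<exists>\<mu>. \<rho> x = \<mu> \<cdot>\<^sub>m 1\<^sub>m d" using \<rho>_mult x by (intro schur[OF irr \<rho>_carrier[OF x]]) auto
  then show "x \<in> scal" using x scalI by blast
qed (use \<rho>_scal_mult in auto)

lemma ker_iff_cancel:
  assumes "x \<in> carrier G" "y \<in> carrier G"
  shows "x \<in> ker \<longleftrightarrow> \<rho> (x \<otimes> y) = \<rho> y"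
proof
  assume "x \<in> ker" then show "\<rho> (x \<otimes> y) = \<rho> y"
    using \<rho>_mult[OF assms] \<rho>_carrier[OF assms(2)] unfolding ker_def by auto
next
  assume eq: "\<rho> (x \<otimes> y) = \<rho> y"
  have "\<rho> x = \<rho> (x \<otimes> y \<otimes> inv y)" using assms by (simp add: m_assoc)
  also have "\<dots> = \<rho> (x \<otimes> y) * \<rho> (inv y)" using assms by (intro \<rho>_mult) auto
  also have "\<dots> = \<rho> (y \<otimes> inv y)" unfolding eq using assms by (intro \<rho>_mult[symmetric]) auto
  finally show "x \<in> ker" using assms \<rho>_one unfolding ker_def by simp
qed

text \<open>Hence \<open>scal\<close> is the preimage of the centre of the quotient by
  \<open>ker\<close>: once the kernel is known, the scalar elements are determined by the group
  alone.\<close>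

lemma scal_iff_commutator:
  assumes x: "x \<in> carrier G"
  shows "x \<in> scal \<longleftrightarrow> (\<forall>g \<in> carrier G. commutator G x g \<in> ker)"
  unfolding scal_iff_commutes[OF x] using ker_iff_cancel commutator_mult commutator_closed x by (metis m_closed)

lemma center_scal: "group_center G \<subseteq> scal"
  unfolding group_center_def using scal_iff_commutes by auto

text \<open>Some conjugate of \<open>x\<close> acts as \<open>\<rho> x\<close> times an eigenvalue
  different from 1, while the trace is invariant under conjugation.\<close>

lemma trace_zero_off_scal:
  assumes cm: "\<And>x y. x \<in> carrier G \<Longrightarrow> y \<in> carrier G \<Longrightarrow> commutator G x y \<in> scal"
    and x: "x \<in> carrier G" "x \<notin> scal"
  shows "mat_trace (\<rho> x) = 0"
proof -
  obtain g where g: "g \<in> carrier G" "commutator G x g \<notin> ker" using scal_iff_commutator x by blast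
  then have s: "commutator G g x \<in> scal" "ev (commutator G g x) \<noteq> 1"
    using cm x g ker_iff subgroup.m_inv_closed[OF ker_subgroup] inv_commutator[of g x] by metis+
  have "\<rho> (g \<otimes> x \<otimes> inv g) = ev (commutator G g x) \<cdot>\<^sub>m \<rho> x"
    using conj_eq_commutator g x \<rho>_scal_mult(1)[OF s(1)] by simp
  then have "mat_trace (\<rho> (g \<otimes> x \<otimes> inv g)) = ev (commutator G g x) * mat_trace (\<rho> x)"
    using \<rho>_carrier[OF x(1)] by (simp add: mat_trace_def sum_distrib_left)
  moreover have "mat_trace (\<rho> (g \<otimes> x \<otimes> inv g)) = mat_trace (\<rho> x)"
  proof -
    have "mat_trace (\<rho> (g \<otimes> x \<otimes> inv g)) = (\<Sum>i<d. \<Sum>k<d. \<rho> (g \<otimes> x) $$ (i, k) * \<rho> (inv g) $$ (k, i))"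
      using g x by (simp add: trace_eq entry_mult)
    also have "\<dots> = (\<Sum>k<d. \<Sum>i<d. \<rho> (inv g) $$ (k, i) * \<rho> (g \<otimes> x) $$ (i, k))"
      by (subst sum.swap) (simp add: mult.commute)
    also have "\<dots> = mat_trace (\<rho> (inv g \<otimes> (g \<otimes> x)))"
      using g x by (subst trace_eq) (auto intro!: sum.cong entry_mult[symmetric])
    finally show ?thesis using g x by (simp add: m_assoc[symmetric])
  qed
  ultimately show ?thesis using s(2) by simp
qed

text \<open>Only the terms from \<open>scal\<close> survive in the norm relation, and each equals
  the square of \<open>d\<close> because the eigenvalues at an element and its inverse
  cancel.\<close>

lemma degree_square:
  assumes cm: "\<And>x y. x \<in> carrier G \<Longrightarrow> y \<in> carrier G \<Longrightarrow> commutator G x y \<in> scal"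
  shows "d\<^sup>2 * card scal = card (carrier G)"
proof -
  have sub: "scal \<subseteq> carrier G" using scalD by auto
  have "of_nat (card (carrier G)) = (\<Sum>g\<in>scal. mat_trace (\<rho> g) * mat_trace (\<rho> (inv g)))"
    unfolding trace_norm[symmetric]
    by (rule sum.mono_neutral_right) (use finite_carrier sub trace_zero_off_scal[OF cm] in auto)
  also have "\<dots> = (\<Sum>g\<in>scal. (of_nat d)\<^sup>2)"
    using scal_inv by (intro sum.cong) (auto simp: trace_scal power2_eq_square)
  also have "\<dots> = of_nat (d\<^sup>2 * card scal)" by simp
  finally show ?thesis by (metis of_nat_eq_iff)
qed

lemma degree_one_if_commuting:
  assumes cm: "\<And>x y. x \<in> carrier G \<Longrightarrow> y \<in> carrier G \<Longrightarrow> commutator G x y \<in> ker"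
  shows "d = 1"
proof -
  have "commutator G x y \<in> scal" if "x \<in> carrier G" "y \<in> carrier G" for x y using cm that ker_iff by auto
  moreover have "scal = carrier G" using cm scal_iff_commutator scalD by blast
  ultimately have "d\<^sup>2 * card (carrier G) = card (carrier G)" using degree_square by simp
  then show ?thesis using finite_carrier one_closed by (auto simp: card_eq_0_iff)
qed

lemma commutator_ker_if_degree_one:
  assumes "d = 1" "x \<in> carrier G" "y \<in> carrier G"
  shows "commutator G x y \<in> ker"
proof -
  have "\<rho> z = \<rho> z $$ (0, 0) \<cdot>\<^sub>m 1\<^sub>m d" if "z \<in> carrier G" for z
    using \<rho>_carrier[OF that] assms(1) by (intro eq_matI) auto
  then have "x \<in> scal" using scalI assms by blast
  then show ?thesis using scal_iff_commutator assms by blast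
qed

end

section \<open>Existence of irreducible representations\<close>

lemma irrepI: "group G \<Longrightarrow> finite (carrier G) \<Longrightarrow> is_irr_rep G d \<rho> \<Longrightarrow> irrep G d \<rho>"
  unfolding irrep_def irrep_axioms_def by auto

definition reg_rep :: "('a, 'b) monoid_scheme \<Rightarrow> (nat \<Rightarrow> 'a) \<Rightarrow> 'a \<Rightarrow> complex mat" where
  "reg_rep G e g = mat (card (carrier G)) (card (carrier G)) (\<lambda>(i, j). if e i = g \<otimes>\<^bsub>G\<^esub> e j then 1 else 0)"

text \<open>Through the enumeration \<open>e\<close>, vectors are functions on the group and the
  regular representation is translation; later computations are made with functions.\<close>

lemma reg_rep_vec:
  assumes "group G" and e: "bij_betw e {..<card (carrier G)} (carrier G)" and g: "g \<in> carrier G"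
  shows "reg_rep G e g *\<^sub>v vec (card (carrier G)) (\<lambda>i. F (e i)) = vec (card (carrier G)) (\<lambda>i. F (inv\<^bsub>G\<^esub> g \<otimes>\<^bsub>G\<^esub> e i))"
proof (rule eq_vecI)
  interpret group G by fact
  let ?n = "card (carrier G)"
  fix i assume "i < dim_vec (vec ?n (\<lambda>i. F (inv\<^bsub>G\<^esub> g \<otimes>\<^bsub>G\<^esub> e i)))"
  then have i: "i < ?n" by simp
  have ec: "e j \<in> carrier G" if "j < ?n" for j using e that unfolding bij_betw_def by auto
  have "inv\<^bsub>G\<^esub> g \<otimes>\<^bsub>G\<^esub> e i \<in> carrier G" using g ec[OF i] by simp
  then obtain k where k: "k < ?n" "e k = inv\<^bsub>G\<^esub> g \<otimes>\<^bsub>G\<^esub> e i" using e unfolding bij_betw_def by (metis imageE lessThan_iff)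
  have iff: "e i = g \<otimes>\<^bsub>G\<^esub> e j \<longleftrightarrow> j = k" if j: "j < ?n" for j
  proof -
    have "e i = g \<otimes>\<^bsub>G\<^esub> e j \<longleftrightarrow> e j = e k" unfolding k(2) using g ec[OF i] ec[OF j] by (metis inv_solve_left)
    then show ?thesis using e j k(1) unfolding bij_betw_def inj_on_def by auto
  qed
  have "(reg_rep G e g *\<^sub>v vec ?n (\<lambda>i. F (e i))) $ i = (\<Sum>j<?n. if j = k then F (e j) else 0)"
    unfolding reg_rep_def using i iff by (simp add: scalar_prod_def atLeast0LessThan if_distrib[of "\<lambda>x. x * _"] cong: if_cong)
  also have "\<dots> = F (inv\<^bsub>G\<^esub> g \<otimes>\<^bsub>G\<^esub> e i)" using k by simp
  finally show "(reg_rep G e g *\<^sub>v vec ?n (\<lambda>i. F (e i))) $ i = vec ?n (\<lambda>i. F (inv\<^bsub>G\<^esub> g \<otimes>\<^bsub>G\<^esub> e i)) $ i"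
    using i by simp
qed (simp add: reg_rep_def)

lemma vec_as_fun:
  assumes e: "bij_betw e {..<n} A" and v: "v \<in> carrier_vec n"
  shows "\<exists>F. v = vec n (\<lambda>i. F (e i))"
  using assms by (intro exI[of _ "\<lambda>x. v $ (the_inv_into {..<n} e x)"] eq_vecI)
    (auto simp: bij_betw_def the_inv_into_f_f)

lemma reg_rep_is_rep:
  assumes "group G" and fin: "finite (carrier G)" and e: "bij_betw e {..<card (carrier G)} (carrier G)"
  shows "is_rep G (card (carrier G)) (reg_rep G e)"
  unfolding is_rep_def
proof (intro conjI ballI)
  interpret group G by fact
  let ?n = "card (carrier G)"
  have ec: "e j \<in> carrier G" if "j < ?n" for j using e that unfolding bij_betw_def by auto
  show "0 < ?n" using fin one_closed by (metis card_gt_0_iff empty_iff)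
  show car: "reg_rep G e g \<in> carrier_mat ?n ?n" for g unfolding reg_rep_def by simp
  show "reg_rep G e \<one>\<^bsub>G\<^esub> = 1\<^sub>m ?n" unfolding reg_rep_def
    using ec e by (intro eq_matI) (auto simp: bij_betw_def inj_on_def)
  fix g h assume gh: "g \<in> carrier G" "h \<in> carrier G"
  show "reg_rep G e (g \<otimes>\<^bsub>G\<^esub> h) = reg_rep G e g * reg_rep G e h"
  proof (rule mat_eq_by_vec[of _ ?n ?n])
    fix v :: "complex vec" assume v: "v \<in> carrier_vec ?n"
    then obtain F where F: "v = vec ?n (\<lambda>i. F (e i))" using vec_as_fun[OF e] by blast
    have "(reg_rep G e g * reg_rep G e h) *\<^sub>v v = reg_rep G e g *\<^sub>v (reg_rep G e h *\<^sub>v v)"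
      using car v by (metis assoc_mult_mat_vec)
    also have "\<dots> = vec ?n (\<lambda>i. F (inv\<^bsub>G\<^esub> h \<otimes>\<^bsub>G\<^esub> (inv\<^bsub>G\<^esub> g \<otimes>\<^bsub>G\<^esub> e i)))"
      unfolding F reg_rep_vec[OF assms(1) e gh(2)]
      using reg_rep_vec[OF assms(1) e gh(1), of "\<lambda>x. F (inv\<^bsub>G\<^esub> h \<otimes>\<^bsub>G\<^esub> x)"] by simp
    also have "\<dots> = reg_rep G e (g \<otimes>\<^bsub>G\<^esub> h) *\<^sub>v v"
      unfolding F reg_rep_vec[OF assms(1) e m_closed[OF gh]]
      using gh ec by (intro eq_vecI) (auto simp: inv_mult_group m_assoc)
    finally show "reg_rep G e (g \<otimes>\<^bsub>G\<^esub> h) *\<^sub>v v = (reg_rep G e g * reg_rep G e h) *\<^sub>v v" by simp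
  qed (use car mult_carrier_mat in blast)+
qed

lemma root_of_unity_sum:
  assumes "n > 0" "j < n"
  shows "(\<Sum>i<n. (cis (2 * pi / real n) ^ i) ^ j) = (if j = 0 then of_nat n else (0::complex))"
proof (cases "j = 0")
  case False
  let ?w = "cis (2 * pi / real n) ^ j"
  have "?w \<noteq> 1" unfolding cis_root_of_unity_power_eq_1_iff[OF assms(1)] using assms False by (auto dest: dvd_imp_le)
  moreover have "?w ^ n = 1" unfolding power_mult[symmetric] cis_root_of_unity_power_eq_1_iff[OF assms(1)] by simp
  moreover have "?w ^ n - 1 = (?w - 1) * (\<Sum>i<n. ?w ^ i)" by (rule power_diff_1_eq)
  ultimately have "(\<Sum>i<n. ?w ^ i) = 0" by simp
  then show ?thesis using False by (simp add: power_mult[symmetric] mult.commute)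
qed simp

context group
begin

text \<open>On the functions invariant under \<open>M\<close>, translation by \<open>a\<close> has
  finite order and is not the identity, because it moves the indicator function of \<open>M\<close>.
  Decomposing that indicator into eigenfunctions yields one with an eigenvalue other than 1.\<close>

lemma invariant_eigenfunction_exists:
  assumes fin: "finite (carrier G)" and M: "M \<lhd> G" and a: "a \<in> carrier G" "a \<notin> M"
  shows "\<exists>F \<mu>. \<mu> \<noteq> (1::complex) \<and> (\<exists>x \<in> carrier G. F x \<noteq> 0) \<and>
    (\<forall>x \<in> carrier G. \<forall>m \<in> M. F (inv m \<otimes> x) = F x) \<and>
    (\<forall>x \<in> carrier G. F (inv a \<otimes> x) = \<mu> * F x)"
proof -
  interpret M: normal M G by fact
  let ?n = "card (carrier G)"
  let ?z = "cis (2 * pi / real ?n)"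
  have n0: "?n > 0" using fin one_closed by (metis card_gt_0_iff empty_iff)
  have an: "a [^] ?n = \<one>" using pow_order_eq_1[OF a(1)] by (simp add: Coset.order_def)
  define b where "b j x = (if inv (a [^] j) \<otimes> x \<in> M then 1 else 0 :: complex)" for j :: nat and x
  \<comment> \<open>the Fourier components, under translation by \<open>a\<close>, of the indicator function of \<open>M\<close>\<close>
  define F where "F i x = (\<Sum>j<?n. (?z ^ i) ^ j * b j x)" for i x
  have bS: "b j (inv a \<otimes> x) = b (Suc j) x" if x: "x \<in> carrier G" for j x
  proof -
    have "inv (a [^] Suc j) \<otimes> x = inv (a [^] j) \<otimes> (inv a \<otimes> x)"
      unfolding nat_pow_Suc2[OF a(1)] using a x by (simp add: inv_mult_group m_assoc)
    then show ?thesis unfolding b_def by simp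
  qed
  have bn: "b ?n x = b 0 x" for x unfolding b_def using an by simp
  have bM: "b j (inv m \<otimes> x) = b j x" if x: "x \<in> carrier G" and m: "m \<in> M" for j m x
  proof -
    let ?y = "inv (a [^] j)"
    have mc: "m \<in> carrier G" using m M.subset by auto
    have "?y \<otimes> (inv m \<otimes> x) = (?y \<otimes> inv m \<otimes> inv ?y) \<otimes> (?y \<otimes> x)"
      using a mc x by (simp add: m_assoc) (simp add: m_assoc[symmetric])
    moreover have "?y \<otimes> inv m \<otimes> inv ?y \<in> M" using M.inv_op_closed2[of ?y "inv m"] m a by simp
    moreover have "t \<otimes> s \<in> M \<longleftrightarrow> s \<in> M" if t: "t \<in> M" and s: "s \<in> carrier G" for t s
    proof
      assume "t \<otimes> s \<in> M"
      then have "inv t \<otimes> (t \<otimes> s) \<in> M" using t by simp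
      then show "s \<in> M" using t s by (simp add: m_assoc[symmetric])
    qed (use t in simp)
    ultimately show ?thesis unfolding b_def using a x by simp
  qed
  have zn: "(?z ^ i) ^ ?n = 1" for i
    unfolding power_mult[symmetric] cis_root_of_unity_power_eq_1_iff[OF n0] by simp
  have Fa: "?z ^ i * F i (inv a \<otimes> x) = F i x" if x: "x \<in> carrier G" for i x
  proof -
    have "?z ^ i * F i (inv a \<otimes> x) = (\<Sum>j<?n. (?z ^ i) ^ Suc j * b (Suc j) x)"
      unfolding F_def sum_distrib_left by (simp add: bS[OF x] mult.assoc)
    also have "\<dots> = (\<Sum>j<Suc ?n. (?z ^ i) ^ j * b j x) - b 0 x"
      by (subst sum.lessThan_Suc_shift) simp
    also have "\<dots> = F i x" unfolding F_def by (simp add: zn bn)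
    finally show ?thesis .
  qed
  have sumF: "(\<Sum>i<?n. F i x) = of_nat ?n * b 0 x" for x
  proof -
    have "(\<Sum>i<?n. F i x) = (\<Sum>j<?n. (\<Sum>i<?n. (?z ^ i) ^ j) * b j x)"
      unfolding F_def sum_distrib_right by (rule sum.swap)
    also have "\<dots> = (\<Sum>j<?n. (if j = 0 then of_nat ?n else 0) * b j x)"
      using n0 by (intro sum.cong) (auto simp: root_of_unity_sum)
    also have "\<dots> = (\<Sum>j<?n. if j = 0 then of_nat ?n * b j x else 0)" by (intro sum.cong) auto
    also have "\<dots> = of_nat ?n * b 0 x" using n0 by (simp add: sum.delta)
    finally show ?thesis .
  qed
  \<comment> \<open>If only component 0 survived, the indicator function would be invariant under
    \<open>a\<close>, but it separates the identity from \<open>a\<close>.\<close>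
  have "\<exists>i\<in>{1..<?n}. \<exists>x \<in> carrier G. F i x \<noteq> 0"
  proof (rule ccontr)
    assume neg: "\<not> ?thesis"
    have "F 0 x = of_nat ?n * b 0 x" if x: "x \<in> carrier G" for x
    proof -
      have "(\<Sum>i<?n. F i x) = (\<Sum>i\<in>{0}. F i x)"
        using neg x n0 by (intro sum.mono_neutral_right) auto
      then show ?thesis using sumF[of x] by simp
    qed
    moreover have "F 0 \<one> = F 0 a" using Fa[OF a(1), of 0] a by simp
    moreover have "b 0 \<one> = 1" "b 0 a = 0" unfolding b_def using a M.one_closed by auto
    ultimately show False using n0 a by auto
  qed
  then obtain i where i: "i \<in> {1..<?n}" "\<exists>x \<in> carrier G. F i x \<noteq> 0" by blast
  have z1: "?z ^ i \<noteq> 1" unfolding cis_root_of_unity_power_eq_1_iff[OF n0] using i by (auto dest: dvd_imp_le)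
  show ?thesis
  proof (intro exI conjI ballI)
    show "inverse (?z ^ i) \<noteq> 1" using z1 by (metis inverse_1 inverse_inverse_eq)
    show "\<exists>x \<in> carrier G. F i x \<noteq> 0" by fact
    show "F i (inv m \<otimes> x) = F i x" if "x \<in> carrier G" "m \<in> M" for x m
      unfolding F_def using bM[OF that] by simp
    show "F i (inv a \<otimes> x) = inverse (?z ^ i) * F i x" if "x \<in> carrier G" for x
    proof -
      have nz: "?z ^ i \<noteq> 0" by simp
      have "F i (inv a \<otimes> x) = inverse (?z ^ i) * (?z ^ i * F i (inv a \<otimes> x))"
        unfolding mult.assoc[symmetric] left_inverse[OF nz] by simp
      then show ?thesis unfolding Fa[OF that] .
    qed
  qed
qed

text \<open>The vectors of the regular representation fixed by \<open>M\<close> on which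
  \<open>a\<close> acts by \<open>\<mu>\<close> form a subspace, invariant because \<open>M\<close>
  is normal and \<open>a\<close> is central modulo \<open>M\<close>. Any irreducible constituent
  inside it has the required properties. Linear and nonlinear representations alike are produced in
  this way.\<close>

lemma irrep_separating:
  assumes fin: "finite (carrier G)" and M: "M \<lhd> G" and a: "a \<in> carrier G" "a \<notin> M"
    and cm: "\<And>g. g \<in> carrier G \<Longrightarrow> commutator G g a \<in> M"
  shows "\<exists>d \<rho>. irrep G d \<rho> \<and> M \<subseteq> irrep.ker G d \<rho> \<and> a \<in> irrep.scal G d \<rho> \<and> a \<notin> irrep.ker G d \<rho>"
proof -
  interpret M: normal M G by fact
  let ?n = "card (carrier G)"
  obtain e where e: "bij_betw e {..<?n} (carrier G)"
    using ex_bij_betw_nat_finite[OF fin] by (auto simp: atLeast0LessThan)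
  let ?r = "reg_rep G e"
  note reg = reg_rep_is_rep[OF group_axioms fin e]
  note R = is_repD[OF reg]
  obtain F \<mu> where \<mu>: "\<mu> \<noteq> (1::complex)" and F0: "\<exists>x \<in> carrier G. F x \<noteq> 0"
    and FM: "\<And>x m. x \<in> carrier G \<Longrightarrow> m \<in> M \<Longrightarrow> F (inv m \<otimes> x) = F x"
    and Fa: "\<And>x. x \<in> carrier G \<Longrightarrow> F (inv a \<otimes> x) = \<mu> * F x"
    using invariant_eigenfunction_exists[OF assms(1-4)] by blast
  define W where "W = {v \<in> carrier_vec ?n. (\<forall>m \<in> M. ?r m *\<^sub>v v = v) \<and> ?r a *\<^sub>v v = \<mu> \<cdot>\<^sub>v v}"
  have Mc: "m \<in> M \<Longrightarrow> m \<in> carrier G" for m using M.subset by auto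
  have ec: "e j \<in> carrier G" if "j < ?n" for j using e that unfolding bij_betw_def by auto
  have z: "?r m *\<^sub>v 0\<^sub>v ?n = 0\<^sub>v ?n" if "m \<in> carrier G" for m
    using R(2)[OF that] by (intro eq_vecI) auto
  have sub: "is_subspace ?n W" unfolding is_subspace_def W_def
    using R(2)[OF a(1)] R(2)[OF Mc] z[OF a(1)] z[OF Mc]
    by (auto simp: mult_add_distrib_mat_vec[of _ ?n ?n] smult_add_distrib_vec mult_mat_vec[of _ ?n ?n] smult_smult_assoc mult.commute)
  have "vec ?n (\<lambda>i. F (e i)) \<in> W"
    unfolding W_def using reg_rep_vec[OF group_axioms e, of _ F] a Mc ec FM Fa by (auto intro!: eq_vecI)
  moreover have "vec ?n (\<lambda>i. F (e i)) \<noteq> 0\<^sub>v ?n"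
  proof -
    obtain x where x: "x \<in> carrier G" "F x \<noteq> 0" using F0 by blast
    then obtain i where "i < ?n" "e i = x" using e unfolding bij_betw_def by (metis imageE lessThan_iff)
    then show ?thesis using x by (metis index_vec index_zero_vec(1))
  qed
  ultimately have W0: "W \<noteq> {0\<^sub>v ?n}" by blast
  have inv: "\<forall>g \<in> carrier G. \<forall>w \<in> W. ?r g *\<^sub>v w \<in> W"
  proof (intro ballI)
    fix g w assume g: "g \<in> carrier G" and w: "w \<in> W"
    have wc: "w \<in> carrier_vec ?n" and wM: "\<And>m. m \<in> M \<Longrightarrow> ?r m *\<^sub>v w = w" and wa: "?r a *\<^sub>v w = \<mu> \<cdot>\<^sub>v w"
      using w unfolding W_def by auto
    have comp: "?r (x \<otimes> y) *\<^sub>v w = ?r x *\<^sub>v (?r y *\<^sub>v w)" if "x \<in> carrier G" "y \<in> carrier G" for x y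
      using R(2,3) that wc by (metis assoc_mult_mat_vec)
    have "?r m *\<^sub>v (?r g *\<^sub>v w) = ?r g *\<^sub>v w" if m: "m \<in> M" for m
    proof -
      have "inv g \<otimes> m \<otimes> g \<in> M" using M.inv_op_closed1[OF g m] .
      moreover have "m \<otimes> g = g \<otimes> (inv g \<otimes> m \<otimes> g)" using g Mc[OF m] by (simp add: m_assoc[symmetric])
      ultimately show ?thesis using comp g m Mc wM by metis
    qed
    moreover have "?r a *\<^sub>v (?r g *\<^sub>v w) = \<mu> \<cdot>\<^sub>v (?r g *\<^sub>v w)"
    proof -
      \<comment> \<open>Moving \<open>a\<close> past \<open>g\<close> costs this commutator, which
        lies in \<open>M\<close> and so acts trivially on \<open>w\<close>.\<close>
      let ?m = "commutator G (inv g) a"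
      have m: "?m \<in> M" using cm g by simp
      have "a \<otimes> g = g \<otimes> (?m \<otimes> a)" using g a unfolding commutator_def by (simp add: m_assoc[symmetric]) (simp add: m_assoc)
      then have "?r a *\<^sub>v (?r g *\<^sub>v w) = ?r g *\<^sub>v (?r (?m \<otimes> a) *\<^sub>v w)" using comp g a m Mc by (metis m_closed)
      also have "?r (?m \<otimes> a) *\<^sub>v w = ?r ?m *\<^sub>v (\<mu> \<cdot>\<^sub>v w)" using comp a m Mc wa by metis
      also have "\<dots> = \<mu> \<cdot>\<^sub>v w" using mult_mat_vec[OF R(2)[OF Mc[OF m]] wc] wM[OF m] by simp
      also have "?r g *\<^sub>v \<dots> = \<mu> \<cdot>\<^sub>v (?r g *\<^sub>v w)" using mult_mat_vec[OF R(2)[OF g] wc] .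
      finally show ?thesis .
    qed
    ultimately show "?r g *\<^sub>v w \<in> W" unfolding W_def using R(2)[OF g] wc by simp
  qed
  obtain d \<rho> B where irr: "is_irr_rep G d \<rho>" and B: "inj_mat ?n d B"
    and BW: "\<And>x. x \<in> carrier_vec d \<Longrightarrow> B *\<^sub>v x \<in> W" and comm: "\<And>g. g \<in> carrier G \<Longrightarrow> ?r g * B = B * \<rho> g"
    using irr_subrep_exists[OF group_axioms reg sub W0 inv] by blast
  interpret irrep G d \<rho> using irrepI[OF group_axioms fin irr] .
  have Bc: "B \<in> carrier_mat ?n d" using B unfolding inj_mat_def by auto
  have main: "\<rho> g = c \<cdot>\<^sub>m 1\<^sub>m d" if g: "g \<in> carrier G" and c: "\<And>w. w \<in> W \<Longrightarrow> ?r g *\<^sub>v w = c \<cdot>\<^sub>v w" for g c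
  proof (rule mat_eq_by_vec[OF \<rho>_carrier[OF g]])
    fix v :: "complex vec" assume v: "v \<in> carrier_vec d"
    have "B *\<^sub>v (\<rho> g *\<^sub>v v) = ?r g *\<^sub>v (B *\<^sub>v v)"
      using comm[OF g] Bc \<rho>_carrier[OF g] R(2)[OF g] v by (metis assoc_mult_mat_vec)
    also have "\<dots> = c \<cdot>\<^sub>v (B *\<^sub>v v)" using c BW v by blast
    also have "\<dots> = B *\<^sub>v (c \<cdot>\<^sub>v v)" using mult_mat_vec[OF Bc v] by simp
    finally have "\<rho> g *\<^sub>v v = c \<cdot>\<^sub>v v" using inj_mat_eqD[OF B] \<rho>_carrier[OF g] v by simp
    then show "\<rho> g *\<^sub>v v = (c \<cdot>\<^sub>m 1\<^sub>m d) *\<^sub>v v" using smult_one_mat_vec[OF v] by simp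
  qed simp
  have "\<rho> a = \<mu> \<cdot>\<^sub>m 1\<^sub>m d" using main[OF a(1), of \<mu>] unfolding W_def by blast
  then have "a \<in> scal" "a \<notin> ker" using scalI ev_eqI ker_iff \<mu> a by auto
  moreover have "\<rho> m = 1 \<cdot>\<^sub>m 1\<^sub>m d" if "m \<in> M" for m
    using main[OF Mc[OF that], of 1] that unfolding W_def by simp
  then have "M \<subseteq> ker" using Mc one_smult_one_mat unfolding ker_def by auto
  ultimately show ?thesis using irrep_axioms by blast
qed

end

section \<open>Degrees, kernels and Galois conjugacy\<close>

context irrep
begin

text \<open>As commutators of \<open>C\<close> act trivially, the restriction to \<open>C\<close>
  has a one-dimensional constituent, spanned by a common eigenvector \<open>v\<close>. The
  translates of \<open>v\<close> along the cosets of \<open>C\<close> span an invariant subspace,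
  hence everything.\<close>

lemma degree_le_index:
  assumes C: "subgroup C G" and cm: "\<And>x y. x \<in> C \<Longrightarrow> y \<in> C \<Longrightarrow> commutator G x y \<in> ker"
  shows "d \<le> card (rcosets C)"
proof -
  let ?H = "G\<lparr>carrier := C\<rparr>"
  interpret C: subgroup C G by fact
  have Cc: "x \<in> C \<Longrightarrow> x \<in> carrier G" for x using C.subset by auto
  have grpH: "group ?H" by (rule subgroup.subgroup_is_group[OF C group_axioms])
  have finH: "finite (carrier ?H)" using finite_subset[OF C.subset finite_carrier] by simp
  have repH: "is_rep ?H d \<rho>" unfolding is_rep_def using degree_pos \<rho>_carrier \<rho>_mult \<rho>_one Cc by auto
  have sub: "is_subspace d (carrier_vec d)" unfolding is_subspace_def by auto
  have "unit_vec d 0 \<noteq> (0\<^sub>v d :: complex vec)" using degree_pos by simp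
  then have ne: "carrier_vec d \<noteq> {0\<^sub>v d :: complex vec}" by (metis singletonD unit_vec_carrier)
  have inv: "\<forall>g \<in> carrier ?H. \<forall>w \<in> carrier_vec d. \<rho> g *\<^sub>v w \<in> carrier_vec d"
    by (auto intro!: mult_mat_vec_carrier[OF \<rho>_carrier] Cc)
  obtain f \<tau> B where irrH: "is_irr_rep ?H f \<tau>" and B: "inj_mat d f B"
    and comm: "\<And>g. g \<in> C \<Longrightarrow> \<rho> g * B = B * \<tau> g"
    using irr_subrep_exists[OF grpH repH sub ne inv] by auto
  interpret H: irrep ?H f \<tau> using irrepI[OF grpH finH irrH] .
  have Bc: "B \<in> carrier_mat d f" using B unfolding inj_mat_def by auto
  have f1: "f = 1"
  proof (rule H.degree_one_if_commuting)
    fix x y assume "x \<in> carrier ?H" "y \<in> carrier ?H"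
    then have xy: "x \<in> C" "y \<in> C" by auto
    have eq: "commutator ?H x y = commutator G x y" unfolding commutator_def using xy m_inv_consistent[OF C] by simp
    have c: "commutator G x y \<in> C" unfolding commutator_def using xy by simp
    have "B * \<tau> (commutator G x y) = B * 1\<^sub>m f"
      using comm[OF c] cm[OF xy] Bc unfolding ker_def by simp
    then have "\<tau> (commutator G x y) = 1\<^sub>m f" using inj_mat_cancel[OF B _ one_carrier_mat] H.\<rho>_carrier[of "commutator G x y"] c by simp
    then show "commutator ?H x y \<in> H.ker" unfolding H.ker_def eq using c by simp
  qed
  define v where "v = B *\<^sub>v unit_vec 1 0"
  have vc: "v \<in> carrier_vec d" unfolding v_def using Bc f1 by simp
  have v0: "v \<noteq> 0\<^sub>v d" unfolding v_def using B f1 unfolding inj_mat_def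
    by (metis less_one unit_vec_carrier unit_vec_nonzero)
  have vC: "\<exists>\<nu>. \<rho> c *\<^sub>v v = \<nu> \<cdot>\<^sub>v v" if c: "c \<in> C" for c
  proof -
    let ?u = "unit_vec 1 0 :: complex vec"
    have t: "\<tau> c \<in> carrier_mat 1 1" using H.\<rho>_carrier c f1 by simp
    have "\<rho> c *\<^sub>v v = B *\<^sub>v (\<tau> c *\<^sub>v ?u)" unfolding v_def
      using comm[OF c] Bc t f1 \<rho>_carrier[OF Cc[OF c]] by (metis assoc_mult_mat_vec unit_vec_carrier)
    also have "\<tau> c *\<^sub>v ?u = (\<tau> c $$ (0, 0)) \<cdot>\<^sub>v ?u"
      using t by (intro eq_vecI) (auto simp: scalar_prod_right_unit)
    also have "B *\<^sub>v \<dots> = (\<tau> c $$ (0, 0)) \<cdot>\<^sub>v v" unfolding v_def using Bc f1 by (metis mult_mat_vec unit_vec_carrier)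
    finally show ?thesis by blast
  qed
  let ?m = "card (rcosets C)"
  have finR: "finite (rcosets C)" using finite_carrier unfolding RCOSETS_def by simp
  obtain e where e: "bij_betw e {..<?m} (rcosets C)"
    using ex_bij_betw_nat_finite[OF finR] by (auto simp: atLeast0LessThan)
  have "\<exists>r \<in> carrier G. e j = C #> r" if "j < ?m" for j
    using e that unfolding bij_betw_def RCOSETS_def by blast
  then obtain r where r: "\<And>j. j < ?m \<Longrightarrow> r j \<in> carrier G \<and> e j = C #> r j" by metis
  have cover: "\<exists>k c. k < ?m \<and> c \<in> C \<and> g = c \<otimes> r k" if g: "g \<in> carrier G" for g
  proof -
    have "C #> g \<in> rcosets C" using g unfolding RCOSETS_def by auto
    then obtain k where k: "k < ?m" "e k = C #> g" using e unfolding bij_betw_def by (metis imageE lessThan_iff)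
    then have "g \<in> C #> r k" using r rcos_self[OF g C] by auto
    then show ?thesis unfolding r_coset_def using k by auto
  qed
  \<comment> \<open>The cosets are \<open>C #> r j\<close>, so the elements moving \<open>v\<close>
    are the inverses of the representatives; another representative would only rescale the translate
    by an eigenvalue of \<open>C\<close>.\<close>
  define u where "u j = \<rho> (inv (r j)) *\<^sub>v v" for j
  have uc: "u j \<in> carrier_vec d" if "j < ?m" for j
    unfolding u_def using r[OF that] \<rho>_carrier vc by (meson inv_closed mult_mat_vec_carrier)
  have \<rho>v: "\<rho> (x \<otimes> y) *\<^sub>v v = \<rho> x *\<^sub>v (\<rho> y *\<^sub>v v)" if "x \<in> carrier G" "y \<in> carrier G" for x y
    using \<rho>_mult \<rho>_carrier vc that by (metis assoc_mult_mat_vec)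
  have perm: "\<exists>k s. k < ?m \<and> \<rho> g *\<^sub>v u j = s \<cdot>\<^sub>v u k" if g: "g \<in> carrier G" and j: "j < ?m" for g j
  proof -
    have rj: "r j \<in> carrier G" using r j by auto
    obtain k c where k: "k < ?m" "c \<in> C" "r j \<otimes> inv g = c \<otimes> r k" using cover[of "r j \<otimes> inv g"] g rj by auto
    have rk: "r k \<in> carrier G" using r k by auto
    have "g \<otimes> inv (r j) = inv (r j \<otimes> inv g)" using g rj by (simp add: inv_mult_group)
    also have "\<dots> = inv (r k) \<otimes> inv c" unfolding k(3) using rk Cc[OF k(2)] by (simp add: inv_mult_group)
    finally have eq: "g \<otimes> inv (r j) = inv (r k) \<otimes> inv c" .
    obtain \<nu> where \<nu>: "\<rho> (inv c) *\<^sub>v v = \<nu> \<cdot>\<^sub>v v" using vC k(2) by auto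
    have "\<rho> g *\<^sub>v u j = \<rho> (inv (r k)) *\<^sub>v (\<rho> (inv c) *\<^sub>v v)"
      unfolding u_def using \<rho>v g rj rk Cc[OF k(2)] eq by (metis inv_closed)
    also have "\<dots> = \<nu> \<cdot>\<^sub>v u k" unfolding \<nu> u_def using \<rho>_carrier[OF inv_closed[OF rk]] vc by (simp add: mult_mat_vec)
    finally show ?thesis using k(1) by blast
  qed
  define A where "A = mat d ?m (\<lambda>(i, j). u j $ i)"
  have A: "A \<in> carrier_mat d ?m" unfolding A_def by simp
  have Aunit: "A *\<^sub>v unit_vec ?m j = u j" if "j < ?m" for j
    unfolding A_def using that uc[OF that] by (intro eq_vecI) (auto simp: scalar_prod_right_unit)
  define U where "U = (\<lambda>x. A *\<^sub>v x) ` carrier_vec ?m"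
  have "is_subspace d U" unfolding is_subspace_def
  proof (intro conjI ballI allI)
    show "U \<subseteq> carrier_vec d" unfolding U_def using A by auto
    have "A *\<^sub>v 0\<^sub>v ?m = 0\<^sub>v d" using A by (intro eq_vecI) auto
    then show "0\<^sub>v d \<in> U" unfolding U_def by (metis image_eqI zero_carrier_vec)
    show "x + y \<in> U" if "x \<in> U" "y \<in> U" for x y
      using that A unfolding U_def by (auto simp: mult_add_distrib_mat_vec[OF A, symmetric])
    show "c \<cdot>\<^sub>v x \<in> U" if "x \<in> U" for c x
      using that A unfolding U_def by (auto simp: mult_mat_vec[OF A, symmetric])
  qed
  moreover have "\<forall>g \<in> carrier G. \<forall>w \<in> U. \<rho> g *\<^sub>v w \<in> U"
  proof (intro ballI)
    fix g w assume g: "g \<in> carrier G" and w: "w \<in> U"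
    obtain k s where ks: "\<And>j. j < ?m \<Longrightarrow> k j < ?m \<and> \<rho> g *\<^sub>v u j = s j \<cdot>\<^sub>v u (k j)"
      using perm[OF g] by metis
    \<comment> \<open>Every column has a single possibly nonzero entry: \<open>g\<close> sends each
      translate to a multiple of another.\<close>
    define T where "T = mat ?m ?m (\<lambda>(i, j). if i = k j then s j else 0)"
    have T: "T \<in> carrier_mat ?m ?m" unfolding T_def by simp
    have "\<rho> g * A = A * T"
    proof (rule eq_matI)
      fix i j assume "i < dim_row (A * T)" "j < dim_col (A * T)"
      then have ij: "i < d" "j < ?m" using A T by auto
      have "(\<rho> g * A) $$ (i, j) = (\<rho> g *\<^sub>v u j) $ i"
        using ij \<rho>_carrier[OF g] A uc[OF ij(2)] unfolding A_def by (auto simp: scalar_prod_def)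
      also have "\<dots> = s j * u (k j) $ i" using ks[OF ij(2)] ij uc[of "k j"] by simp
      also have "\<dots> = (\<Sum>l<?m. if l = k j then s j * u (k j) $ i else 0)" using ks[OF ij(2)] by simp
      also have "\<dots> = (\<Sum>l<?m. u l $ i * (if l = k j then s j else 0))" by (intro sum.cong) auto
      also have "\<dots> = (A * T) $$ (i, j)"
        using ij unfolding A_def T_def by (simp add: scalar_prod_def atLeast0LessThan)
      finally show "(\<rho> g * A) $$ (i, j) = (A * T) $$ (i, j)" .
    qed (use \<rho>_carrier[OF g] A T in auto)
    moreover obtain x where x: "x \<in> carrier_vec ?m" "w = A *\<^sub>v x" using w unfolding U_def by blast
    ultimately have "\<rho> g *\<^sub>v w = A *\<^sub>v (T *\<^sub>v x)" using A T \<rho>_carrier[OF g] by (metis assoc_mult_mat_vec)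
    then show "\<rho> g *\<^sub>v w \<in> U" unfolding U_def using T x by (metis image_eqI mult_mat_vec_carrier)
  qed
  moreover have "U \<noteq> {0\<^sub>v d}"
  proof
    assume U0: "U = {0\<^sub>v d}"
    obtain k c where k: "k < ?m" "c \<in> C" "\<one> = c \<otimes> r k" using cover[of \<one>] by auto
    have rk: "r k \<in> carrier G" using r k by auto
    have "u k \<in> U" unfolding U_def using Aunit[OF k(1)] by (metis image_eqI unit_vec_carrier)
    then have "u k = 0\<^sub>v d" using U0 by auto
    then have "\<rho> (r k) *\<^sub>v u k = 0\<^sub>v d" using \<rho>_carrier[OF rk] by (intro eq_vecI) auto
    moreover have "\<rho> (r k) *\<^sub>v u k = v" unfolding u_def using \<rho>v[OF rk inv_closed[OF rk]] rk \<rho>_one vc by simp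
    ultimately show False using v0 by simp
  qed
  ultimately have "U = carrier_vec d" using irr unfolding is_irr_rep_def by blast
  then show ?thesis using surjective_matrix_dim_ge[OF A] unfolding U_def by (metis imageE)
qed

text \<open>\<open>ev\<close> is a homomorphism on \<open>S\<close> with kernel \<open>ker\<close>,
  and its fibres are the cosets of \<open>ker\<close>.\<close>

lemma card_eq_ev_image:
  assumes S: "subgroup S G" "ker \<subseteq> S" "S \<subseteq> scal"
  shows "card S = card (ev ` S) * card ker"
proof -
  interpret S: subgroup S G by fact
  have fin: "finite S" using finite_subset[OF S.subset finite_carrier] .
  have kc: "k \<in> ker \<Longrightarrow> k \<in> carrier G" for k unfolding ker_def by auto
  have fiber: "card {y \<in> S. ev y = ev x} = card ker" if x: "x \<in> S" for x
  proof -
    have xc: "x \<in> carrier G" using x S.subset by auto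
    have "bij_betw (\<lambda>k. x \<otimes> k) ker {y \<in> S. ev y = ev x}"
    proof (rule bij_betwI[where g = "\<lambda>y. inv x \<otimes> y"])
      show "(\<lambda>k. x \<otimes> k) \<in> ker \<rightarrow> {y \<in> S. ev y = ev x}"
        using x S ker_iff scal_mult by auto
      show "(\<lambda>y. inv x \<otimes> y) \<in> {y \<in> S. ev y = ev x} \<rightarrow> ker"
        using x S scal_mult scal_inv by (auto simp: ker_iff subset_iff)
    qed (use xc kc S.subset in \<open>auto simp: m_assoc[symmetric]\<close>)
    then show ?thesis using bij_betw_same_card by metis
  qed
  have "card S = (\<Sum>u\<in>ev ` S. card {y \<in> S. ev y = u})"
    using sum.image_gen[OF fin, of "\<lambda>_. 1::nat" ev] by simp
  also have "\<dots> = (\<Sum>u\<in>ev ` S. card ker)" using fiber by (intro sum.cong) auto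
  finally show ?thesis by simp
qed

text \<open>Eigenvalues of scalar elements are p-th roots of eigenvalues of \<open>Z\<close>, and a
  nonzero complex number has p of them. So the image of \<open>ev\<close> grows by a factor of at
  most p, and so does the group, as the kernel is shared.\<close>

lemma card_scal_le:
  assumes Z: "subgroup Z G" "ker \<subseteq> Z" "Z \<subseteq> scal" and p: "p > 0" and pow: "\<And>x. x \<in> scal \<Longrightarrow> x [^] p \<in> Z"
  shows "card scal \<le> p * card Z"
proof -
  have fin: "finite scal" "finite Z" using finite_subset[OF _ finite_carrier] scalD(1) Z by blast+
  have nz: "w \<in> ev ` Z \<Longrightarrow> w \<noteq> 0" for w using scal_inv(3) Z(3) by auto
  have "ev ` scal \<subseteq> (\<Union>w\<in>ev ` Z. {u. u ^ p = w})"
  proof (rule subsetI)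
    fix u assume "u \<in> ev ` scal"
    then obtain x where "x \<in> scal" "u = ev x" by blast
    then have "x [^] p \<in> Z" "u ^ p = ev (x [^] p)" using pow scal_pow(2) by auto
    then show "u \<in> (\<Union>w\<in>ev ` Z. {u. u ^ p = w})" by blast
  qed
  then have "card (ev ` scal) \<le> card (\<Union>w\<in>ev ` Z. {u. u ^ p = w})"
    using fin nz p by (intro card_mono) (auto intro!: finite_UN_I finite_nth_roots)
  also have "\<dots> \<le> (\<Sum>w\<in>ev ` Z. card {u. u ^ p = w})" using fin by (intro card_UN_le) auto
  also have "\<dots> = card (ev ` Z) * p" using nz p by (simp add: card_nth_roots)
  finally have "card (ev ` scal) * card ker \<le> (card (ev ` Z) * p) * card ker" by simp
  moreover have "ker \<subseteq> scal" using ker_iff by auto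
  ultimately show ?thesis
    using card_eq_ev_image[OF scal_subgroup] card_eq_ev_image[OF Z] by (simp add: mult.commute mult.left_commute)
qed

lemma irr_char: "irr_char G (\<lambda>g. mat_trace (\<rho> g))"
  unfolding irr_char_def using irr by blast

lemma trace_one: "mat_trace (\<rho> \<one>) = of_nat d"
  unfolding \<rho>_one mat_trace_def by simp

end

section \<open>Galois conjugacy and kernels\<close>

lemma of_nat_cyclotomic_field: "of_nat k \<in> cyclotomic_field n"
proof -
  have "of_nat k = poly (map_poly of_rat [:of_nat k:]) (cis (2 * pi / real n))"
    by (simp add: of_rat_hom.map_poly_pCons_hom)
  then show ?thesis unfolding cyclotomic_field_def by blast
qed

lemma gal_cyclotomic_of_nat:
  assumes "\<sigma> \<in> gal_cyclotomic n"
  shows "\<sigma> (of_nat k) = of_nat k"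
proof (induction k)
  case 0
  have "\<sigma> (0 + 0) = \<sigma> 0 + \<sigma> 0"
    using assms of_nat_cyclotomic_field[of 0 n] unfolding gal_cyclotomic_def by auto
  then show ?case by simp
next
  case (Suc k)
  have "\<sigma> (1 + of_nat k) = \<sigma> 1 + \<sigma> (of_nat k)" "\<sigma> 1 = 1"
    using assms of_nat_cyclotomic_field[of k n] of_nat_cyclotomic_field[of 1 n]
    unfolding gal_cyclotomic_def by auto
  then show ?case using Suc by simp
qed

text \<open>The automorphism preserves the character value d at \<open>x\<close>. Since
  \<open>x\<close> is scalar for \<open>\<rho>'\<close>, that value means eigenvalue 1; for a
  general element the same conclusion would rest on an estimate of sums of roots of unity.\<close>

lemma GC_star_ker:
  assumes GC: "GC_star G" and r: "irrep G d \<rho>" and r': "irrep G d \<rho>'" and d: "d \<noteq> 1"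
    and x: "x \<in> irrep.ker G d \<rho>" "x \<in> irrep.scal G d \<rho>'"
  shows "x \<in> irrep.ker G d \<rho>'"
proof -
  interpret A: irrep G d \<rho> by fact
  interpret B: irrep G d \<rho>' by fact
  have "galois_conjugate G (\<lambda>g. mat_trace (\<rho> g)) (\<lambda>g. mat_trace (\<rho>' g))"
    using GC d A.irr_char B.irr_char A.trace_one B.trace_one unfolding GC_star_def by simp
  then obtain n \<sigma> where \<sigma>: "\<sigma> \<in> gal_cyclotomic n" "\<forall>g \<in> carrier G. mat_trace (\<rho>' g) = \<sigma> (mat_trace (\<rho> g))"
    unfolding galois_conjugate_def by blast
  have xc: "x \<in> carrier G" using x A.ker_iff A.scalD by auto
  have "mat_trace (\<rho> x) = of_nat d" using A.trace_scal x A.ker_iff by simp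
  then have "mat_trace (\<rho>' x) = of_nat d" using \<sigma> xc gal_cyclotomic_of_nat by simp
  then have "B.ev x = 1" using B.trace_scal[OF x(2)] B.degree_pos by simp
  then show ?thesis using x B.ker_iff by blast
qed

lemma irrep_twist:
  assumes r: "irrep G d \<rho>" and l: "irrep G 1 \<tau>"
  shows "irrep G d (\<lambda>g. irrep.ev \<tau> g \<cdot>\<^sub>m \<rho> g)"
proof -
  interpret A: irrep G d \<rho> by fact
  interpret L: irrep G 1 \<tau> by fact
  let ?r = "\<lambda>g. L.ev g \<cdot>\<^sub>m \<rho> g"
  have Ls: "g \<in> L.scal" if "g \<in> carrier G" for g
    using L.commutator_ker_if_degree_one L.scal_iff_commutator that by blast
  have rep: "is_rep G d ?r" unfolding is_rep_def
  proof (intro conjI ballI)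
    fix g h assume gh: "g \<in> carrier G" "h \<in> carrier G"
    show "?r (g \<otimes>\<^bsub>G\<^esub> h) = ?r g * ?r h"
      using A.\<rho>_mult[OF gh] A.\<rho>_carrier[OF gh(1)] A.\<rho>_carrier[OF gh(2)] L.scal_mult(2)[OF Ls[OF gh(1)] Ls[OF gh(2)]]
      by (auto simp: mult_smult_assoc_mat[of _ d d _ d] mult_smult_distrib[of _ d d _ d] intro!: eq_matI)
  qed (use A.degree_pos A.\<rho>_carrier A.\<rho>_one L.ev_one A.one_smult_one_mat in auto)
  have "is_irr_rep G d ?r" unfolding is_irr_rep_def
  proof (intro conjI rep allI impI)
    fix W assume W: "is_subspace d W \<and> (\<forall>g \<in> carrier G. \<forall>w \<in> W. ?r g *\<^sub>v w \<in> W)"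
    have "\<rho> g *\<^sub>v w \<in> W" if g: "g \<in> carrier G" and w: "w \<in> W" for g w
    proof -
      have wc: "w \<in> carrier_vec d" using W w unfolding is_subspace_def by auto
      have nz: "L.ev g \<noteq> 0" using L.scal_inv(3) Ls g by blast
      have "inverse (L.ev g) \<cdot>\<^sub>v (?r g *\<^sub>v w) = \<rho> g *\<^sub>v w"
        using A.\<rho>_carrier[OF g] wc nz by (intro eq_vecI) (auto simp: row_smult smult_scalar_prod_distrib[of _ d])
      then show ?thesis using W g w unfolding is_subspace_def by metis
    qed
    then show "W = {0\<^sub>v d} \<or> W = carrier_vec d" using A.irr W unfolding is_irr_rep_def by blast
  qed
  then show ?thesis using irrepI[OF A.is_group A.finite_carrier] by blast
qed

lemma (in group) commutator_derived: "x \<in> carrier G \<Longrightarrow> y \<in> carrier G \<Longrightarrow> commutator G x y \<in> derived G (carrier G)"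
  unfolding derived_def commutator_def by (rule generate.incl) blast

text \<open>A linear character separates an element \<open>x\<close> of the kernel from the derived
  subgroup. Twisting by it keeps the degree but makes \<open>x\<close> act as a scalar other than 1,
  against \<open>GC_star_ker\<close>.\<close>

lemma GC_star_ker_derived:
  assumes GC: "GC_star G" and r: "irrep G d \<rho>" and d: "d \<noteq> 1"
  shows "irrep.ker G d \<rho> \<subseteq> derived G (carrier G)"
proof (rule ccontr)
  interpret A: irrep G d \<rho> by fact
  assume "\<not> A.ker \<subseteq> derived G (carrier G)"
  then obtain x where x: "x \<in> A.ker" "x \<notin> derived G (carrier G)" by blast
  have xc: "x \<in> carrier G" using x A.ker_iff A.scalD by auto
  obtain f \<tau> where l: "irrep G f \<tau>" and tr: "derived G (carrier G) \<subseteq> irrep.ker G f \<tau>"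
    and xl: "x \<in> irrep.scal G f \<tau>" "x \<notin> irrep.ker G f \<tau>"
    using A.irrep_separating[OF A.finite_carrier A.derived_self_is_normal xc x(2)] A.commutator_derived xc by blast
  interpret L: irrep G f \<tau> by fact
  have f1: "f = 1" using L.degree_one_if_commuting tr A.commutator_derived by blast
  define \<rho>' where "\<rho>' = (\<lambda>g. L.ev g \<cdot>\<^sub>m \<rho> g)"
  have r': "irrep G d \<rho>'" unfolding \<rho>'_def using irrep_twist[OF r] l f1 by simp
  interpret B: irrep G d \<rho>' by fact
  have "\<rho>' x = L.ev x \<cdot>\<^sub>m 1\<^sub>m d" unfolding \<rho>'_def using x unfolding A.ker_def by simp
  then have "x \<in> B.scal" "B.ev x = L.ev x" using B.scalI B.ev_eqI xc by auto
  moreover have "L.ev x \<noteq> 1" using xl L.ker_iff by blast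
  ultimately show False using GC_star_ker[OF GC r r' d x(1)] B.ker_iff by simp
qed

section \<open>Commutators and \<open>p\<close>-groups\<close>

text \<open>Preimage in G of the centre of G/M. Stated through commutators, it spares most arguments
  the passage to the quotient group.\<close>

definition center_mod :: "('a, 'b) monoid_scheme \<Rightarrow> 'a set \<Rightarrow> 'a set" where
  "center_mod G M = {x \<in> carrier G. \<forall>g \<in> carrier G. commutator G x g \<in> M}"

context group
begin

lemma subgroup_pow_closed: "subgroup H G \<Longrightarrow> x \<in> H \<Longrightarrow> x [^] (n::nat) \<in> H"
  by (induction n) (auto simp: subgroup.one_closed subgroup.m_closed)

lemma commutator_mult_left:
  assumes "x \<in> carrier G" "y \<in> carrier G" "g \<in> carrier G"
  shows "commutator G (x \<otimes> y) g = x \<otimes> commutator G y g \<otimes> inv x \<otimes> commutator G x g"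
  unfolding commutator_def using assms
  by (simp add: inv_mult_group m_assoc) (simp add: m_assoc[symmetric])

lemma commutator_one: "g \<in> carrier G \<Longrightarrow> commutator G \<one> g = \<one>"
  unfolding commutator_def by simp

lemma commutator_inv_left:
  assumes "x \<in> carrier G" "g \<in> carrier G"
  shows "commutator G (inv x) g = inv x \<otimes> inv (commutator G x g) \<otimes> x"
  unfolding commutator_def using assms by (simp add: inv_mult_group m_assoc)

lemma center_mod_carrier: "center_mod G M \<subseteq> carrier G"
  unfolding center_mod_def by auto

lemma center_mod_subgroup:
  assumes "M \<lhd> G"
  shows "subgroup (center_mod G M) G"
proof -
  interpret M: normal M G by fact
  show ?thesis
  proof (rule subgroupI)
    show "center_mod G M \<noteq> {}" using commutator_one M.one_closed unfolding center_mod_def by force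
    show "inv x \<in> center_mod G M" if "x \<in> center_mod G M" for x
      using that M.inv_op_closed1 M.m_inv_closed unfolding center_mod_def by (auto simp: commutator_inv_left)
    show "x \<otimes> y \<in> center_mod G M" if "x \<in> center_mod G M" "y \<in> center_mod G M" for x y
      using that M.inv_op_closed2 M.m_closed unfolding center_mod_def by (auto simp: commutator_mult_left)
  qed (rule center_mod_carrier)
qed

lemma commutator_flip:
  assumes "subgroup M G" "x \<in> carrier G" "g \<in> carrier G"
  shows "commutator G x g \<in> M \<longleftrightarrow> commutator G g x \<in> M"
  using assms inv_commutator subgroup.m_inv_closed by metis

lemma normal_commutator:
  assumes "M \<lhd> G" "x \<in> M" "g \<in> carrier G"
  shows "commutator G x g \<in> M"
proof -
  interpret M: normal M G by fact
  have "x \<otimes> (g \<otimes> inv x \<otimes> inv g) \<in> M" using assms M.inv_op_closed2 by (simp add: M.m_inv_closed)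
  then show ?thesis unfolding commutator_def using assms M.mem_carrier by (simp add: m_assoc)
qed

lemma normal_subset_center_mod: "M \<lhd> G \<Longrightarrow> M \<subseteq> center_mod G M"
  using normal_commutator normal_imp_subgroup subgroup.mem_carrier unfolding center_mod_def by fast

lemma group_center_eq_center_mod: "group_center G = center_mod G {\<one>}"
  unfolding group_center_def center_mod_def using commutator_eq_one_iff by auto

lemma center_subgroup: "subgroup (group_center G) G"
  unfolding group_center_eq_center_mod by (rule center_mod_subgroup[OF one_is_normal])

lemma center_commutes: "z \<in> group_center G \<Longrightarrow> g \<in> carrier G \<Longrightarrow> z \<otimes> g = g \<otimes> z"
  unfolding group_center_def by auto

lemma conj_eq_self_iff:
  assumes "x \<in> carrier G" "h \<in> carrier G"
  shows "x \<otimes> h \<otimes> inv x = h \<longleftrightarrow> h \<otimes> x = x \<otimes> h"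
proof
  assume "x \<otimes> h \<otimes> inv x = h"
  then have "h \<otimes> x = x \<otimes> h \<otimes> inv x \<otimes> x" by simp
  also have "\<dots> = x \<otimes> h" using assms by (simp add: m_assoc)
  finally show "h \<otimes> x = x \<otimes> h" .
next
  assume "h \<otimes> x = x \<otimes> h"
  then have "x \<otimes> h \<otimes> inv x = h \<otimes> x \<otimes> inv x" by simp
  also have "\<dots> = h" using assms by (simp add: m_assoc)
  finally show "x \<otimes> h \<otimes> inv x = h" .
qed

lemma center_subgroup_normal:
  assumes H: "subgroup H G" "H \<subseteq> group_center G"
  shows "H \<lhd> G"
proof (rule normal_invI[OF H(1)])
  fix x h assume x: "x \<in> carrier G" and h: "h \<in> H"
  have "h \<in> carrier G" using subgroup.mem_carrier[OF H(1) h] .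
  moreover have "h \<otimes> x = x \<otimes> h" using center_commutes[OF _ x] h H(2) by auto
  ultimately have "x \<otimes> h \<otimes> inv x = h" using conj_eq_self_iff[OF x] by simp
  then show "x \<otimes> h \<otimes> inv x \<in> H" using h by simp
qed

lemma commutator_pow_left:
  assumes x: "x \<in> carrier G" and g: "g \<in> carrier G" and c: "commutator G x g \<in> group_center G"
  shows "commutator G (x [^] (n::nat)) g = commutator G x g [^] n"
proof (induction n)
  case 0 then show ?case using g by (simp add: commutator_one)
next
  case (Suc n)
  have "commutator G (x [^] n \<otimes> x) g = x [^] n \<otimes> commutator G x g \<otimes> inv (x [^] n) \<otimes> commutator G (x [^] n) g"
    using x g by (simp add: commutator_mult_left)
  also have "x [^] n \<otimes> commutator G x g \<otimes> inv (x [^] n) = commutator G x g"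
    using conj_eq_self_iff[of "x [^] n" "commutator G x g"] center_commutes[OF c, of "x [^] n"] x g commutator_closed[OF x g] by simp
  finally show ?case using Suc x g commutator_closed[OF x g] nat_pow_Suc2 by simp
qed

section \<open>Lagrange's theorem and subgroups of prime index\<close>

lemma card_subgroup_dvd:
  assumes "subgroup A G" "subgroup B G" "A \<subseteq> B"
  shows "card A dvd card B"
proof -
  interpret B: group "G\<lparr>carrier := B\<rparr>" using subgroup_imp_group[OF assms(2)] .
  have "subgroup A (G\<lparr>carrier := B\<rparr>)" using subgroup_incl[OF assms] .
  then have "card (rcosets\<^bsub>G\<lparr>carrier := B\<rparr>\<^esub> A) * card A = card B"
    using B.lagrange by (simp add: Coset.order_def)
  then show ?thesis by (metis dvd_triv_right)
qed

text \<open>Nothing lies strictly between \<open>A\<close> and \<open>B\<close>, while the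
  intersection of \<open>B\<close> and \<open>D\<close> contains \<open>A\<close> and the further
  element \<open>x\<close>. In this way a single element decides an inclusion, again and again in
  the final argument.\<close>

lemma subgroup_subset_if_prime_index:
  fixes p :: nat
  assumes "finite (carrier G)" "prime p" and A: "subgroup A G" and B: "subgroup B G" "A \<subseteq> B" "card B = p * card A"
    and x: "x \<in> B" "x \<notin> A" and D: "subgroup D G" "A \<subseteq> D" "x \<in> D"
  shows "B \<subseteq> D"
proof -
  have S: "subgroup (B \<inter> D) G" using B D by (intro subgroups_Inter_pair) auto
  have fin: "finite B" using B assms(1) subgroup.subset finite_subset by metis
  have A0: "card A > 0" using subgroup.finite_imp_card_positive[OF A] assms(1) by blast
  have "A \<subset> B \<inter> D" using B D x by auto
  then have lt: "card A < card (B \<inter> D)" using fin by (intro psubset_card_mono) auto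
  have "card A dvd card (B \<inter> D)" using card_subgroup_dvd[OF A S] B D by auto
  then obtain q where q: "card (B \<inter> D) = card A * q" by (elim dvdE)
  have "card (B \<inter> D) dvd p * card A" using card_subgroup_dvd[OF S B(1)] B(3) by auto
  then have "q dvd p" using q A0 by (simp add: mult.commute)
  moreover have "q \<noteq> 1" using q lt by auto
  ultimately have "q = p" using assms(2) by (metis prime_nat_iff)
  then have "card (B \<inter> D) = card B" using q B(3) by (simp add: mult.commute)
  then have "B \<inter> D = B" using fin by (intro card_subset_eq) auto
  then show ?thesis by auto
qed

lemma normal_conj_action:
  assumes "H \<lhd> G"
  shows "group_action G H (\<lambda>g. \<lambda>h\<in>H. g \<otimes> h \<otimes> inv g)"
proof -
  interpret H: normal H G by fact
  let ?f = "\<lambda>g. \<lambda>h\<in>H. g \<otimes> h \<otimes> inv g"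
  have bij: "?f g \<in> Bij H" if g: "g \<in> carrier G" for g
  proof -
    have "bij_betw (\<lambda>h. g \<otimes> h \<otimes> inv g) H H"
    proof (rule bij_betwI[where g = "\<lambda>h. inv g \<otimes> h \<otimes> g"])
      show "(\<lambda>h. g \<otimes> h \<otimes> inv g) \<in> H \<rightarrow> H" using g H.inv_op_closed2 by auto
      show "(\<lambda>h. inv g \<otimes> h \<otimes> g) \<in> H \<rightarrow> H" using g H.inv_op_closed1 by auto
    qed (use g H.mem_carrier in \<open>auto simp: m_assoc\<close>, (simp add: m_assoc[symmetric])+)
    then show ?thesis unfolding Bij_def by (auto intro: bij_betw_cong[THEN iffD1])
  qed
  have "?f \<in> hom G (BijGroup H)"
  proof (rule homI)
    show "?f g \<in> carrier (BijGroup H)" if "g \<in> carrier G" for g using bij[OF that] unfolding BijGroup_def by simp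
    fix g k assume gk: "g \<in> carrier G" "k \<in> carrier G"
    have "?f (g \<otimes> k) = compose H (?f g) (?f k)"
      using gk H.inv_op_closed2 H.mem_carrier by (auto simp: compose_def fun_eq_iff inv_mult_group m_assoc)
    then show "?f (g \<otimes> k) = ?f g \<otimes>\<^bsub>BijGroup H\<^esub> ?f k" using bij gk unfolding BijGroup_def by simp
  qed
  then show ?thesis unfolding group_action_def group_hom_def group_hom_axioms_def
    using group_BijGroup group_axioms by auto
qed

end

section \<open>Central elements and normal subgroups of finite p-groups\<close>

locale pgroup = group G for G (structure) +
  fixes p k :: nat
  assumes finite_carrier: "finite (carrier G)" and prime: "prime p" and card_carrier: "card (carrier G) = p ^ k"
begin

lemma p_gt_1: "p > 1" using prime prime_gt_1_nat by blast

lemma card_subgroup: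
  assumes "subgroup H G"
  shows "\<exists>j. card H = p ^ j"
proof -
  have "card H dvd p ^ k"
    using card_subgroup_dvd[OF assms subgroup_self subgroup.subset[OF assms]] card_carrier by simp
  then show ?thesis using divides_primepow_nat[OF prime] by blast
qed

lemma card_pos: "subgroup H G \<Longrightarrow> card H > 0"
  using subgroup.finite_imp_card_positive finite_carrier by blast

text \<open>Class equation for conjugation on \<open>H\<close>: without a nontrivial central
  element, every orbit other than that of the identity has size divisible by p, although p divides
  \<open>card H\<close>.\<close>

lemma normal_meets_center:
  assumes H: "H \<lhd> G" "H \<noteq> {\<one>}"
  shows "\<exists>a \<in> H. a \<in> group_center G \<and> a \<noteq> \<one>"
proof (rule ccontr)
  assume neg: "\<not> ?thesis"
  interpret H: normal H G by fact
  let ?f = "\<lambda>g. \<lambda>h\<in>H. g \<otimes> h \<otimes> inv g"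
  interpret act: group_action G H ?f by (rule normal_conj_action[OF H(1)])
  have fin: "finite H" using finite_subset[OF H.subset finite_carrier] .
  let ?O = "orbits G H ?f"
  have orb: "card (orbit G ?f x) = 1 \<or> p dvd card (orbit G ?f x)" if x: "x \<in> H" for x
  proof -
    have "card (orbit G ?f x) * card (stabilizer G ?f x) = p ^ k"
      using act.orbit_stabilizer_theorem[OF x] unfolding Coset.order_def card_carrier .
    then have "card (orbit G ?f x) dvd p ^ k" by (rule dvdI[OF sym])
    then obtain j where "card (orbit G ?f x) = p ^ j" using divides_primepow_nat[OF prime] by blast
    then show ?thesis by (cases j) auto
  qed
  have orbx: "x \<in> orbit G ?f x" if "x \<in> H" for x
    using that unfolding orbit_def by (auto intro!: exI[of _ \<one>])
  have only: "x = \<one>" if x: "x \<in> H" and c: "card (orbit G ?f x) = 1" for x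
  proof -
    have xc: "x \<in> carrier G" using x by simp
    obtain y where y: "orbit G ?f x = {y}" using card_1_singletonE[OF c] .
    then have o: "orbit G ?f x = {x}" using orbx[OF x] by simp
    have "g \<otimes> x \<otimes> inv g = x" if g: "g \<in> carrier G" for g
    proof -
      have "g \<otimes> x \<otimes> inv g \<in> orbit G ?f x" unfolding orbit_def using g x by auto
      then show ?thesis using o by simp
    qed
    then have "x \<otimes> g = g \<otimes> x" if "g \<in> carrier G" for g using that xc conj_eq_self_iff by simp
    then have "x \<in> group_center G" unfolding group_center_def using xc by auto
    then show ?thesis using neg x by blast
  qed
  have orb_one: "orbit G ?f \<one> = {\<one>}" unfolding orbit_def by (auto intro!: exI[of _ \<one>])
  have one: "{\<one>} \<in> ?O" unfolding orbits_def using orb_one H.one_closed by blast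
  have finO: "finite ?O" using fin unfolding orbits_def by simp
  have "card H = (\<Sum>orb\<in>?O. card orb)" using act.disjoint_sum[OF fin, of "\<lambda>_. 1::nat"] by simp
  also have "\<dots> = 1 + (\<Sum>orb\<in>?O - {{\<one>}}. card orb)" using sum.remove[OF finO one, of card] by simp
  finally have eq: "card H = 1 + (\<Sum>orb\<in>?O - {{\<one>}}. card orb)" .
  have "p dvd (\<Sum>orb\<in>?O - {{\<one>}}. card orb)"
  proof (rule dvd_sum)
    fix orb assume "orb \<in> ?O - {{\<one>}}"
    then obtain x where x: "x \<in> H" "orb = orbit G ?f x" "orb \<noteq> {\<one>}" unfolding orbits_def by blast
    have "card orb \<noteq> 1"
    proof
      assume "card orb = 1"
      then have "x = \<one>" using only[OF x(1)] x(2) by simp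
      then show False using x(2,3) orb_one by simp
    qed
    then show "p dvd card orb" using orb x by blast
  qed
  moreover obtain j where j: "card H = p ^ j" using card_subgroup H.is_subgroup by blast
  moreover have "j \<noteq> 0"
  proof
    assume "j = 0"
    then have "card H = 1" using j by simp
    then obtain y where "H = {y}" by (rule card_1_singletonE)
    then show False using H(2) H.one_closed by auto
  qed
  ultimately have "p dvd 1 + (\<Sum>orb\<in>?O - {{\<one>}}. card orb)" "p dvd (\<Sum>orb\<in>?O - {{\<one>}}. card orb)"
    using eq by (auto simp: dvd_power)
  then have "p dvd 1" using dvd_add_left_iff by blast
  then show False using p_gt_1 by simp
qed

lemma pgroup_Mod:
  assumes M: "M \<lhd> G"
  shows "\<exists>j. pgroup (G Mod M) p j"
proof -
  interpret M: normal M G by fact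
  have car: "carrier (G Mod M) = rcosets M" unfolding FactGroup_def by simp
  have "card (rcosets M) * card M = p ^ k"
    using lagrange[OF M.is_subgroup] card_carrier by (simp add: Coset.order_def)
  then have "card (rcosets M) dvd p ^ k" by (rule dvdI[OF sym])
  then obtain j where "card (rcosets M) = p ^ j" using divides_primepow_nat[OF prime] by blast
  moreover have "finite (rcosets M)" using finite_carrier unfolding RCOSETS_def by simp
  ultimately show ?thesis
    unfolding pgroup_def pgroup_axioms_def using M.factorgroup_is_group prime car by auto
qed

text \<open>The image of \<open>H\<close> in G/M is a nontrivial normal subgroup and so meets the
  centre nontrivially; a preimage is central modulo \<open>M\<close>.\<close>

lemma central_mod_exists:
  assumes H: "H \<lhd> G" and M: "M \<lhd> G" "M \<subseteq> H" "M \<noteq> H"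
  shows "\<exists>a \<in> H. a \<notin> M \<and> a \<in> center_mod G M"
proof -
  interpret M: normal M G by fact
  interpret H: normal H G by fact
  let ?Q = "G Mod M"
  obtain j where "pgroup ?Q p j" using pgroup_Mod[OF M(1)] by blast
  then interpret Q: pgroup ?Q p j .
  interpret h: group_hom G ?Q "\<lambda>x. M #> x"
    unfolding group_hom_def group_hom_axioms_def using M.r_coset_hom_Mod M.factorgroup_is_group group_axioms by auto
  have eq: "M #> x = M \<longleftrightarrow> x \<in> M" if "x \<in> carrier G" for x
    using coset_join1[OF _ that M.is_subgroup] coset_join2[OF that M.is_subgroup] by blast
  let ?H = "(\<lambda>x. M #> x) ` H"
  have HQ: "?H \<lhd> ?Q"
  proof (rule Q.normal_invI)
    show "subgroup ?H ?Q" using h.subgroup_img_is_subgroup[OF H.is_subgroup] .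
    fix X Y assume X: "X \<in> carrier ?Q" and Y: "Y \<in> ?H"
    obtain x where x: "x \<in> carrier G" "X = M #> x" using X unfolding carrier_FactGroup by blast
    obtain y where y: "y \<in> H" "Y = M #> y" using Y by blast
    have "X \<otimes>\<^bsub>?Q\<^esub> Y \<otimes>\<^bsub>?Q\<^esub> inv\<^bsub>?Q\<^esub> X = M #> (x \<otimes> y \<otimes> inv x)"
      unfolding x(2) y(2) using x(1) H.mem_carrier[OF y(1)]
      by (simp only: h.hom_inv[symmetric] h.hom_mult[symmetric] inv_closed m_closed)
    then show "X \<otimes>\<^bsub>?Q\<^esub> Y \<otimes>\<^bsub>?Q\<^esub> inv\<^bsub>?Q\<^esub> X \<in> ?H" using H.inv_op_closed2 x y by blast
  qed
  obtain b where b: "b \<in> H" "b \<notin> M" using M by blast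
  have "?H \<noteq> {\<one>\<^bsub>?Q\<^esub>}"
  proof
    assume "?H = {\<one>\<^bsub>?Q\<^esub>}"
    then have "M #> b = M" using b by auto
    then show False using eq b H.mem_carrier by blast
  qed
  then obtain A where A: "A \<in> ?H" "A \<in> group_center ?Q" "A \<noteq> \<one>\<^bsub>?Q\<^esub>" using Q.normal_meets_center[OF HQ] by blast
  then obtain a where a: "a \<in> H" "A = M #> a" by blast
  have ac: "a \<in> carrier G" using a by simp
  have "a \<notin> M" using A(3) a eq[OF ac] by auto
  moreover have "commutator G a g \<in> M" if g: "g \<in> carrier G" for g
  proof -
    have "A \<otimes>\<^bsub>?Q\<^esub> (M #> g) = (M #> g) \<otimes>\<^bsub>?Q\<^esub> A" using Q.center_commutes[OF A(2)] h.hom_closed[OF g] by blast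
    then have "M #> (a \<otimes> g) = M #> (g \<otimes> a)" unfolding a(2) by (simp only: h.hom_mult[OF ac g, symmetric] h.hom_mult[OF g ac, symmetric])
    moreover have "M #> (a \<otimes> g) = (M #> commutator G a g) \<otimes>\<^bsub>?Q\<^esub> (M #> (g \<otimes> a))"
      by (simp only: h.hom_mult[OF commutator_closed[OF ac g] m_closed[OF g ac], symmetric] commutator_mult[OF ac g])
    ultimately have "M #> commutator G a g = \<one>\<^bsub>?Q\<^esub>"
      using Q.r_cancel_one[of "M #> (g \<otimes> a)" "M #> commutator G a g"] h.hom_closed[of "g \<otimes> a"] h.hom_closed[OF commutator_closed[OF ac g]] ac g
      by simp
    then show ?thesis using eq commutator_closed[OF ac g] by simp
  qed
  ultimately show ?thesis using a ac unfolding center_mod_def by blast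
qed

text \<open>Starting from an element central modulo \<open>M\<close>, repeated p-th powers end in
  \<open>M\<close>; the last one outside \<open>M\<close> is taken.\<close>

lemma central_mod_pow_exists:
  assumes H: "H \<lhd> G" and M: "M \<lhd> G" "M \<subseteq> H" "M \<noteq> H"
  shows "\<exists>a \<in> H. a \<notin> M \<and> a \<in> center_mod G M \<and> a [^] p \<in> M"
proof -
  interpret M: normal M G by fact
  interpret H: normal H G by fact
  obtain a where a: "a \<in> H" "a \<notin> M" "a \<in> center_mod G M" using central_mod_exists[OF assms] by blast
  have ac: "a \<in> carrier G" using a by simp
  have "a [^] (p ^ k) \<in> M" using pow_order_eq_1[OF ac] card_carrier by (simp add: Coset.order_def)
  then obtain i where i: "a [^] (p ^ i) \<in> M" and min: "\<And>j. j < i \<Longrightarrow> a [^] (p ^ j) \<notin> M"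
    using exists_least_iff[of "\<lambda>i. a [^] (p ^ i) \<in> M"] by blast
  have "i \<noteq> 0" using i a ac by (intro notI) simp
  then obtain j where j: "i = Suc j" using not0_implies_Suc by blast
  let ?b = "a [^] (p ^ j)"
  have "?b \<notin> M" using min j by simp
  moreover have "?b [^] p \<in> M" using i j ac by (simp add: nat_pow_pow mult.commute)
  moreover have "?b \<in> H" using subgroup_pow_closed[OF H.is_subgroup a(1)] .
  moreover have "?b \<in> center_mod G M"
    using subgroup_pow_closed[OF center_mod_subgroup[OF M(1)] a(3)] .
  ultimately show ?thesis by blast
qed

text \<open>\<open>S\<close> is generated by \<open>M\<close> and \<open>b\<close>. Its order is at
  most p times that of \<open>M\<close> because the p-th power of \<open>b\<close> lies in
  \<open>M\<close>, and it is a larger power of p. The last clause says that \<open>S\<close> is the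
  least subgroup containing both.\<close>

lemma normal_extend:
  assumes M: "M \<lhd> G" and b: "b \<in> center_mod G M" "b \<notin> M" "b [^] p \<in> M"
  shows "\<exists>S. S \<lhd> G \<and> card S = p * card M \<and> M \<subseteq> S \<and> b \<in> S \<and> (\<forall>H. subgroup H G \<longrightarrow> M \<subseteq> H \<longrightarrow> b \<in> H \<longrightarrow> S \<subseteq> H)"
proof -
  interpret M: normal M G by fact
  have bc: "b \<in> carrier G" using b center_mod_carrier by auto
  \<comment> \<open>Integer exponents give closure under inverses; the count below reduces them
    modulo p.\<close>
  define S where "S = (\<lambda>(m, i::int). m \<otimes> b [^] i) ` (M \<times> UNIV)"
  have SI: "m \<otimes> b [^] i \<in> S" if "m \<in> M" for m and i :: int unfolding S_def using that by auto
  have bcm: "b [^] (i::int) \<in> center_mod G M" for i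
    using subgroup_int_pow_closed[OF center_mod_subgroup[OF M] b(1)] .
  have "subgroup S G"
  proof (rule subgroupI)
    show "S \<subseteq> carrier G" unfolding S_def using bc by auto
    show "S \<noteq> {}" using SI M.one_closed by blast
    show "x \<otimes> y \<in> S" if "x \<in> S" "y \<in> S" for x y
    proof -
      obtain m i n j where mn: "m \<in> M" "x = m \<otimes> b [^] (i::int)" "n \<in> M" "y = n \<otimes> b [^] (j::int)"
        using \<open>x \<in> S\<close> \<open>y \<in> S\<close> unfolding S_def by auto
      have "x \<otimes> y = (m \<otimes> (b [^] i \<otimes> n \<otimes> inv (b [^] i))) \<otimes> (b [^] i \<otimes> b [^] j)"
        unfolding mn using mn bc by (simp add: m_assoc) (simp add: m_assoc[symmetric])
      also have "b [^] i \<otimes> b [^] j = b [^] (i + j)" using bc by (simp add: int_pow_mult)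
      finally show ?thesis using SI M.inv_op_closed2[of "b [^] i" n] mn bc by simp
    qed
    show "inv x \<in> S" if "x \<in> S" for x
    proof -
      obtain m i where mn: "m \<in> M" "x = m \<otimes> b [^] (i::int)" using \<open>x \<in> S\<close> unfolding S_def by auto
      have "inv x = (inv (b [^] i) \<otimes> inv m \<otimes> b [^] i) \<otimes> inv (b [^] i)"
        unfolding mn using mn bc by (simp add: inv_mult_group m_assoc)
      also have "inv (b [^] i) = b [^] (- i)" using bc by (simp add: int_pow_neg)
      finally have "inv x = (inv (b [^] i) \<otimes> inv m \<otimes> b [^] i) \<otimes> b [^] (- i)"
        using bc by (simp add: int_pow_neg)
      then show ?thesis using SI[OF M.inv_op_closed1[of "b [^] i" "inv m"], of "- i"] mn bc by simp
    qed
  qed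
  moreover have "g \<otimes> x \<otimes> inv g \<in> S" if g: "g \<in> carrier G" and x: "x \<in> S" for g x
  proof -
    obtain m i where mn: "m \<in> M" "x = m \<otimes> b [^] (i::int)" using \<open>x \<in> S\<close> unfolding S_def by auto
    have c: "commutator G g (b [^] i) \<in> M"
      using bcm[of i] g bc commutator_flip[OF M.is_subgroup g, of "b [^] i"] unfolding center_mod_def by auto
    have "g \<otimes> x \<otimes> inv g = (g \<otimes> m \<otimes> inv g) \<otimes> (g \<otimes> b [^] i \<otimes> inv g)"
      unfolding mn using mn g bc by (simp add: m_assoc) (simp add: m_assoc[symmetric])
    also have "g \<otimes> b [^] i \<otimes> inv g = commutator G g (b [^] i) \<otimes> b [^] i" using conj_eq_commutator g bc by simp
    finally have "g \<otimes> x \<otimes> inv g = ((g \<otimes> m \<otimes> inv g) \<otimes> commutator G g (b [^] i)) \<otimes> b [^] i"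
      using g mn bc commutator_closed by (simp add: m_assoc)
    then show ?thesis using SI c M.inv_op_closed2[OF g mn(1)] by simp
  qed
  ultimately have nS: "S \<lhd> G" using normal_invI by blast
  have subS: "subgroup S G" using nS normal_imp_subgroup by blast
  have MS: "M \<subseteq> S" using SI[of _ 0] M.mem_carrier by fastforce
  have bS: "b \<in> S" using SI[OF M.one_closed, of 1] bc by (simp add: int_pow_1)
  have "S \<subseteq> (\<lambda>(m, i::nat). m \<otimes> b [^] i) ` (M \<times> {..<p})"
  proof
    fix x assume "x \<in> S"
    then obtain m i where mn: "m \<in> M" "x = m \<otimes> b [^] (i::int)" unfolding S_def by auto
    define q r where "q = i div int p" and "r = nat (i mod int p)"
    have ir: "i = int p * q + int r" unfolding q_def r_def using p_gt_1 by simp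
    have "b [^] i = b [^] (int p * q) \<otimes> b [^] int r" unfolding ir using bc by (simp add: int_pow_mult)
    also have "\<dots> = (b [^] p) [^] q \<otimes> b [^] r" using bc by (simp add: int_pow_pow[symmetric] int_pow_int)
    finally have "x = (m \<otimes> (b [^] p) [^] q) \<otimes> b [^] r" using mn bc by (simp add: m_assoc)
    moreover have "m \<otimes> (b [^] p) [^] q \<in> M" using mn subgroup_int_pow_closed[OF M.is_subgroup b(3)] by simp
    moreover have "r < p" unfolding r_def using p_gt_1 by (simp add: nat_less_iff)
    ultimately show "x \<in> (\<lambda>(m, i::nat). m \<otimes> b [^] i) ` (M \<times> {..<p})"
      by (intro image_eqI[of _ _ "(m \<otimes> (b [^] p) [^] q, r)"]) auto
  qed
  moreover have finM: "finite M" using finite_subset[OF M.subset finite_carrier] .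
  ultimately have "card S \<le> card (M \<times> {..<p})" by (intro surj_card_le) auto
  then have le: "card S \<le> p * card M" by (simp add: card_cartesian_product mult.commute)
  have "finite S" using finite_subset[OF subgroup.subset[OF subS] finite_carrier] .
  then have lt: "card M < card S" using MS bS b(2) by (intro psubset_card_mono) auto
  obtain i j where ij: "card M = p ^ i" "card S = p ^ j" using card_subgroup subS M.is_subgroup by blast
  have "i < j" using lt p_gt_1 unfolding ij by (simp add: power_strict_increasing_iff)
  then have "p ^ Suc i \<le> p ^ j" using p_gt_1 by (intro power_increasing) auto
  then have "card S = p * card M" using le ij by simp
  moreover have "S \<subseteq> H" if "subgroup H G" "M \<subseteq> H" "b \<in> H" for H
    using that subgroup_int_pow_closed[OF that(1,3)] subgroup.m_closed[OF that(1)] unfolding S_def by auto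
  ultimately show ?thesis using nS MS bS by blast
qed

text \<open>A proper normal subgroup inside \<open>H\<close> is taken of largest order; extending it
  by an element of order p that is central modulo it must then fill \<open>H\<close>.\<close>

lemma normal_index_p_exists:
  assumes H: "H \<lhd> G" "H \<noteq> {\<one>}"
  shows "\<exists>M. M \<lhd> G \<and> M \<subseteq> H \<and> card H = p * card M"
proof -
  let ?P = "\<lambda>M. M \<lhd> G \<and> M \<subset> H"
  have subH: "subgroup H G" using H normal_imp_subgroup by blast
  have finH: "finite H" using finite_subset[OF subgroup.subset[OF subH] finite_carrier] .
  have "?P {\<one>}" using one_is_normal H subgroup.one_closed[OF subH] by auto
  moreover have "card M < Suc (card H)" if "?P M" for M using that finH by (meson less_SucI psubset_card_mono)
  ultimately obtain M where M: "?P M" and max: "\<And>M'. ?P M' \<Longrightarrow> card M' \<le> card M"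
    using ex_has_greatest_nat[of ?P "{\<one>}" card "Suc (card H)"] by blast
  obtain b where b: "b \<in> H" "b \<notin> M" "b \<in> center_mod G M" "b [^] p \<in> M"
    using central_mod_pow_exists[OF H(1), of M] M by blast
  obtain S where S: "S \<lhd> G" "card S = p * card M" "S \<subseteq> H"
    using normal_extend[of M b] b M subH by blast
  have "card M > 0" using card_pos M normal_imp_subgroup by blast
  then have "card S > card M" using S p_gt_1 by simp
  then have "S = H" using max[of S] S by fastforce
  then show ?thesis using S M by blast
qed

end

section \<open>Powers of a primitive root of unity of prime power order\<close>

lemma root_of_unity_power_iff:
  fixes u :: complex
  assumes p: "prime p" and u: "u ^ (p ^ Suc a) = 1" "u ^ (p ^ a) \<noteq> 1"
  shows "u ^ i = 1 \<longleftrightarrow> p ^ Suc a dvd i"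
proof
  assume i: "u ^ i = 1"
  show "p ^ Suc a dvd i"
  proof (cases "i = 0")
    case False
    have "gcd i (p ^ Suc a) dvd p ^ Suc a" by simp
    then obtain j where j: "j \<le> Suc a" "gcd i (p ^ Suc a) = p ^ j" using divides_primepow_nat[OF p] by blast
    obtain x y where xy: "i * x = p ^ Suc a * y + gcd i (p ^ Suc a)" using bezout_nat[OF False] by blast
    have "u ^ (i * x) = u ^ (p ^ Suc a * y) * u ^ (p ^ j)" unfolding xy j(2) by (simp only: power_add)
    moreover have "u ^ (i * x) = 1" "u ^ (p ^ Suc a * y) = 1" unfolding power_mult i u(1) by simp_all
    ultimately have uj: "u ^ (p ^ j) = 1" by simp
    have "j = Suc a"
    proof (rule ccontr)
      assume "j \<noteq> Suc a"
      then have "a = j + (a - j)" using j by simp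
      then have "p ^ a = p ^ j * p ^ (a - j)" by (metis power_add)
      then have "u ^ (p ^ a) = 1" using uj by (simp add: power_mult)
      then show False using u by simp
    qed
    then show ?thesis using j(2) by (metis gcd_dvd1)
  qed simp
next
  assume "p ^ Suc a dvd i"
  then obtain c where "i = p ^ Suc a * c" by (elim dvdE)
  then show "u ^ i = 1" using u by (simp only: power_mult) simp
qed

text \<open>The powers of \<open>u\<close> are \<open>p ^ Suc a\<close> distinct roots of unity of
  that order or less, hence all of them.\<close>

lemma root_of_unity_is_power:
  fixes u w :: complex
  assumes p: "prime p" and u: "u ^ (p ^ Suc a) = 1" "u ^ (p ^ a) \<noteq> 1" and w: "w ^ (p ^ Suc a) = 1"
  shows "\<exists>i. w = u ^ i"
proof -
  let ?N = "p ^ Suc a"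
  have N: "?N > 0" using prime_gt_0_nat[OF p] by simp
  have u0: "u \<noteq> 0" using u N by (intro notI) (simp add: power_0_left)
  have "inj_on (\<lambda>i. u ^ i) {..<?N}"
  proof (rule linorder_inj_onI')
    fix i j assume ij: "i \<in> {..<?N}" "j \<in> {..<?N}" "i < j"
    show "u ^ i \<noteq> u ^ j"
    proof
      assume eq: "u ^ i = u ^ j"
      have "u ^ j = u ^ i * u ^ (j - i)" using ij by (simp add: power_add[symmetric])
      then have "u ^ (j - i) = 1" using eq u0 by simp
      then have "?N dvd j - i" using root_of_unity_power_iff[OF p u] by blast
      then show False using ij by (auto dest: dvd_imp_le)
    qed
  qed
  then have "card ((\<lambda>i. u ^ i) ` {..<?N}) = ?N" by (simp add: card_image)
  moreover have "(\<lambda>i. u ^ i) ` {..<?N} \<subseteq> {z. z ^ ?N = 1}"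
  proof
    fix z assume "z \<in> (\<lambda>i. u ^ i) ` {..<?N}"
    then obtain i where "z = u ^ i" by blast
    then have "z ^ ?N = (u ^ ?N) ^ i" by (simp only: power_mult[symmetric] mult.commute)
    then show "z \<in> {z. z ^ ?N = 1}" using u by simp
  qed
  moreover have "card {z::complex. z ^ ?N = 1} = ?N" using card_nth_roots[of 1 ?N] N by simp
  moreover have "finite {z::complex. z ^ ?N = 1}" using finite_nth_roots[OF N] .
  ultimately have "(\<lambda>i. u ^ i) ` {..<?N} = {z. z ^ ?N = 1}" by (intro card_subset_eq) auto
  then show ?thesis using w by blast
qed

lemma cyclotomic_field_mult:
  assumes "x \<in> cyclotomic_field n" "y \<in> cyclotomic_field n"
  shows "x * y \<in> cyclotomic_field n"
proof -
  obtain q r where "x = poly (map_poly of_rat q) (cis (2 * pi / real n))" "y = poly (map_poly of_rat r) (cis (2 * pi / real n))"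
    using assms unfolding cyclotomic_field_def by blast
  then have "x * y = poly (map_poly of_rat (q * r)) (cis (2 * pi / real n))"
    by (simp add: of_rat_poly_hom.hom_mult)
  then show ?thesis unfolding cyclotomic_field_def by blast
qed

lemma gal_cyclotomic_power:
  assumes s: "\<sigma> \<in> gal_cyclotomic n" and x: "x \<in> cyclotomic_field n"
  shows "x ^ i \<in> cyclotomic_field n \<and> \<sigma> (x ^ i) = \<sigma> x ^ i"
proof (induction i)
  case 0 then show ?case using of_nat_cyclotomic_field[of 1 n] gal_cyclotomic_of_nat[OF s, of 1] by simp
next
  case (Suc i)
  then show ?case using s x cyclotomic_field_mult[of x n "x ^ i"] unfolding gal_cyclotomic_def by simp
qed

lemma root_in_cyclotomic_field: "cis (2 * pi / real n) \<in> cyclotomic_field n"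
proof -
  have "cis (2 * pi / real n) = poly (map_poly of_rat [:0, 1:]) (cis (2 * pi / real n))"
    by (simp add: of_rat_hom.map_poly_pCons_hom)
  then show ?thesis unfolding cyclotomic_field_def by blast
qed

section \<open>Inflation of characters from quotient groups\<close>

lemma is_irr_rep_inflate:
  assumes "M \<lhd> G" and irr: "is_irr_rep (G Mod M) d \<rho>"
  shows "is_irr_rep G d (\<lambda>x. \<rho> (M #>\<^bsub>G\<^esub> x))"
proof -
  interpret M: normal M G by fact
  have car: "M #>\<^bsub>G\<^esub> x \<in> carrier (G Mod M)" if "x \<in> carrier G" for x
    unfolding carrier_FactGroup using that by blast
  have mult: "M #>\<^bsub>G\<^esub> (x \<otimes>\<^bsub>G\<^esub> y) = (M #>\<^bsub>G\<^esub> x) \<otimes>\<^bsub>G Mod M\<^esub> (M #>\<^bsub>G\<^esub> y)" if "x \<in> carrier G" "y \<in> carrier G" for x y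
    using hom_mult[OF M.r_coset_hom_Mod that] .
  have one: "M #>\<^bsub>G\<^esub> \<one>\<^bsub>G\<^esub> = \<one>\<^bsub>G Mod M\<^esub>" using M.subset by (simp add: M.coset_mult_one)
  have "is_rep G d (\<lambda>x. \<rho> (M #>\<^bsub>G\<^esub> x))"
    using irr car mult one unfolding is_irr_rep_def is_rep_def by auto
  moreover have "(\<forall>g \<in> carrier G. \<forall>w \<in> W. \<rho> (M #>\<^bsub>G\<^esub> g) *\<^sub>v w \<in> W) \<longleftrightarrow> (\<forall>X \<in> carrier (G Mod M). \<forall>w \<in> W. \<rho> X *\<^sub>v w \<in> W)" for W
    unfolding carrier_FactGroup by blast
  ultimately show ?thesis using irr unfolding is_irr_rep_def by blast
qed

text \<open>Characters of the quotient inflate with unchanged values; the same automorphism works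
  because the order of the quotient divides that of G.\<close>

lemma GC_star_Mod:
  assumes GC: "GC_star G" and M: "M \<lhd> G"
  shows "GC_star (G Mod M)"
  unfolding GC_star_def
proof (intro allI impI)
  fix \<chi> \<psi>
  assume H: "irr_char (G Mod M) \<chi> \<and> irr_char (G Mod M) \<psi> \<and> \<chi> \<one>\<^bsub>G Mod M\<^esub> \<noteq> 1 \<and> \<psi> \<one>\<^bsub>G Mod M\<^esub> \<noteq> 1 \<and>
    \<chi> \<one>\<^bsub>G Mod M\<^esub> = \<psi> \<one>\<^bsub>G Mod M\<^esub>"
  interpret M: normal M G by fact
  have car: "M #>\<^bsub>G\<^esub> x \<in> carrier (G Mod M)" if "x \<in> carrier G" for x
    unfolding carrier_FactGroup using that by blast
  have infl: "irr_char G (\<lambda>x. \<phi> (M #>\<^bsub>G\<^esub> x))" if ic: "irr_char (G Mod M) \<phi>" for \<phi>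
  proof -
    obtain d \<rho> where "is_irr_rep (G Mod M) d \<rho>" "\<forall>g \<in> carrier (G Mod M). \<phi> g = mat_trace (\<rho> g)"
      using ic unfolding irr_char_def by blast
    then show ?thesis using is_irr_rep_inflate[OF M] car unfolding irr_char_def by blast
  qed
  have one: "M #>\<^bsub>G\<^esub> \<one>\<^bsub>G\<^esub> = \<one>\<^bsub>G Mod M\<^esub>" using M.subset by (simp add: M.coset_mult_one)
  have "galois_conjugate G (\<lambda>x. \<chi> (M #>\<^bsub>G\<^esub> x)) (\<lambda>x. \<psi> (M #>\<^bsub>G\<^esub> x))"
    using GC H infl unfolding GC_star_def one[symmetric] by blast
  then obtain n \<sigma> where n: "0 < n" "card (carrier G) dvd n" "\<sigma> \<in> gal_cyclotomic n"
    and \<sigma>: "\<forall>g \<in> carrier G. \<psi> (M #>\<^bsub>G\<^esub> g) = \<sigma> (\<chi> (M #>\<^bsub>G\<^esub> g))"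
    unfolding galois_conjugate_def by blast
  have "carrier (G Mod M) = rcosets\<^bsub>G\<^esub> M" unfolding FactGroup_def by simp
  then have "card (carrier (G Mod M)) * card M = card (carrier G)"
    using M.lagrange[OF M.is_subgroup] by (simp add: Coset.order_def)
  then have "card (carrier (G Mod M)) dvd n" using n(2) by (metis dvd_mult_left)
  then show "galois_conjugate (G Mod M) \<chi> \<psi>"
    unfolding galois_conjugate_def using n \<sigma> unfolding carrier_FactGroup by blast
qed

text \<open>A commutator acting as a scalar makes two conjugate matrices differ by that scalar
  factor, and their determinants by its d-th power. This will force p to divide a degree.\<close>

lemma (in irrep) ev_commutator_power_degree:
  assumes g: "g \<in> carrier G" "x \<in> carrier G" and s: "commutator G g x \<in> scal"
  shows "ev (commutator G g x) ^ d = 1"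
proof -
  have car: "\<rho> y \<in> carrier_mat d d" if "y \<in> carrier G" for y using \<rho>_carrier that .
  have dm: "det (\<rho> (y \<otimes> z)) = det (\<rho> y) * det (\<rho> z)" if "y \<in> carrier G" "z \<in> carrier G" for y z
    using \<rho>_mult that det_mult[OF car car] by simp
  have di: "det (\<rho> y) * det (\<rho> (inv y)) = 1" if "y \<in> carrier G" for y
    using dm[OF that inv_closed[OF that]] that \<rho>_one by simp
  have "det (\<rho> (g \<otimes> x \<otimes> inv g)) = (det (\<rho> g) * det (\<rho> (inv g))) * det (\<rho> x)"
    using g dm by simp
  then have "det (\<rho> (g \<otimes> x \<otimes> inv g)) = det (\<rho> x)" using di g by simp
  moreover have "\<rho> (g \<otimes> x \<otimes> inv g) = ev (commutator G g x) \<cdot>\<^sub>m \<rho> x"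
    using conj_eq_commutator[OF g] \<rho>_scal_mult(1)[OF s g(2)] by simp
  ultimately have "ev (commutator G g x) ^ d * det (\<rho> x) = det (\<rho> x)"
    using car[OF g(2)] by (simp add: det_smult)
  moreover have "det (\<rho> x) \<noteq> 0" using di[OF g(2)] by auto
  ultimately show ?thesis by simp
qed

section \<open>Centralizers and the derived subgroup\<close>

context group
begin

definition centralizer :: "'a \<Rightarrow> 'a set" where "centralizer w = {x \<in> carrier G. x \<otimes> w = w \<otimes> x}"

lemma centralizer_subgroup:
  assumes w: "w \<in> carrier G"
  shows "subgroup (centralizer w) G"
proof (rule subgroupI)
  show "centralizer w \<noteq> {}" unfolding centralizer_def using w by (auto intro!: exI[of _ \<one>])
  show "inv x \<in> centralizer w" if "x \<in> centralizer w" for x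
  proof -
    have x: "x \<in> carrier G" "x \<otimes> w = w \<otimes> x" using that unfolding centralizer_def by auto
    have "inv x \<otimes> w = inv x \<otimes> (w \<otimes> x) \<otimes> inv x" using x w by (simp add: m_assoc)
    also have "\<dots> = inv x \<otimes> (x \<otimes> w) \<otimes> inv x" using x by simp
    also have "\<dots> = w \<otimes> inv x" using x(1) w by (simp add: m_assoc[symmetric])
    finally show ?thesis unfolding centralizer_def using x by simp
  qed
  show "x \<otimes> y \<in> centralizer w" if "x \<in> centralizer w" "y \<in> centralizer w" for x y
  proof -
    have x: "x \<in> carrier G" "x \<otimes> w = w \<otimes> x" and y: "y \<in> carrier G" "y \<otimes> w = w \<otimes> y"
      using that unfolding centralizer_def by auto
    have "x \<otimes> y \<otimes> w = x \<otimes> w \<otimes> y" using x(1) y w by (simp add: m_assoc)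
    also have "\<dots> = w \<otimes> (x \<otimes> y)" unfolding x(2) using x(1) y(1) w by (simp add: m_assoc)
    finally show ?thesis unfolding centralizer_def using x y by simp
  qed
qed (auto simp: centralizer_def)

lemma centralizer_sym: "x \<in> carrier G \<Longrightarrow> y \<in> carrier G \<Longrightarrow> x \<in> centralizer y \<longleftrightarrow> y \<in> centralizer x"
  unfolding centralizer_def by auto

lemma centralizer_iff_commutator: "x \<in> carrier G \<Longrightarrow> y \<in> carrier G \<Longrightarrow> x \<in> centralizer y \<longleftrightarrow> commutator G x y = \<one>"
  unfolding centralizer_def using commutator_eq_one_iff by auto

lemma center_subset_centralizer: "w \<in> carrier G \<Longrightarrow> group_center G \<subseteq> centralizer w"
  unfolding group_center_def centralizer_def by auto

lemma derived_subset:
  assumes "subgroup H G" "\<And>x y. x \<in> carrier G \<Longrightarrow> y \<in> carrier G \<Longrightarrow> commutator G x y \<in> H"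
  shows "derived G (carrier G) \<subseteq> H"
  unfolding derived_def using assms by (intro generate_subgroup_incl) (auto simp: commutator_def)

lemma derived_subgroup: "subgroup (derived G (carrier G)) G"
  using derived_is_subgroup[OF subset_refl] .

lemma subgroup_pow_card:
  assumes fin: "finite (carrier G)" and H: "subgroup H G" and x: "x \<in> H"
  shows "x [^] card H = \<one>"
proof -
  interpret H: group "G\<lparr>carrier := H\<rparr>" using subgroup_imp_group[OF H] .
  have "x [^]\<^bsub>G\<lparr>carrier := H\<rparr>\<^esub> Coset.order (G\<lparr>carrier := H\<rparr>) = \<one>\<^bsub>G\<lparr>carrier := H\<rparr>\<^esub>"
    by (rule H.pow_order_eq_1) (use x in simp)
  then show ?thesis using nat_pow_consistent[of x "card H" H] by (simp add: Coset.order_def)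
qed

end

context pgroup
begin

lemma subset_if_card_p:
  assumes B: "subgroup B G" "card B = p" and D: "subgroup D G" and x: "x \<in> B" "x \<in> D" "x \<noteq> \<one>"
  shows "B \<subseteq> D"
  using subgroup_subset_if_prime_index[OF finite_carrier prime triv_subgroup B(1) _ _ x(1) _ D _ x(2)]
    B(2) x(3) subgroup.one_closed[OF B(1)] subgroup.one_closed[OF D] by simp

lemma card_index_cases:
  assumes A: "subgroup A G" and B: "subgroup B G" "A \<subseteq> B" "card B \<le> p * card A"
  shows "card B = card A \<or> card B = p * card A"
proof -
  obtain i j where ij: "card A = p ^ i" "card B = p ^ j" using card_subgroup A B by blast
  have "p ^ i \<le> p ^ j" using card_subgroup_dvd[OF A B(1,2)] card_pos[OF B(1)] ij by (metis dvd_imp_le)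
  then have "i \<le> j" using p_gt_1 by simp
  moreover have "p ^ j \<le> p ^ Suc i" using B(3) ij by simp
  then have "j \<le> Suc i" using p_gt_1 power_increasing_iff by blast
  ultimately have "j = i \<or> j = Suc i" by auto
  then show ?thesis using ij by auto
qed

lemma derived_subset_center_if_card_p:
  assumes "card (derived G (carrier G)) = p"
  shows "derived G (carrier G) \<subseteq> group_center G"
proof -
  let ?D = "derived G (carrier G)"
  have "?D \<noteq> {\<one>}" using assms p_gt_1 by auto
  then obtain a where "a \<in> ?D" "a \<in> group_center G" "a \<noteq> \<one>"
    using normal_meets_center[OF derived_self_is_normal] by blast
  then show ?thesis using subset_if_card_p[OF derived_subgroup assms center_subgroup] by blast
qed

text \<open>A kernel meeting the derived subgroup nontrivially would contain it, as its order is
  prime, and the representation would be linear. Commutators with a scalar element lie in both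
  groups and are therefore trivial.\<close>

lemma irrep_derived_p:
  assumes D: "card (derived G (carrier G)) = p" and r: "irrep G d \<rho>" and d: "d \<noteq> 1"
  shows "irrep.ker G d \<rho> \<inter> derived G (carrier G) = {\<one>}" "irrep.scal G d \<rho> = group_center G"
proof -
  interpret A: irrep G d \<rho> by fact
  let ?D = "derived G (carrier G)"
  have 1: "c = \<one>" if c: "c \<in> A.ker" "c \<in> ?D" for c
  proof (rule ccontr)
    assume "c \<noteq> \<one>"
    then have "?D \<subseteq> A.ker" using subset_if_card_p[OF derived_subgroup D A.ker_subgroup] c by blast
    then show False using A.degree_one_if_commuting commutator_derived d by blast
  qed
  then show "A.ker \<inter> ?D = {\<one>}"
    using subgroup.one_closed[OF A.ker_subgroup] subgroup.one_closed[OF derived_subgroup] by blast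
  show "A.scal = group_center G"
  proof
    show "A.scal \<subseteq> group_center G"
    proof
      fix x assume x: "x \<in> A.scal"
      then have xc: "x \<in> carrier G" using A.scalD by blast
      have "commutator G x g = \<one>" if g: "g \<in> carrier G" for g
        using 1 A.scal_iff_commutator[OF xc] x g commutator_derived[OF xc g] by blast
      then show "x \<in> group_center G" unfolding group_center_eq_center_mod center_mod_def using xc by simp
    qed
  qed (rule A.center_scal)
qed

end

section \<open>The Galois conjugacy condition for \<open>p\<close>-groups\<close>

lemma prime_times_square_neq_square:
  fixes p d e :: nat
  assumes p: "prime p" and d: "d > 0"
  shows "p * d\<^sup>2 \<noteq> e\<^sup>2"
proof
  assume eq: "p * d\<^sup>2 = e\<^sup>2"
  have p0: "p > 0" using p prime_gt_0_nat by blast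
  have e: "e \<noteq> 0" using eq d p0 by (intro notI) simp
  have pe: "prime_elem p" using p by simp
  have "multiplicity p (p * d\<^sup>2) = 1 + 2 * multiplicity p d"
    using pe p0 d by (simp add: prime_elem_multiplicity_mult_distrib prime_elem_multiplicity_power_distrib)
  moreover have "multiplicity p (e\<^sup>2) = 2 * multiplicity p e"
    using pe e by (simp add: prime_elem_multiplicity_power_distrib)
  ultimately have "1 + 2 * multiplicity p d = 2 * multiplicity p e" using eq by simp
  then show False by presburger
qed

context pgroup
begin

lemma nonlinear_if_derived_not_ker:
  assumes r: "irrep G d \<rho>" and x: "x \<in> derived G (carrier G)" "x \<notin> irrep.ker G d \<rho>"
  shows "d \<noteq> 1"
proof
  interpret A: irrep G d \<rho> by fact
  assume "d = 1"
  then have "derived G (carrier G) \<subseteq> A.ker"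
    using derived_subset[OF A.ker_subgroup] A.commutator_ker_if_degree_one by blast
  then show False using x by blast
qed

text \<open>By the condition on kernels, a representation nontrivial on the derived subgroup is
  faithful, so \<open>ev\<close> embeds the centre into the roots of unity. For \<open>z\<close> of
  largest order, the powers of its eigenvalue include all others.\<close>

lemma cyclic_center_if_GC_star:
  assumes D: "card (derived G (carrier G)) = p" and GC: "GC_star G"
  shows "cyclic_subset G (group_center G)"
proof -
  let ?D = "derived G (carrier G)" and ?Z = "group_center G"
  have "?D \<noteq> {\<one>}" using D p_gt_1 by auto
  then obtain c where c: "c \<in> ?D" "c \<noteq> \<one>" using subgroup.one_closed[OF derived_subgroup] by blast
  have cZ: "c \<in> ?Z" using c derived_subset_center_if_card_p[OF D] by blast
  have cc: "c \<in> carrier G" using c subgroup.mem_carrier[OF derived_subgroup] by blast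
  have "commutator G g c \<in> {\<one>}" if g: "g \<in> carrier G" for g
    using center_commutes[OF cZ g] commutator_eq_one_iff[OF g cc] by simp
  then obtain d \<rho> where r: "irrep G d \<rho>" and nk: "c \<notin> irrep.ker G d \<rho>"
    using irrep_separating[OF finite_carrier one_is_normal cc] c(2) by blast
  interpret A: irrep G d \<rho> by fact
  have d: "d \<noteq> 1" using nonlinear_if_derived_not_ker[OF r c(1) nk] .
  have "A.ker \<subseteq> ?D" using GC_star_ker_derived[OF GC r d] .
  then have ker: "A.ker = {\<one>}" using irrep_derived_p(1)[OF D r d] by blast
  have scal: "A.scal = ?Z" using irrep_derived_p(2)[OF D r d] .
  have Zc: "x \<in> ?Z \<Longrightarrow> x \<in> carrier G" for x unfolding group_center_def by auto
  have finZ: "finite ?Z" using finite_subset[OF _ finite_carrier] Zc by blast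
  have neZ: "?Z \<noteq> {}" using cZ by blast
  have ev1: "x = \<one>" if "x \<in> ?Z" "A.ev x = 1" for x using that A.ker_iff scal ker by blast
  have Zpow: "x [^] (n::nat) \<in> ?Z" "A.ev (x [^] n) = A.ev x ^ n" if "x \<in> ?Z" for x n
    using A.scal_pow[of x n] that scal by auto
  obtain z where z: "z \<in> ?Z" and max: "\<And>y. y \<in> ?Z \<Longrightarrow> ord y \<le> ord z"
  proof -
    have "Max (ord ` ?Z) \<in> ord ` ?Z" using finZ neZ by (intro Max_in) auto
    then obtain z where "z \<in> ?Z" "ord z = Max (ord ` ?Z)" by (metis imageE)
    then show thesis using that[of z] finZ by simp
  qed
  have ordp: "\<exists>i. ord y = p ^ i" if "y \<in> carrier G" for y
    using ord_dvd_group_order[OF that] divides_primepow_nat[OF prime] card_carrier by (auto simp: Coset.order_def)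
  obtain m where m: "ord z = p ^ m" using ordp[OF Zc[OF z]] by blast
  \<comment> \<open>The element \<open>c\<close> makes the centre nontrivial, so the largest order
    has the form \<open>p ^ Suc a\<close>.\<close>
  have "ord c \<noteq> 1" using c(2) ord_eq_1[OF cc] by simp
  moreover have "ord c \<noteq> 0" using ordp[OF cc] p_gt_1 by auto
  ultimately have "p ^ m > 1" using max[OF cZ] m by linarith
  then obtain a where a: "m = Suc a" by (cases m) auto
  have za: "z [^] (p ^ a) \<noteq> \<one>"
    using pow_eq_id[OF Zc[OF z], of "p ^ a"] m a p_gt_1 by (auto dest: dvd_imp_le)
  have u: "A.ev z ^ (p ^ Suc a) = 1" "A.ev z ^ (p ^ a) \<noteq> 1"
  proof -
    have "z [^] (p ^ Suc a) = \<one>" using pow_ord_eq_1[OF Zc[OF z]] m a by simp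
    then show "A.ev z ^ (p ^ Suc a) = 1" using Zpow(2)[OF z, of "p ^ Suc a"] A.ev_one by simp
    show "A.ev z ^ (p ^ a) \<noteq> 1" using za ev1 Zpow[OF z, of "p ^ a"] by auto
  qed
  have "?Z \<subseteq> generate G {z}"
  proof
    fix y assume y: "y \<in> ?Z"
    obtain i where i: "ord y = p ^ i" using ordp[OF Zc[OF y]] by blast
    have "p ^ i \<le> p ^ Suc a" using max[OF y] i m a by simp
    then have "i \<le> Suc a" using p_gt_1 power_increasing_iff by blast
    then have "ord y dvd p ^ Suc a" unfolding i by (rule le_imp_power_dvd)
    then have "y [^] (p ^ Suc a) = \<one>" using pow_eq_id[OF Zc[OF y]] by blast
    then have "A.ev y ^ (p ^ Suc a) = 1" using Zpow(2)[OF y, of "p ^ Suc a"] A.ev_one by simp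
    then obtain j where j: "A.ev y = A.ev z ^ j" using root_of_unity_is_power[OF prime u] by blast
    have zj: "z [^] j \<in> A.scal" using Zpow(1)[OF z] scal by simp
    have ys: "y \<in> A.scal" using y scal by simp
    have "A.ev (inv (z [^] j) \<otimes> y) = 1"
      using A.scal_mult(2)[OF A.scal_inv(1)[OF zj] ys] A.scal_inv(2,3)[OF zj] j Zpow(2)[OF z] by simp
    moreover have "inv (z [^] j) \<otimes> y \<in> ?Z" using A.scal_mult(1)[OF A.scal_inv(1)[OF zj] ys] scal by simp
    ultimately have "inv (z [^] j) \<otimes> y = \<one>" using ev1 by blast
    then have "y = z [^] j" using Zc[OF y] Zc[OF z] by (metis inv_closed inv_equality inv_inv nat_pow_closed)
    then show "y \<in> generate G {z}"
      using subgroup_pow_closed[OF generate_is_subgroup] Zc[OF z] generate.incl[of z "{z}" G] by simp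
  qed
  moreover have "generate G {z} \<subseteq> ?Z" using generate_subgroup_incl[OF _ center_subgroup] z by simp
  ultimately show ?thesis unfolding cyclic_subset_def using z by blast
qed

text \<open>Both characters vanish off the centre, and on it they are d times powers of the
  eigenvalue at a generator \<open>z\<close>. So an automorphism matching the two eigenvalues at
  \<open>z\<close> is enough.\<close>

lemma GC_star_if_cyclic_center:
  assumes D: "card (derived G (carrier G)) = p" and cyc: "cyclic_subset G (group_center G)"
  shows "GC_star G"
  unfolding GC_star_def
proof (intro allI impI)
  fix \<chi> \<psi>
  assume H: "irr_char G \<chi> \<and> irr_char G \<psi> \<and> \<chi> \<one> \<noteq> 1 \<and> \<psi> \<one> \<noteq> 1 \<and> \<chi> \<one> = \<psi> \<one>"
  let ?D = "derived G (carrier G)" and ?Z = "group_center G"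
  obtain d \<rho> where "is_irr_rep G d \<rho>" and \<chi>: "\<And>g. g \<in> carrier G \<Longrightarrow> \<chi> g = mat_trace (\<rho> g)"
    using H unfolding irr_char_def by blast
  then have r: "irrep G d \<rho>" using irrepI[OF is_group finite_carrier] by blast
  obtain d' \<rho>' where "is_irr_rep G d' \<rho>'" and \<psi>: "\<And>g. g \<in> carrier G \<Longrightarrow> \<psi> g = mat_trace (\<rho>' g)"
    using H unfolding irr_char_def by blast
  then have r': "irrep G d' \<rho>'" using irrepI[OF is_group finite_carrier] by blast
  interpret A: irrep G d \<rho> by fact
  interpret B: irrep G d' \<rho>' by fact
  have dd: "d' = d" "d \<noteq> 1" using H \<chi> \<psi> A.trace_one B.trace_one by auto
  have r'': "irrep G d \<rho>'" using r' dd by simp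
  have sA: "A.scal = ?Z" using irrep_derived_p(2)[OF D r dd(2)] .
  have sB: "B.scal = ?Z" using irrep_derived_p(2)[OF D r''] dd by simp
  have DZ: "?D \<subseteq> ?Z" using derived_subset_center_if_card_p[OF D] .
  obtain z where z: "z \<in> ?Z" "?Z = generate G {z}" using cyc unfolding cyclic_subset_def by blast
  have zc: "z \<in> carrier G" using z unfolding group_center_def by auto
  have "?D \<noteq> {\<one>}" using D p_gt_1 by auto
  then obtain c where c: "c \<in> ?D" "c \<noteq> \<one>" using subgroup.one_closed[OF derived_subgroup] by blast
  have "ord z dvd p ^ k" using ord_dvd_group_order[OF zc] card_carrier by (simp add: Coset.order_def)
  then obtain m where m: "ord z = p ^ m" using divides_primepow_nat[OF prime] by blast
  have gen: "generate G {z} = {z [^] (i::nat) | i. i \<in> UNIV}"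
    using generate_pow_nat[OF zc] m p_gt_1 by simp
  obtain t where t: "c = z [^] (t::nat)" using c DZ z gen by blast
  have "m \<noteq> 0"
  proof
    assume "m = 0"
    then have "z = \<one>" using m ord_eq_1[OF zc] by simp
    then show False using t c by simp
  qed
  then obtain a where a: "m = Suc a" using not0_implies_Suc by blast
  \<comment> \<open>Being killed by p, \<open>c\<close> is a power of \<open>z [^] (p ^ a)\<close>;
    an eigenvalue at \<open>z\<close> of order less than \<open>p ^ Suc a\<close> would thus put
    \<open>c\<close> into the kernel.\<close>
  have "c [^] p = \<one>" using subgroup_pow_card[OF finite_carrier derived_subgroup c(1)] D by simp
  then have "z [^] (t * p) = \<one>" using t zc by (simp add: nat_pow_pow)
  then have "p * p ^ a dvd p * t" using pow_eq_id[OF zc] m a by (simp add: mult.commute)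
  then have "p ^ a dvd t" using p_gt_1 by simp
  then obtain t' where t': "t = p ^ a * t'" by (elim dvdE)
  have prim: "irrep.ev \<tau> z ^ (p ^ Suc a) = 1 \<and> irrep.ev \<tau> z ^ (p ^ a) \<noteq> 1" if T: "irrep G d \<tau>" for \<tau>
  proof -
    interpret T: irrep G d \<tau> by fact
    have zs: "z \<in> T.scal" using T.center_scal z by blast
    have "z [^] (p ^ Suc a) = \<one>" using pow_ord_eq_1[OF zc] m a by simp
    then have "T.ev z ^ (p ^ Suc a) = 1" using T.scal_pow(2)[OF zs, of "p ^ Suc a"] T.ev_one by simp
    moreover have "T.ev z ^ (p ^ a) \<noteq> 1"
    proof
      assume "T.ev z ^ (p ^ a) = 1"
      then have "T.ev c = 1" unfolding t t' T.scal_pow(2)[OF zs] by (simp add: power_mult)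
      moreover have "c \<in> T.scal" using T.center_scal DZ c by blast
      ultimately have "c \<in> T.ker" using T.ker_iff by blast
      then show False using irrep_derived_p(1)[OF D T dd(2)] c by blast
    qed
    ultimately show ?thesis by blast
  qed
  have u: "A.ev z ^ (p ^ Suc a) = 1" "A.ev z ^ (p ^ a) \<noteq> 1" using prim[OF r] by auto
  have w: "B.ev z ^ (p ^ Suc a) = 1" "B.ev z ^ (p ^ a) \<noteq> 1" using prim[OF r''] by auto
  obtain l where l: "B.ev z = A.ev z ^ l" using root_of_unity_is_power[OF prime u w(1)] by blast
  have pl: "\<not> p dvd l"
  proof
    assume "p dvd l"
    then obtain l' where "l = p * l'" by (elim dvdE)
    then have "B.ev z ^ (p ^ a) = (A.ev z ^ (p ^ Suc a)) ^ l'"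
      unfolding l by (simp add: power_mult[symmetric] mult_ac)
    then show False using u w by simp
  qed
  \<comment> \<open>\<open>galois_conjugate\<close> asks for a multiple of the group order, which
    can exceed the order of \<open>z\<close>. The automorphism that raises the generating root to
    the power \<open>l\<close> does the same to its power \<open>A.ev z\<close>.\<close>
  let ?n = "card (carrier G)"
  let ?\<zeta> = "cis (2 * pi / real ?n)"
  have n0: "?n > 0" using card_carrier p_gt_1 by simp
  have "k \<noteq> 0"
  proof
    assume "k = 0"
    then have "card (carrier G) = 1" using card_carrier by simp
    then obtain x where "carrier G = {x}" by (rule card_1_singletonE)
    then show False using c subgroup.mem_carrier[OF derived_subgroup] one_closed by auto
  qed
  then obtain k' where k': "k = Suc k'" using not0_implies_Suc by blast
  have n: "?n = p ^ Suc k'" using card_carrier k' by simp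
  have \<zeta>: "?\<zeta> ^ (p ^ Suc k') = 1" "?\<zeta> ^ (p ^ k') \<noteq> 1"
    using cis_root_of_unity_power_eq_1_iff[OF n0, of "p ^ Suc k'"] cis_root_of_unity_power_eq_1_iff[OF n0, of "p ^ k'"] n p_gt_1
    by (auto dest: dvd_imp_le)
  have "A.ev z ^ ?n = 1"
  proof -
    have zs: "z \<in> A.scal" using A.center_scal z by blast
    have "z [^] ?n = \<one>" using pow_order_eq_1[OF zc] by (simp add: Coset.order_def)
    then show ?thesis using A.scal_pow(2)[OF zs, of ?n] A.ev_one by simp
  qed
  then obtain s where s: "A.ev z = ?\<zeta> ^ s" using root_of_unity_is_power[OF prime \<zeta>] n by auto
  obtain \<sigma> where \<sigma>: "\<sigma> \<in> gal_cyclotomic ?n" "\<sigma> ?\<zeta> = ?\<zeta> ^ l"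
    using gal_cyclotomic_prime_power[OF prime n pl] by blast
  have \<alpha>F: "A.ev z \<in> cyclotomic_field ?n" unfolding s
    using gal_cyclotomic_power[OF \<sigma>(1) root_in_cyclotomic_field] by blast
  have "\<sigma> (A.ev z) = (?\<zeta> ^ l) ^ s"
    unfolding s using gal_cyclotomic_power[OF \<sigma>(1) root_in_cyclotomic_field] \<sigma>(2) by simp
  also have "\<dots> = B.ev z" unfolding l s by (simp only: power_mult[symmetric] mult.commute)
  finally have \<sigma>\<alpha>: "\<sigma> (A.ev z) = B.ev z" .
  have "\<psi> g = \<sigma> (\<chi> g)" if g: "g \<in> carrier G" for g
  proof (cases "g \<in> ?Z")
    case True
    then obtain i where i: "g = z [^] (i::nat)" using z gen by blast
    have "\<chi> g = of_nat d * A.ev z ^ i"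
      using \<chi>[OF g] A.trace_scal[of g] True sA A.scal_pow(2)[of z i] z(1) i by simp
    then have "\<sigma> (\<chi> g) = \<sigma> (of_nat d) * \<sigma> (A.ev z ^ i)"
      using \<sigma>(1) of_nat_cyclotomic_field[of d ?n] gal_cyclotomic_power[OF \<sigma>(1) \<alpha>F, of i]
      unfolding gal_cyclotomic_def by simp
    also have "\<dots> = of_nat d * B.ev z ^ i"
      using gal_cyclotomic_of_nat[OF \<sigma>(1)] gal_cyclotomic_power[OF \<sigma>(1) \<alpha>F, of i] \<sigma>\<alpha> by simp
    also have "\<dots> = \<psi> g"
      using \<psi>[OF g] B.trace_scal[of g] True sB B.scal_pow(2)[of z i] z(1) i dd by simp
    finally show ?thesis by simp
  next
    case False
    have "\<chi> g = 0" using \<chi>[OF g] A.trace_zero_off_scal[OF _ g] False sA DZ commutator_derived by auto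
    moreover have "\<psi> g = 0" using \<psi>[OF g] B.trace_zero_off_scal[OF _ g] False sB DZ commutator_derived by auto
    ultimately show ?thesis using gal_cyclotomic_of_nat[OF \<sigma>(1), of 0] by simp
  qed
  then show "galois_conjugate G \<chi> \<psi>" unfolding galois_conjugate_def
    using n0 \<sigma>(1) by (intro exI[of _ ?n] exI[of _ \<sigma>]) auto
qed

section \<open>Derived subgroups of order p squared\<close>

lemma card_scal_cases:
  assumes r: "irrep G d \<rho>" and ker: "irrep.ker G d \<rho> \<subseteq> group_center G"
    and pow: "\<And>y. y \<in> irrep.ker G d \<rho> \<Longrightarrow> y [^] p = \<one>"
  shows "card (irrep.scal G d \<rho>) = card (group_center G) \<or> card (irrep.scal G d \<rho>) = p * card (group_center G)"
proof -
  interpret A: irrep G d \<rho> by fact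
  have "x [^] p \<in> group_center G" if x: "x \<in> A.scal" for x
  proof -
    have xc: "x \<in> carrier G" using x A.scalD by blast
    \<comment> \<open>Commutators with \<open>x\<close> are central and killed by p, so the p-th
      power of \<open>x\<close> commutes with everything.\<close>
    have "commutator G (x [^] p) g = \<one>" if g: "g \<in> carrier G" for g
    proof -
      have c: "commutator G x g \<in> A.ker" using A.scal_iff_commutator[OF xc] x g by blast
      then show ?thesis using commutator_pow_left[OF xc g, of p] ker pow by auto
    qed
    then show ?thesis unfolding group_center_eq_center_mod center_mod_def using xc by simp
  qed
  then have "card A.scal \<le> p * card (group_center G)"
    using A.card_scal_le[OF center_subgroup ker A.center_scal] p_gt_1 by simp
  then show ?thesis using card_index_cases[OF center_subgroup A.scal_subgroup A.center_scal] by blast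
qed

text \<open>Conjugation by any element changes \<open>x\<close> and \<open>y\<close> only by factors in \<open>G'\<close>, which are central in \<open>C\<close>.\<close>

lemma commutator_central_if_derived_centralized:
  assumes C: "subgroup C G" and D: "derived G (carrier G) \<subseteq> C"
    and comm: "\<And>s c. s \<in> derived G (carrier G) \<Longrightarrow> c \<in> C \<Longrightarrow> s \<in> centralizer c"
    and x: "x \<in> C" and y: "y \<in> C"
  shows "commutator G x y \<in> group_center G"
proof -
  have Cc: "c \<in> C \<Longrightarrow> c \<in> carrier G" for c using subgroup.mem_carrier[OF C] .
  have Dc: "s \<in> derived G (carrier G) \<Longrightarrow> s \<in> carrier G" for s using D Cc by blast
  have cl: "commutator G (s \<otimes> u) v = commutator G u v" if s: "s \<in> derived G (carrier G)" and u: "u \<in> C" and v: "v \<in> C" for s u v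
  proof -
    have uv: "commutator G u v \<in> C" unfolding commutator_def
      using u v subgroup.m_closed[OF C] subgroup.m_inv_closed[OF C] by simp
    have "commutator G s v = \<one>" using comm[OF s v] centralizer_iff_commutator[OF Dc[OF s] Cc[OF v]] by simp
    moreover have "s \<otimes> commutator G u v \<otimes> inv s = commutator G u v"
      using comm[OF s uv] conj_eq_self_iff[OF Dc[OF s] Cc[OF uv]] unfolding centralizer_def by simp
    ultimately show ?thesis using commutator_mult_left[OF Dc[OF s] Cc[OF u] Cc[OF v]] Cc[OF uv] by simp
  qed
  have "w \<otimes> commutator G x y \<otimes> inv w = commutator G x y" if w: "w \<in> carrier G" for w
  proof -
    let ?s = "commutator G w x" and ?t = "commutator G w y"
    have st: "?s \<in> derived G (carrier G)" "?t \<in> derived G (carrier G)" using commutator_derived w Cc x y by auto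
    have tC: "?t \<otimes> y \<in> C" using st D y subgroup.m_closed[OF C] by blast
    have "w \<otimes> commutator G x y \<otimes> inv w = commutator G (w \<otimes> x \<otimes> inv w) (w \<otimes> y \<otimes> inv w)"
      unfolding commutator_def using w Cc[OF x] Cc[OF y]
      by (simp add: inv_mult_group m_assoc) (simp add: m_assoc[symmetric])
    also have "\<dots> = commutator G (?s \<otimes> x) (?t \<otimes> y)" using conj_eq_commutator w Cc x y by simp
    also have "\<dots> = commutator G x (?t \<otimes> y)" using cl[OF st(1) x tC] .
    also have "\<dots> = inv (commutator G (?t \<otimes> y) x)" using inv_commutator Cc tC x by simp
    also have "\<dots> = inv (commutator G y x)" using cl[OF st(2) y x] by simp
    also have "\<dots> = commutator G x y" using inv_commutator Cc x y by simp
    finally show ?thesis .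
  qed
  then show ?thesis unfolding group_center_def
    using conj_eq_self_iff commutator_closed Cc x y by auto
qed

text \<open>The map sending g to [g, b] takes values in \<open>N\<close>, and its fibres lie in left
  cosets of the centralizer; so the index is at most p, and it is not 1 because \<open>b\<close> is
  not central.\<close>

lemma card_cent_index:
  assumes N: "subgroup N G" "card N = p" and b: "b \<in> center_mod G N" "b \<notin> group_center G"
  shows "card (carrier G) = p * card (centralizer b)"
proof -
  have bc: "b \<in> carrier G" using b center_mod_carrier by auto
  have subC: "subgroup (centralizer b) G" using centralizer_subgroup[OF bc] .
  have fin: "finite N" "finite (centralizer b)"
    using finite_subset[OF subgroup.subset finite_carrier] N(1) subC by blast+
  have cN: "commutator G g b \<in> N" if "g \<in> carrier G" for g
    using b that commutator_flip[OF N(1) that bc] unfolding center_mod_def by blast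
  have fiber: "card {g \<in> carrier G. commutator G g b = n} \<le> card (centralizer b)" for n
  proof (cases "{g \<in> carrier G. commutator G g b = n} = {}")
    case False
    then obtain h where h: "h \<in> carrier G" "commutator G h b = n" by blast
    have "{g \<in> carrier G. commutator G g b = n} \<subseteq> (\<lambda>c. h \<otimes> c) ` centralizer b"
    proof
      fix g assume "g \<in> {g \<in> carrier G. commutator G g b = n}"
      then have g: "g \<in> carrier G" "commutator G g b = n" by auto
      have "g \<otimes> b \<otimes> inv g = h \<otimes> b \<otimes> inv h" using conj_eq_commutator[OF g(1) bc] conj_eq_commutator[OF h(1) bc] g h by simp
      then have "inv h \<otimes> (g \<otimes> b \<otimes> inv g) \<otimes> g = inv h \<otimes> (h \<otimes> b \<otimes> inv h) \<otimes> g" by simp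
      then have "inv h \<otimes> g \<otimes> b = b \<otimes> (inv h \<otimes> g)"
        using g(1) h(1) bc by (simp add: m_assoc) (simp add: m_assoc[symmetric])
      then have "inv h \<otimes> g \<in> centralizer b" unfolding centralizer_def using g h by simp
      moreover have "g = h \<otimes> (inv h \<otimes> g)" using g h by (simp add: m_assoc[symmetric])
      ultimately show "g \<in> (\<lambda>c. h \<otimes> c) ` centralizer b" by blast
    qed
    then show ?thesis using surj_card_le[OF fin(2)] by blast
  next
    case True
    then show ?thesis by (simp only: True card.empty le0)
  qed
  have "carrier G \<subseteq> (\<Union>n\<in>N. {g \<in> carrier G. commutator G g b = n})" using cN by blast
  then have "card (carrier G) \<le> card (\<Union>n\<in>N. {g \<in> carrier G. commutator G g b = n})"
    using fin finite_carrier by (intro card_mono) auto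
  also have "\<dots> \<le> (\<Sum>n\<in>N. card {g \<in> carrier G. commutator G g b = n})" using fin(1) by (rule card_UN_le)
  also have "\<dots> \<le> (\<Sum>n\<in>N. card (centralizer b))" by (intro sum_mono fiber)
  finally have "card (carrier G) \<le> p * card (centralizer b)" using N(2) by simp
  then have "card (carrier G) = card (centralizer b) \<or> card (carrier G) = p * card (centralizer b)"
    using card_index_cases[OF subC subgroup_self subgroup.subset[OF subC]] by blast
  moreover have "card (carrier G) \<noteq> card (centralizer b)"
  proof
    assume "card (carrier G) = card (centralizer b)"
    then have "centralizer b = carrier G" using finite_carrier subgroup.subset[OF subC] by (intro card_subset_eq) auto
    then have "g \<in> centralizer b" if "g \<in> carrier G" for g using that by simp
    then have "b \<otimes> g = g \<otimes> b" if "g \<in> carrier G" for g using that unfolding centralizer_def by simp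
    then show False using b(2) bc unfolding group_center_def by auto
  qed
  ultimately show ?thesis by blast
qed

lemma GC_star_derived_not_p_square:
  assumes GC: "GC_star G" and D2: "card (derived G (carrier G)) = p\<^sup>2"
  shows False
proof -
  let ?D = "derived G (carrier G)" and ?Z = "group_center G"
  have Dn: "?D \<lhd> G" and Ds: "subgroup ?D G" using derived_self_is_normal derived_subgroup by auto
  have Zs: "subgroup ?Z G" by (rule center_subgroup)
  have Zc: "x \<in> ?Z \<Longrightarrow> x \<in> carrier G" for x unfolding group_center_def by auto
  have "card ?D > 1" unfolding D2 using p_gt_1 by (rule one_less_power) simp
  then have "?D \<noteq> {\<one>}" by auto
  then obtain a0 where a0: "a0 \<in> ?D" "a0 \<in> ?Z" "a0 \<noteq> \<one>" using normal_meets_center[OF Dn] by blast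
  have DZs: "subgroup (?D \<inter> ?Z) G" using subgroups_Inter_pair[OF Ds Zs] .
  have DZn: "?D \<inter> ?Z \<lhd> G" using center_subgroup_normal[OF DZs] by blast
  obtain a where a: "a \<in> ?D \<inter> ?Z" "a \<noteq> \<one>" "a [^] p = \<one>"
    using central_mod_pow_exists[OF DZn one_is_normal] a0 subgroup.one_closed[OF DZs] by blast
  have aZ: "a \<in> center_mod G {\<one>}" using a group_center_eq_center_mod by blast
  obtain N where N: "N \<lhd> G" "card N = p * card {\<one>}" "a \<in> N" "N \<subseteq> ?D \<inter> ?Z"
    using normal_extend[OF one_is_normal aZ] a DZs subgroup.one_closed[OF DZs] by blast
  have Ns: "subgroup N G" and cN: "card N = p" using N normal_imp_subgroup by auto
  have cD: "card ?D = p * card N" using D2 cN by (simp add: power2_eq_square)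
  have ND: "N \<subseteq> ?D" and NZ: "N \<subseteq> ?Z" using N by auto
  have "N \<noteq> ?D" using cD cN p_gt_1 by (intro notI) simp
  then obtain b where b: "b \<in> ?D" "b \<notin> N" "b \<in> center_mod G N"
    using central_mod_exists[OF Dn N(1) ND] by blast
  have bc: "b \<in> carrier G" using b subgroup.mem_carrier[OF Ds] by blast
  note prime_idx = subgroup_subset_if_prime_index[OF finite_carrier prime Ns Ds ND cD]
  \<comment> \<open>These will be the scalar elements of the representation with kernel
    \<open>N\<close>.\<close>
  define K where "K = center_mod G N"
  have Ks: "subgroup K G" unfolding K_def by (rule center_mod_subgroup[OF N(1)])
  have DK: "?D \<subseteq> K" using prime_idx[OF b(1,2) Ks] normal_subset_center_mod[OF N(1)] b(3) unfolding K_def by blast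
  have powN: "y [^] p = \<one>" if "y \<in> N" for y using subgroup_pow_card[OF finite_carrier Ns that] cN by simp

  have "commutator G g b \<in> N" if "g \<in> carrier G" for g
    using b(3) commutator_flip[OF Ns that bc] that unfolding center_mod_def by blast
  then obtain d \<rho> where r: "irrep G d \<rho>" and NA: "N \<subseteq> irrep.ker G d \<rho>" and bA: "b \<notin> irrep.ker G d \<rho>"
    using irrep_separating[OF finite_carrier N(1) bc b(2)] by blast
  interpret A: irrep G d \<rho> by fact
  have d1: "d \<noteq> 1" using nonlinear_if_derived_not_ker[OF r b(1) bA] .
  \<comment> \<open>The kernel lies between \<open>N\<close> and the derived subgroup, in which
    \<open>N\<close> has index p, and \<open>b\<close> keeps it from being the whole.\<close>
  have kerA: "A.ker = N"
  proof (rule ccontr)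
    assume "A.ker \<noteq> N"
    then obtain x where x: "x \<in> A.ker" "x \<notin> N" using NA by blast
    then have "x \<in> ?D" using GC_star_ker_derived[OF GC r d1] by blast
    then have "?D \<subseteq> A.ker" using prime_idx[OF _ x(2) A.ker_subgroup NA x(1)] by blast
    then show False using b bA by blast
  qed
  have scalA: "A.scal = K"
    unfolding K_def center_mod_def using A.scal_iff_commutator A.scalD(1) kerA by blast
  have dK: "d\<^sup>2 * card K = card (carrier G)"
    using A.degree_square commutator_derived DK scalA by blast
  have cK: "card K = card ?Z \<or> card K = p * card ?Z"
    using card_scal_cases[OF r] kerA NZ powN scalA by simp

  have "commutator G g a \<in> {\<one>}" if g: "g \<in> carrier G" for g
    using commutator_eq_one_iff[OF g] center_commutes[of a g] a Zc g by auto
  \<comment> \<open>The second representation is nontrivial on \<open>N\<close>, witnessed by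
    \<open>a\<close>. As \<open>a\<close> acts as a scalar, \<open>GC_star_ker\<close> applies and
    excludes equal degrees.\<close>
  then obtain e \<theta> where r': "irrep G e \<theta>" and aB: "a \<in> irrep.scal G e \<theta>" "a \<notin> irrep.ker G e \<theta>"
    using irrep_separating[OF finite_carrier one_is_normal] a Zc by blast
  interpret B: irrep G e \<theta> by fact
  have e1: "e \<noteq> 1" using nonlinear_if_derived_not_ker[OF r' _ aB(2)] a by blast
  have kerB: "B.ker \<subseteq> ?D" using GC_star_ker_derived[OF GC r' e1] .
  have ed: "e \<noteq> d"
  proof
    assume "e = d"
    then have "irrep G d \<theta>" "a \<in> irrep.scal G d \<theta>" "a \<notin> irrep.ker G d \<theta>" using r' aB by auto
    then show False using GC_star_ker[OF GC r _ d1] NA N(3) by blast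
  qed
  show False
  proof (cases "?D \<subseteq> ?Z")
    case True
    \<comment> \<open>The kernel misses \<open>a\<close>, so it is a proper subgroup of a group of
      order p squared and its order divides p.\<close>
    have powB: "y [^] p = \<one>" if y: "y \<in> B.ker" for y
    proof -
      obtain j where j: "card B.ker = p ^ j" using card_subgroup[OF B.ker_subgroup] by blast
      have "card B.ker \<noteq> card ?D"
      proof
        assume "card B.ker = card ?D"
        then have "B.ker = ?D" using kerB finite_subset[OF subgroup.subset[OF Ds] finite_carrier] by (intro card_subset_eq) auto
        then show False using a aB by blast
      qed
      moreover have "p ^ j dvd p\<^sup>2" using card_subgroup_dvd[OF B.ker_subgroup Ds kerB] j D2 by simp
      then have "j \<le> 2" using p_gt_1 power_dvd_imp_le by blast
      ultimately have "j \<le> 1" using j D2 by (cases "j = 2") auto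
      then have "card B.ker dvd p" unfolding j by (metis le_imp_power_dvd power_one_right)
      then obtain c where c: "p = card B.ker * c" by (elim dvdE)
      have "y [^] p = (y [^] card B.ker) [^] c"
        using subgroup.mem_carrier[OF B.ker_subgroup y] by (subst c) (simp add: nat_pow_pow)
      then show ?thesis using subgroup_pow_card[OF finite_carrier B.ker_subgroup y] by simp
    qed
    have sB: "card B.scal = card ?Z \<or> card B.scal = p * card ?Z"
      using card_scal_cases[OF r'] kerB True powB by blast
    have "e\<^sup>2 * card B.scal = card (carrier G)"
      using B.degree_square commutator_derived True B.center_scal by blast
    then have eq: "e\<^sup>2 * card B.scal = d\<^sup>2 * card K" using dK by simp
    have Z0: "card ?Z > 0" using card_pos[OF Zs] .
    have "p * e\<^sup>2 \<noteq> d\<^sup>2" "p * d\<^sup>2 \<noteq> e\<^sup>2"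
      using prime_times_square_neq_square[OF prime] A.degree_pos B.degree_pos by auto
    moreover have "e\<^sup>2 = d\<^sup>2 \<or> p * e\<^sup>2 = d\<^sup>2 \<or> p * d\<^sup>2 = e\<^sup>2"
      using sB cK
    proof (elim disjE)
      assume "card B.scal = card ?Z" "card K = card ?Z"
      then show ?thesis using eq Z0 by simp
    next
      assume "card B.scal = card ?Z" "card K = p * card ?Z"
      then have "e\<^sup>2 * card ?Z = (p * d\<^sup>2) * card ?Z" using eq by (simp add: mult_ac)
      then show ?thesis using Z0 by simp
    next
      assume "card B.scal = p * card ?Z" "card K = card ?Z"
      then have "(p * e\<^sup>2) * card ?Z = d\<^sup>2 * card ?Z" using eq by (simp add: mult_ac)
      then show ?thesis using Z0 by simp
    next
      assume "card B.scal = p * card ?Z" "card K = p * card ?Z"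
      then show ?thesis using eq Z0 p_gt_1 by simp
    qed
    ultimately have "e\<^sup>2 = d\<^sup>2" by blast
    then show False using ed by simp
  next
    case False
    have DZN: "?D \<inter> ?Z = N"
    proof (rule ccontr)
      assume "?D \<inter> ?Z \<noteq> N"
      then obtain x where x: "x \<in> ?D" "x \<in> ?Z" "x \<notin> N" using N(4) by blast
      then have "?D \<subseteq> ?Z" using prime_idx[OF x(1,3) Zs NZ x(2)] by blast
      then show False using False by blast
    qed
    have bZ: "b \<notin> ?Z" using b DZN by blast
    have bK: "b \<in> K" using b K_def by simp
    have ZK: "?Z \<subseteq> K" using A.center_scal scalA by simp
    have "card K \<noteq> card ?Z"
    proof
      assume "card K = card ?Z"
      then have "?Z = K" using ZK finite_subset[OF subgroup.subset[OF Ks] finite_carrier] by (intro card_subset_eq) auto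
      then show False using bK bZ by blast
    qed
    then have cKp: "card K = p * card ?Z" using cK by blast
    define C where "C = centralizer b"
    have Cs: "subgroup C G" unfolding C_def by (rule centralizer_subgroup[OF bc])
    have Cc: "c \<in> C \<Longrightarrow> c \<in> carrier G" for c using subgroup.mem_carrier[OF Cs] .
    \<comment> \<open>\<open>Z(G)\<close> has index p in \<open>K\<close> and \<open>b\<close> lies
      outside it, so whatever commutes with \<open>b\<close> commutes with \<open>K\<close>. As
      \<open>K\<close> contains the derived subgroup, \<open>C\<close> centralizes that as
      well.\<close>
    have K_cent: "K \<subseteq> centralizer w" if w: "w \<in> C" for w
      using subgroup_subset_if_prime_index[OF finite_carrier prime Zs Ks ZK cKp bK bZ centralizer_subgroup[OF Cc[OF w]]]
        center_subset_centralizer[OF Cc[OF w]] centralizer_sym[OF bc Cc[OF w]] w unfolding C_def by blast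
    have "b \<in> C" unfolding C_def centralizer_def using bc by simp
    then have KC: "K \<subseteq> C" using K_cent unfolding C_def by blast
    have commutatorC: "commutator G x y \<in> N" if "x \<in> C" "y \<in> C" for x y
    proof -
      have "commutator G x y \<in> ?Z"
        using commutator_central_if_derived_centralized[OF Cs _ _ that] DK KC K_cent by blast
      then show ?thesis using DZN commutator_derived Cc that by blast
    qed
    have GC_card: "card (carrier G) = p * card C"
      unfolding C_def using card_cent_index[OF Ns cN b(3) bZ] .
    have C0: "card C > 0" using card_pos[OF Cs] .
    have idx: "card (rcosets C) = p"
    proof -
      have "card (rcosets C) * card C = p * card C"
        using lagrange[OF Cs] GC_card by (simp add: Coset.order_def)
      then show ?thesis using C0 by simp
    qed
    \<comment> \<open>Commutators of \<open>C\<close> lie in the kernel \<open>N\<close>, so the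
      index of \<open>C\<close> bounds \<open>d\<close>; as a nontrivial power of p,
      \<open>d\<close> must equal p.\<close>
    have "d \<le> p" using A.degree_le_index[OF Cs] commutatorC kerA idx by simp
    moreover have "d = p ^ 1"
    proof -
      have "d dvd card (carrier G)" using dK by (metis dvd_triv_left dvd_trans power2_eq_square)
      then obtain i where i: "d = p ^ i" using divides_primepow_nat[OF prime] card_carrier by auto
      have "p ^ i \<le> p ^ 1" using \<open>d \<le> p\<close> i by simp
      then have "i \<le> 1" using p_gt_1 power_increasing_iff by blast
      moreover have "i \<noteq> 0" using i d1 by (intro notI) simp
      ultimately have "i = 1" by simp
      then show ?thesis using i by blast
    qed
    ultimately have dp: "d = p" by simp
    \<comment> \<open>With \<open>d = p\<close>, the order of G is both p squared times that of
      \<open>K\<close> and p times that of \<open>C\<close>. So \<open>K\<close>, which is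
      centralized by \<open>C\<close>, has prime index in \<open>C\<close>, and \<open>C\<close> is
      abelian.\<close>
    have "p * card C = p * (p * card K)" using dK GC_card unfolding dp power2_eq_square by (simp only: mult.assoc)
    then have CK: "card C = p * card K" using p_gt_1 by simp
    have "card K > 0" using card_pos[OF Ks] .
    then have "card C > card K" using CK p_gt_1 by simp
    then have "\<not> C \<subseteq> K" using KC by auto
    then obtain c where c: "c \<in> C" "c \<notin> K" by blast
    note prime_idx_C = subgroup_subset_if_prime_index[OF finite_carrier prime Ks Cs KC CK c centralizer_subgroup]
    have "c \<in> centralizer c" unfolding centralizer_def using Cc c by simp
    then have Cc_cent: "C \<subseteq> centralizer c" using prime_idx_C[OF Cc[OF c(1)] K_cent[OF c(1)]] by blast
    have abel: "commutator G x y = \<one>" if x: "x \<in> C" and y: "y \<in> C" for x y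
    proof -
      have "c \<in> centralizer y" using Cc_cent y centralizer_sym[OF Cc[OF c(1)] Cc[OF y]] by blast
      then have "C \<subseteq> centralizer y" using prime_idx_C[OF Cc[OF y] K_cent[OF y]] by blast
      then show ?thesis using centralizer_iff_commutator[OF Cc[OF x] Cc[OF y]] x by blast
    qed
    have "e \<le> p"
      using B.degree_le_index[OF Cs] abel subgroup.one_closed[OF B.ker_subgroup] idx by simp
    \<comment> \<open>A commutator with \<open>b\<close> acts as a nontrivial p-th root of unity,
      and by the determinant its e-th power is 1.\<close>
    moreover have "p dvd e"
    proof -
      obtain g where g: "g \<in> carrier G" "commutator G b g \<noteq> \<one>"
        using bZ bc unfolding group_center_eq_center_mod center_mod_def by blast
      let ?z = "commutator G g b"
      have z1: "?z \<noteq> \<one>" using g commutator_eq_one_iff[OF g(1) bc] commutator_eq_one_iff[OF bc g(1)] by auto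
      have zN: "?z \<in> N" using b(3) commutator_flip[OF Ns g(1) bc] g(1) unfolding center_mod_def by blast
      have zs: "?z \<in> B.scal" using zN NZ B.center_scal by blast
      have "?z \<notin> B.ker" using subset_if_card_p[OF Ns cN B.ker_subgroup zN _ z1] N(3) aB by blast
      then have ev1: "B.ev ?z ^ (p ^ 0) \<noteq> 1" using B.ker_iff zs by auto
      have "B.ev ?z ^ (p ^ Suc 0) = 1"
        using B.scal_pow(2)[OF zs, of p] powN[OF zN] B.ev_one by simp
      then show ?thesis
        using root_of_unity_power_iff[OF prime _ ev1, of e] B.ev_commutator_power_degree[OF g(1) bc zs] by simp
    qed
    then have "p \<le> e" using B.degree_pos by (intro dvd_imp_le)
    ultimately show False using ed dp by simp
  qed
qed

end

theorem theorem3p1: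
  fixes P :: "('a, 'b) monoid_scheme" and p :: nat
  assumes "group P" and "finite (carrier P)" and "prime p"
    and "\<exists>k. card (carrier P) = p ^ k"
    and "\<not> comm_group P"
  shows "GC_star P \<longleftrightarrow>
           cyclic_subset P (group_center P) \<and> card (derived P (carrier P)) = p"
proof -
  obtain k where "card (carrier P) = p ^ k" using assms(4) by blast
  then interpret pgroup P p k
    using assms(1-3) unfolding pgroup_def pgroup_axioms_def by blast
  let ?D = "derived P (carrier P)"
  have D1: "?D \<noteq> {\<one>\<^bsub>P\<^esub>}"
  proof
    assume eq: "?D = {\<one>\<^bsub>P\<^esub>}"
    have "x \<otimes>\<^bsub>P\<^esub> y = y \<otimes>\<^bsub>P\<^esub> x" if "x \<in> carrier P" "y \<in> carrier P" for x y
      using commutator_derived[OF that] eq commutator_eq_one_iff[OF that] by simp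
    then have "comm_group P" by (intro group_comm_groupI) auto
    then show False using assms(5) by simp
  qed
  have "card ?D = p" if GC: "GC_star P"
  proof (rule ccontr)
    assume np: "card ?D \<noteq> p"
    obtain N where N: "N \<lhd> P" "N \<subseteq> ?D" "card ?D = p * card N"
      using normal_index_p_exists[OF derived_self_is_normal D1] by blast
    have "N \<noteq> {\<one>\<^bsub>P\<^esub>}" using N np by auto
    \<comment> \<open>Two steps of index p, both normal in the whole group, make \<open>M\<close> of
      index p squared in the derived subgroup; dividing by it gives a quotient whose derived
      subgroup has order p squared.\<close>
    then obtain M where M: "M \<lhd> P" "M \<subseteq> N" "card N = p * card M"
      using normal_index_p_exists[OF N(1)] by blast
    interpret M: normal M P by fact
    obtain j where "pgroup (P Mod M) p j" using pgroup_Mod[OF M(1)] by blast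
    then interpret Q: pgroup "P Mod M" p j .
    interpret h: group_hom P "P Mod M" "\<lambda>x. M #>\<^bsub>P\<^esub> x"
      unfolding group_hom_def group_hom_axioms_def
      using M.r_coset_hom_Mod M.factorgroup_is_group is_group by auto
    have "derived (P Mod M) (carrier (P Mod M)) = (\<lambda>x. M #>\<^bsub>P\<^esub> x) ` ?D"
      using h.derived_img[of "carrier P"] unfolding carrier_FactGroup by simp
    also have "\<dots> = rcosets\<^bsub>P\<lparr>carrier := ?D\<rparr>\<^esub> M"
      unfolding RCOSETS_def r_coset_def by auto
    finally have im: "derived (P Mod M) (carrier (P Mod M)) = rcosets\<^bsub>P\<lparr>carrier := ?D\<rparr>\<^esub> M" .
    interpret D: group "P\<lparr>carrier := ?D\<rparr>" using subgroup_imp_group[OF derived_subgroup] .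
    have "subgroup M (P\<lparr>carrier := ?D\<rparr>)"
      using subgroup_incl[OF M.is_subgroup derived_subgroup] M N by blast
    then have "card (rcosets\<^bsub>P\<lparr>carrier := ?D\<rparr>\<^esub> M) * card M = card ?D"
      using D.lagrange by (simp add: Coset.order_def)
    also have "\<dots> = p\<^sup>2 * card M" using N M by (simp add: power2_eq_square)
    finally have "card (derived (P Mod M) (carrier (P Mod M))) = p\<^sup>2"
      using im card_pos[OF M.is_subgroup] by simp
    then show False
      using Q.GC_star_derived_not_p_square[OF GC_star_Mod[OF GC M(1)]] by blast
  qed
  then show ?thesis using cyclic_center_if_GC_star GC_star_if_cyclic_center by blast
qed

end
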